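(* The Group Epimorphism Problem restricted to input pairs $(G_1,G_2)$ with $G_1,G_2\in\mathrm{Coprime}(\mathrm{ElemAb},\mathrm{ElemAb})$ is polynomial-time many-one equivalent to the problem SInducedRepEpivalent; that is, each of the two problems is reducible to the other by a polynomial-time many-one reduction.
   Context: All groups are finite. For classes of finite groups $X$ and $Y$, $\mathrm{Coprime}(X,Y)$ denotes the class of finite groups $G$ having a normal subgroup $N\in X$ and a complement $H\in Y$ of $N$ in $G$ (i.e. $G=NH$, $N\cap H=1$) such that $\gcd(|N|,|H|)=1$. $\mathrm{ElemAb}$ is the class of elementary Abelian groups. Group Epimorphism Problem: given two finite groups $G_1,G_2$ by their multiplication (Cayley) tables, decide whether there exists a surjective homomorphism $G_1\to G_2$. SInducedRepEpivalent: given two representations $\tau:H_1\to \mathrm{GL}(m_1,\mathbb{Z}_p)=\mathrm{Aut}(\mathbb{Z}_p^{m_1})$ and $\gamma:H_2\to \mathrm{GL}(m_2,\mathbb{Z}_p)=\mathrm{Aut}(\mathbb{Z}_p^{m_2})$, where $H_1,H_2$ are elementary Abelian $q$-groups and $p,q$ are distinct primes, decide whether there exist a surjective homomorphism $\phi:H_1\to H_2$ and a surjective linear map $\rho:\mathbb{Z}_p^{m_1}\to\mathbb{Z}_p^{m_2}$ such that $\rho\circ\tau(h)=\gamma(\phi(h))\circ\rho$ for all $h\in H_1$. The size of such an instance is measured by $p^{m_1}|H_1|+p^{m_2}|H_2|$, the sum of the orders of the associated semidirect products. *)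

theory Defs
  imports
    "HOL-Algebra.Coset"
    "HOL-Computational_Algebra.Primes"
    "HOL-Computational_Algebra.Polynomial"
    "HOL-Library.Log_Nat"
    "HOL-Library.More_List"
    "Jordan_Normal_Form.Matrix"
begin

section \<open>Random access machines\<close>

text \<open>
  The machine model is the unit-cost random access machine whose arithmetic is
  restricted to addition and (truncated) subtraction. It is well known to be
  polynomially equivalent to multi-tape Turing machines; there is deliberately
  no multiplication, which would break that equivalence. Two presentational
  choices, both affecting running times only by a constant factor that depends
  on the program: programs are structured instead of using jumps, and the
  memory is split into arrays. A program mentions array names only as
  constants, so it uses finitely many of them.
\<close>

type_synonym mem = "nat \<Rightarrow> nat \<Rightarrow> nat"

datatype expr =
    Const nat
  | Get nat expr
  | Add expr expr
  | Sub expr expr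

primrec eval :: "mem \<Rightarrow> expr \<Rightarrow> nat" where
  "eval M (Const n) = n"
| "eval M (Get a e) = M a (eval M e)"
| "eval M (Add e1 e2) = eval M e1 + eval M e2"
| "eval M (Sub e1 e2) = eval M e1 - eval M e2"

datatype prog =
    Skip
  | Put nat expr expr
  | Write expr
  | Seq prog prog
  | Cond expr expr prog prog
  | Loop expr expr prog

text \<open>
  \<open>exec c (M, out) t (M', out')\<close>: started with memory \<open>M\<close> and output tape \<open>out\<close>,
  the program \<open>c\<close> halts after \<open>t\<close> steps with memory \<open>M'\<close> and output tape \<open>out'\<close>.
  The tests of \<open>Cond\<close> and \<open>Loop\<close> are strict inequalities. The output is written
  one number at a time, so that its length is bounded by the running time.
\<close>

inductive exec :: "prog \<Rightarrow> mem \<times> nat list \<Rightarrow> nat \<Rightarrow> mem \<times> nat list \<Rightarrow> bool" where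
  Skip: "exec Skip s 1 s"
| Put: "exec (Put a e1 e2) (M, out) 1 (M(a := (M a)(eval M e1 := eval M e2)), out)"
| Write: "exec (Write e) (M, out) 1 (M, out @ [eval M e])"
| Seq: "exec c1 s t1 s' \<Longrightarrow> exec c2 s' t2 s'' \<Longrightarrow> exec (Seq c1 c2) s (t1 + t2) s''"
| Cond_True: "eval (fst s) e1 < eval (fst s) e2 \<Longrightarrow> exec c1 s t s'
    \<Longrightarrow> exec (Cond e1 e2 c1 c2) s (Suc t) s'"
| Cond_False: "\<not> eval (fst s) e1 < eval (fst s) e2 \<Longrightarrow> exec c2 s t s'
    \<Longrightarrow> exec (Cond e1 e2 c1 c2) s (Suc t) s'"
| Loop_True: "eval (fst s) e1 < eval (fst s) e2 \<Longrightarrow> exec c s t s'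
    \<Longrightarrow> exec (Loop e1 e2 c) s' t' s'' \<Longrightarrow> exec (Loop e1 e2 c) s (Suc (t + t')) s''"
| Loop_False: "\<not> eval (fst s) e1 < eval (fst s) e2 \<Longrightarrow> exec (Loop e1 e2 c) s 1 s"

text \<open>The input, preceded by its length, is in array 0; all other cells are 0.\<close>

definition init_mem :: "nat list \<Rightarrow> mem" where
  "init_mem xs = (\<lambda>a. if a = 0 then nth_default 0 (length xs # xs) else (\<lambda>_. 0))"

definition computes_in :: "prog \<Rightarrow> nat list \<Rightarrow> nat \<Rightarrow> nat list \<Rightarrow> bool" where
  "computes_in c xs t ys \<longleftrightarrow> (\<exists>M. exec c (init_mem xs, []) t (M, ys))"


section \<open>Decision problems and polynomial-time many-one reductions\<close>

text \<open>
  A decision problem has a set of admissible instances, a set of positive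
  instances (only its intersection with the admissible ones matters), an encoding
  of instances as input of a machine, and a size measure with respect to which
  running times are bounded.
\<close>

record 'a problem =
  instances :: "'a set"
  positive :: "'a set"
  encode :: "'a \<Rightarrow> nat list"
  inst_size :: "'a \<Rightarrow> nat"

definition restrict_problem :: "'a problem \<Rightarrow> ('a \<Rightarrow> bool) \<Rightarrow> 'a problem" where
  "restrict_problem A C = A\<lparr>instances := {x \<in> instances A. C x}\<rparr>"

text \<open>
  As \<^const>\<open>inst_size\<close> need not be the length of the encoding, the size of
  the produced instance is required separately to be polynomially bounded. This is
  also what makes reductions compose.
\<close>

definition poly_time_reducible :: "'a problem \<Rightarrow> 'b problem \<Rightarrow> bool"  (infix "\<le>\<^sub>p" 50) where
  "A \<le>\<^sub>p B \<longleftrightarrow>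
     (\<exists>f c. \<exists>P Q :: nat poly. \<forall>x \<in> instances A.
        f x \<in> instances B \<and>
        (x \<in> positive A \<longleftrightarrow> f x \<in> positive B) \<and>
        inst_size B (f x) \<le> poly Q (inst_size A x) \<and>
        (\<exists>t \<le> poly P (inst_size A x). computes_in c (encode A x) t (encode B (f x))))"

definition bit_size :: "nat list \<Rightarrow> nat" where
  "bit_size xs = (\<Sum>x\<leftarrow>xs. Suc (floorlog 2 x))"


section \<open>Classes of finite groups\<close>

definition elementary_abelian :: "nat \<Rightarrow> ('a, 'b) monoid_scheme \<Rightarrow> bool" where
  "elementary_abelian q G \<longleftrightarrow>
     prime q \<and> comm_group G \<and> finite (carrier G) \<and> (\<forall>x \<in> carrier G. x [^]\<^bsub>G\<^esub> q = \<one>\<^bsub>G\<^esub>)"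

definition ElemAb :: "('a, 'b) monoid_scheme \<Rightarrow> bool" where
  "ElemAb G \<longleftrightarrow> (\<exists>q. elementary_abelian q G)"

definition Coprime ::
  "(('a, 'b) monoid_scheme \<Rightarrow> bool) \<Rightarrow> (('a, 'b) monoid_scheme \<Rightarrow> bool)
     \<Rightarrow> ('a, 'b) monoid_scheme \<Rightarrow> bool" where
  "Coprime X Y G \<longleftrightarrow> group G \<and> finite (carrier G) \<and>
     (\<exists>N H. N \<lhd> G \<and> subgroup H G \<and> X (G\<lparr>carrier := N\<rparr>) \<and> Y (G\<lparr>carrier := H\<rparr>) \<and>
        N <#>\<^bsub>G\<^esub> H = carrier G \<and> N \<inter> H = {\<one>\<^bsub>G\<^esub>} \<and> coprime (card N) (card H))"


section \<open>The Group Epimorphism Problem\<close>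

text \<open>
  A multiplication table of order \<open>n\<close> is an \<open>n\<close> by \<open>n\<close> matrix. The elements are
  the indices below \<open>n\<close>; the neutral element may be any of them.
\<close>

definition table_group :: "nat mat \<Rightarrow> nat monoid" where
  "table_group T =
     \<lparr>carrier = {..<dim_row T},
      monoid.mult = (\<lambda>x y. T $$ (x, y)),
      one = (THE e. e < dim_row T \<and> (\<forall>x < dim_row T. T $$ (e, x) = x \<and> T $$ (x, e) = x))\<rparr>"

definition cayley_table :: "nat mat \<Rightarrow> bool" where
  "cayley_table T \<longleftrightarrow> square_mat T \<and> group (table_group T)"

definition mat_entries :: "'a mat \<Rightarrow> 'a list" where
  "mat_entries A = concat (mat_to_list A)"

definition encode_tables :: "nat mat \<times> nat mat \<Rightarrow> nat list" where
  "encode_tables = (\<lambda>(T1, T2). [dim_row T1, dim_row T2] @ mat_entries T1 @ mat_entries T2)"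

definition GroupEpi :: "(nat mat \<times> nat mat) problem" where
  "GroupEpi =
     \<lparr>instances = {(T1, T2). cayley_table T1 \<and> cayley_table T2},
      positive = {(T1, T2). epi (table_group T1) (table_group T2) \<noteq> {}},
      encode = encode_tables,
      inst_size = (\<lambda>x. bit_size (encode_tables x))\<rparr>"

definition GroupEpi_on :: "(nat monoid \<Rightarrow> bool) \<Rightarrow> (nat mat \<times> nat mat) problem" where
  "GroupEpi_on C = restrict_problem GroupEpi (\<lambda>(T1, T2). C (table_group T1) \<and> C (table_group T2))"


section \<open>Epivalence of representations\<close>

text \<open>
  The field with \<open>p\<close> elements is represented by the residues \<open>0, \<dots>, p - 1\<close>, and vectors
  and matrices over it by vectors and matrices with such entries.
\<close>

definition vec_mod :: "nat \<Rightarrow> nat vec \<Rightarrow> nat vec" where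
  "vec_mod p = map_vec (\<lambda>x. x mod p)"

definition mat_mod :: "nat \<Rightarrow> nat mat \<Rightarrow> nat mat" where
  "mat_mod p = map_mat (\<lambda>x. x mod p)"

definition Zp_vec :: "nat \<Rightarrow> nat \<Rightarrow> nat vec set" where
  "Zp_vec p m = {v \<in> carrier_vec m. \<forall>i < m. v $ i < p}"

definition Zp_mat :: "nat \<Rightarrow> nat \<Rightarrow> nat mat set" where
  "Zp_mat p m = {A \<in> carrier_mat m m. \<forall>i < m. \<forall>j < m. A $$ (i, j) < p}"

definition GL :: "nat \<Rightarrow> nat \<Rightarrow> nat mat monoid" where
  "GL m p =
     \<lparr>carrier = {A \<in> Zp_mat p m. \<exists>B \<in> Zp_mat p m.
                   mat_mod p (A * B) = 1\<^sub>m m \<and> mat_mod p (B * A) = 1\<^sub>m m},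
      monoid.mult = (\<lambda>A B. mat_mod p (A * B)),
      one = 1\<^sub>m m\<rparr>"

definition Zp_linear :: "nat \<Rightarrow> nat \<Rightarrow> nat \<Rightarrow> (nat vec \<Rightarrow> nat vec) \<Rightarrow> bool" where
  "Zp_linear p m n \<rho> \<longleftrightarrow>
     \<rho> \<in> Zp_vec p m \<rightarrow> Zp_vec p n \<and>
     (\<forall>u \<in> Zp_vec p m. \<forall>v \<in> Zp_vec p m. \<rho> (vec_mod p (u + v)) = vec_mod p (\<rho> u + \<rho> v)) \<and>
     (\<forall>c < p. \<forall>v \<in> Zp_vec p m. \<rho> (vec_mod p (c \<cdot>\<^sub>v v)) = vec_mod p (c \<cdot>\<^sub>v \<rho> v))"

text \<open>
  A representation is given by the multiplication table of the group and the list
  of the matrices of its elements.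
\<close>

record rep =
  grp :: "nat mat"
  rep_dim :: nat
  rep_mats :: "nat mat list"

definition is_rep :: "nat \<Rightarrow> rep \<Rightarrow> bool" where
  "is_rep p R \<longleftrightarrow> cayley_table (grp R) \<and> length (rep_mats R) = dim_row (grp R) \<and>
     (\<lambda>h. rep_mats R ! h) \<in> hom (table_group (grp R)) (GL (rep_dim R) p)"

text \<open>An instance \<open>(p, R1, R2)\<close> consists of the prime and the two representations.\<close>

type_synonym rep_pair = "nat \<times> rep \<times> rep"

definition rep_pair_valid :: "rep_pair \<Rightarrow> bool" where
  "rep_pair_valid = (\<lambda>(p, R1, R2). prime p \<and> is_rep p R1 \<and> is_rep p R2 \<and>
     (\<exists>q. q \<noteq> p \<and> elementary_abelian q (table_group (grp R1))
             \<and> elementary_abelian q (table_group (grp R2))))"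

definition epivalent :: "rep_pair \<Rightarrow> bool" where
  "epivalent = (\<lambda>(p, R1, R2).
     \<exists>\<phi> \<in> epi (table_group (grp R1)) (table_group (grp R2)).
     \<exists>\<rho>. Zp_linear p (rep_dim R1) (rep_dim R2) \<rho> \<and>
         \<rho> ` Zp_vec p (rep_dim R1) = Zp_vec p (rep_dim R2) \<and>
         (\<forall>h \<in> carrier (table_group (grp R1)). \<forall>v \<in> Zp_vec p (rep_dim R1).
            \<rho> (vec_mod p ((rep_mats R1 ! h) *\<^sub>v v)) = vec_mod p ((rep_mats R2 ! \<phi> h) *\<^sub>v \<rho> v)))"

definition encode_rep :: "rep \<Rightarrow> nat list" where
  "encode_rep R = [rep_dim R, dim_row (grp R)] @ mat_entries (grp R)
     @ concat (map mat_entries (rep_mats R))"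

definition encode_rep_pair :: "rep_pair \<Rightarrow> nat list" where
  "encode_rep_pair = (\<lambda>(p, R1, R2). p # encode_rep R1 @ encode_rep R2)"

definition rep_pair_size :: "rep_pair \<Rightarrow> nat" where
  "rep_pair_size = (\<lambda>(p, R1, R2).
     p ^ rep_dim R1 * Coset.order (table_group (grp R1)) + p ^ rep_dim R2 * Coset.order (table_group (grp R2)))"

definition SInducedRepEpivalent :: "rep_pair problem" where
  "SInducedRepEpivalent =
     \<lparr>instances = {x. rep_pair_valid x},
      positive = {x. epivalent x},
      encode = encode_rep_pair,
      inst_size = rep_pair_size\<rparr>"

end

(*
  Let G be a finite group with a normal subgroup N and a complement, both elementary abelian, for
  primes p and q. If p and q differ, then N consists of the elements x with x^p = 1, so an
  epimorphism of two such groups (for the same p and q) maps the first N onto the second and induces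
  an epimorphism of the quotients; these two maps form an epivalence. Conversely, an epivalence
  extends to an epimorphism by means of the complements. Since only the action of G/N on N matters,
  no complement has to be computed: coset representatives suffice.

  The primes are found by exhaustive search: G is suitable for (p, q) iff the solutions of x^p = 1
  are closed under multiplication and every x^q is a solution. Suitability passes to quotients, so
  if no pair of primes suits both groups, there is no epimorphism. A basis of N is built greedily;
  adjoining x to b_0, ..., b_(m-1) continues the enumeration E of the spanned subgroup, in which
  E(i) is the product of the b_k raised to the k-th base-p digit of i, by E(i + p^m) = E(i) x.
*)

theory Submission
  imports Defs "HOL-Algebra.Multiplicative_Group" "HOL-Algebra.Sylow" "HOL-Number_Theory.Cong"
begin

text \<open>One pair of primes has to serve both groups, and the decompositions provided by the
  class do not determine it: a direct product of an elementary abelian p-group and an elementary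
  abelian q-group splits in either order, and a trivial factor admits any prime. Therefore
  suitability speaks of the torsion alone, without reference to a chosen normal subgroup, and the
  pair is sought for both groups at once. The factor given as complement may thereby become the
  torsion. As trivial factors leave primes free, the search extends slightly beyond the orders, so
  that 2 and 3 are always in range.

  The machine neither multiplies nor divides. Products are repeated additions, addresses of rows are
  tabulated, and quotients by p are looked up in tables filled by counting. Running times are
  treated uniformly: it suffices to bound the length of every single loop by the size of the
  instance plus a constant, because the loops of a fixed program are nested to a fixed
  depth.\<close>

hide_const (open) UnivPoly.eval

section \<open>Programs and their weakest preconditions\<close>

text \<open>
  \<open>wp B c Q M out\<close> says that \<open>c\<close>, started in \<open>(M, out)\<close>, halts in a state satisfying \<open>Q\<close>
  and that no loop makes more than \<open>B\<close> iterations in a row. The running time is then at most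
  \<open>cost B c\<close>, a polynomial in \<open>B\<close> that depends only on the program.
\<close>

primrec cost :: "nat \<Rightarrow> prog \<Rightarrow> nat" where
  "cost B Skip = 1"
| "cost B (Put a e1 e2) = 1"
| "cost B (Write e) = 1"
| "cost B (Seq c1 c2) = cost B c1 + cost B c2"
| "cost B (Cond e1 e2 c1 c2) = Suc (cost B c1 + cost B c2)"
| "cost B (Loop e1 e2 c) = Suc (B * Suc (cost B c))"

text \<open>Each loop multiplies by \<open>B\<close> once, so the degree is governed by the nesting
  depth of the loops, which is fixed with the program.\<close>

lemma cost_poly: "\<exists>P. \<forall>B. cost B c = poly P B"
proof (induction c)
  case (Seq c1 c2)
  then obtain P1 P2 where "\<forall>B. cost B c1 = poly P1 B" "\<forall>B. cost B c2 = poly P2 B" by blast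
  then show ?case by (intro exI[of _ "P1 + P2"]) simp
next
  case (Cond e1 e2 c1 c2)
  then obtain P1 P2 where "\<forall>B. cost B c1 = poly P1 B" "\<forall>B. cost B c2 = poly P2 B" by blast
  then show ?case by (intro exI[of _ "1 + P1 + P2"]) simp
next
  case (Loop e1 e2 c)
  then obtain P where "\<forall>B. cost B c = poly P B" by blast
  then show ?case by (intro exI[of _ "1 + [:0, 1:] * (1 + P)"]) (simp add: algebra_simps)
qed (auto intro: exI[of _ "1 :: nat poly"])

text \<open>Whole arrays are the units of the frame condition. They can be read off from the program
  because array names occur in it only as constants.\<close>

primrec writes :: "prog \<Rightarrow> nat set" where
  "writes Skip = {}"
| "writes (Put a e1 e2) = {a}"
| "writes (Write e) = {}"
| "writes (Seq c1 c2) = writes c1 \<union> writes c2"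
| "writes (Cond e1 e2 c1 c2) = writes c1 \<union> writes c2"
| "writes (Loop e1 e2 c) = writes c"

primrec reads :: "expr \<Rightarrow> nat set" where
  "reads (Const n) = {}"
| "reads (Get a e) = insert a (reads e)"
| "reads (Add e1 e2) = reads e1 \<union> reads e2"
| "reads (Sub e1 e2) = reads e1 \<union> reads e2"

lemma eval_cong: "(\<And>a. a \<in> reads e \<Longrightarrow> M a = M' a) \<Longrightarrow> eval M e = eval M' e"
  by (induction e) auto

type_synonym post = "mem \<Rightarrow> nat list \<Rightarrow> bool"

text \<open>Counting the passes exactly turns the semantics of a loop into a recursion on numbers
  instead of a fixed point; termination is built in.\<close>

primrec iter :: "nat \<Rightarrow> (mem \<Rightarrow> bool) \<Rightarrow> (post \<Rightarrow> post) \<Rightarrow> post \<Rightarrow> post" where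
  "iter 0 b f Q = (\<lambda>M out. \<not> b M \<and> Q M out)"
| "iter (Suc n) b f Q = (\<lambda>M out. b M \<and> f (iter n b f Q) M out)"

primrec wp :: "nat \<Rightarrow> prog \<Rightarrow> post \<Rightarrow> post" where
  "wp B Skip = (\<lambda>Q. Q)"
| "wp B (Put a e1 e2) = (\<lambda>Q M out. Q (M(a := (M a)(eval M e1 := eval M e2))) out)"
| "wp B (Write e) = (\<lambda>Q M out. Q M (out @ [eval M e]))"
| "wp B (Seq c1 c2) = (\<lambda>Q. wp B c1 (wp B c2 Q))"
| "wp B (Cond e1 e2 c1 c2) =
    (\<lambda>Q M out. if eval M e1 < eval M e2 then wp B c1 Q M out else wp B c2 Q M out)"
| "wp B (Loop e1 e2 c) =
    (\<lambda>Q M out. \<exists>n \<le> B. iter n (\<lambda>M. eval M e1 < eval M e2) (wp B c) Q M out)"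

lemma wp_sound:
  "wp B c Q M out \<Longrightarrow> \<exists>t M' out'. exec c (M, out) t (M', out') \<and> t \<le> cost B c \<and> Q M' out'"
proof (induction c arbitrary: Q M out)
  case Skip
  then show ?case using exec.Skip by fastforce
next
  case (Put a e1 e2)
  then show ?case using exec.Put[of a e1 e2 M out] by fastforce
next
  case (Write e)
  then show ?case using exec.Write[of e M out] by fastforce
next
  case (Seq c1 c2)
  have "wp B c1 (wp B c2 Q) M out" using Seq.prems by simp
  from Seq.IH(1)[OF this]
  obtain t1 M1 o1 where 1: "exec c1 (M, out) t1 (M1, o1)" "t1 \<le> cost B c1" "wp B c2 Q M1 o1"
    by blast
  from Seq.IH(2)[OF 1(3)]
  obtain t2 M2 o2 where 2: "exec c2 (M1, o1) t2 (M2, o2)" "t2 \<le> cost B c2" "Q M2 o2"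
    by blast
  show ?case
    using exec.Seq[OF 1(1) 2(1)] 1(2) 2(2,3)
    by (intro exI[of _ "t1 + t2"] exI[of _ M2] exI[of _ o2]) simp
next
  case (Cond e1 e2 c1 c2)
  show ?case
  proof (cases "eval M e1 < eval M e2")
    case True
    then have "wp B c1 Q M out" using Cond.prems by simp
    from Cond.IH(1)[OF this]
    obtain t M' out' where "exec c1 (M, out) t (M', out')" "t \<le> cost B c1" "Q M' out'" by blast
    with True show ?thesis
      by (intro exI[of _ "Suc t"] exI[of _ M'] exI[of _ out']) (auto intro: exec.Cond_True)
  next
    case False
    then have "wp B c2 Q M out" using Cond.prems by simp
    from Cond.IH(2)[OF this]
    obtain t M' out' where "exec c2 (M, out) t (M', out')" "t \<le> cost B c2" "Q M' out'" by blast
    with False show ?thesis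
      by (intro exI[of _ "Suc t"] exI[of _ M'] exI[of _ out']) (auto intro: exec.Cond_False)
  qed
next
  case (Loop e1 e2 c)
  \<comment> \<open>The inner induction is on the exact number of passes; each costs one test and
    the body, and the failing test accounts for the outer \<open>Suc\<close>.\<close>
  have "\<exists>t M' out'. exec (Loop e1 e2 c) (M, out) t (M', out') \<and> t \<le> Suc (n * Suc (cost B c)) \<and> Q M' out'"
    if "iter n (\<lambda>M. eval M e1 < eval M e2) (wp B c) Q M out" for n
    using that
  proof (induction n arbitrary: M out)
    case 0
    then show ?case using exec.Loop_False[of "(M, out)" e1 e2 c] by fastforce
  next
    case (Suc n)
    then have b: "eval M e1 < eval M e2"
      and "wp B c (iter n (\<lambda>M. eval M e1 < eval M e2) (wp B c) Q) M out"
      by simp_all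
    from Loop.IH[OF this(2)]
    obtain t M1 o1 where 1: "exec c (M, out) t (M1, o1)" "t \<le> cost B c"
        "iter n (\<lambda>M. eval M e1 < eval M e2) (wp B c) Q M1 o1"
      by blast
    from Suc.IH[OF 1(3)]
    obtain t2 M2 o2 where 2: "exec (Loop e1 e2 c) (M1, o1) t2 (M2, o2)"
        "t2 \<le> Suc (n * Suc (cost B c))" "Q M2 o2"
      by blast
    have "exec (Loop e1 e2 c) (M, out) (Suc (t + t2)) (M2, o2)"
      using exec.Loop_True[of "(M, out)"] b 1(1) 2(1) by simp
    then show ?case using 1(2) 2(2,3)
      by (intro exI[of _ "Suc (t + t2)"] exI[of _ M2] exI[of _ o2]) auto
  qed
  then obtain n t M' out' where *: "n \<le> B" "exec (Loop e1 e2 c) (M, out) t (M', out')"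
      "t \<le> Suc (n * Suc (cost B c))" "Q M' out'"
    using Loop.prems unfolding wp.simps by blast
  have "n * Suc (cost B c) \<le> B * Suc (cost B c)" using *(1) by (rule mult_le_mono1)
  then show ?case using * by (intro exI[of _ t] exI[of _ M'] exI[of _ out']) auto
qed

text \<open>The relation \<open>R\<close> will be the frame condition. It has to hold before the
  first pass and to compose along the passes, hence reflexivity and transitivity.\<close>

lemma iter_mono:
  assumes "\<And>Q Q' M out. (\<And>M' o'. R M M' \<Longrightarrow> Q M' o' \<Longrightarrow> Q' M' o') \<Longrightarrow> f Q M out \<Longrightarrow> f Q' M out"
    and "reflp R" "transp R"
    and "\<And>M' o'. R M M' \<Longrightarrow> Q M' o' \<Longrightarrow> Q' M' o'"
    and "iter n b f Q M out"
  shows "iter n b f Q' M out"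
  using assms(4,5)
proof (induction n arbitrary: M out)
  case 0
  then show ?case using \<open>reflp R\<close> by (auto dest: reflpD)
next
  case (Suc n)
  have "f (iter n b f Q) M out" using Suc.prems by simp
  then have "f (iter n b f Q') M out"
  proof (rule assms(1)[rotated])
    fix M' o' assume "R M M'" "iter n b f Q M' o'"
    then show "iter n b f Q' M' o'" using Suc.IH Suc.prems(1) \<open>transp R\<close> by (metis transpD)
  qed
  then show ?case using Suc.prems by simp
qed

text \<open>Rule of consequence and frame rule in one: the weaker postcondition may use that arrays
  outside \<open>writes c\<close> are unchanged, so specifications and invariants need to mention
  only what a program changes.\<close>

lemma wp_conseq:
  assumes "wp B c Q M out"
    and "\<And>M' o'. \<forall>a. a \<notin> writes c \<longrightarrow> M' a = M a \<Longrightarrow> Q M' o' \<Longrightarrow> Q' M' o'"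
  shows "wp B c Q' M out"
  using assms
proof (induction c arbitrary: Q Q' M out)
  case (Seq c1 c2)
  have "wp B c1 (wp B c2 Q) M out" using Seq.prems by simp
  then have "wp B c1 (wp B c2 Q') M out"
    by (rule Seq.IH(1)) (erule Seq.IH(2), simp add: Seq.prems(2))
  then show ?case by simp
next
  case (Cond e1 e2 c1 c2)
  show ?case
  proof (cases "eval M e1 < eval M e2")
    case True
    then have "wp B c1 Q M out" using Cond.prems by simp
    then have "wp B c1 Q' M out" by (rule Cond.IH(1)) (simp add: Cond.prems(2))
    then show ?thesis using True by simp
  next
    case False
    then have "wp B c2 Q M out" using Cond.prems by simp
    then have "wp B c2 Q' M out" by (rule Cond.IH(2)) (simp add: Cond.prems(2))
    then show ?thesis using False by simp
  qed
next
  case (Loop e1 e2 c)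
  let ?R = "\<lambda>M M' :: mem. \<forall>a. a \<notin> writes c \<longrightarrow> M' a = M a"
  obtain n where n: "n \<le> B" "iter n (\<lambda>M. eval M e1 < eval M e2) (wp B c) Q M out"
    using Loop.prems by auto
  have "iter n (\<lambda>M. eval M e1 < eval M e2) (wp B c) Q' M out"
  proof (rule iter_mono[of ?R _ _ Q])
    show "wp B c Q' M out" if "\<And>M' o'. ?R M M' \<Longrightarrow> Q M' o' \<Longrightarrow> Q' M' o'" "wp B c Q M out" for Q Q' M out
      using Loop.IH that by blast
    show "reflp ?R" by (rule reflpI) simp
    show "transp ?R" by (rule transpI) simp
    show "Q' M' o'" if "?R M M'" "Q M' o'" for M' o' using Loop.prems(2) that by simp
  qed (rule n)
  then show ?case using n by auto
qed auto

section \<open>Counting loops, products and quotients\<close>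

abbreviation V :: "nat \<Rightarrow> expr" where "V a \<equiv> Get a (Const 0)"
abbreviation Assign :: "nat \<Rightarrow> expr \<Rightarrow> prog" where "Assign a e \<equiv> Put a (Const 0) e"

definition For :: "nat \<Rightarrow> expr \<Rightarrow> prog \<Rightarrow> prog" where
  "For i e c = Seq (Assign i (Const 0)) (Loop (V i) e (Seq c (Assign i (Add (V i) (Const 1)))))"

lemma writes_For [simp]: "writes (For i e c) = insert i (writes c)"
  by (auto simp: For_def)

text \<open>The bound \<open>e\<close> is evaluated anew at every test, so the loop must not write
  what \<open>e\<close> reads. The postcondition in \<open>step\<close> refers to the state after
  the counter has been raised, since that assignment follows the body.\<close>

lemma wp_For:
  assumes i: "i \<notin> writes c" and e: "reads e \<inter> insert i (writes c) = {}"
    and n: "eval M e = n" "n \<le> B"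
    and base: "I 0 (M(i := (M i)(0 := 0))) out"
    and step: "\<And>k M' o'. k < n \<Longrightarrow> \<forall>a. a \<notin> insert i (writes c) \<longrightarrow> M' a = M a \<Longrightarrow> M' i 0 = k
        \<Longrightarrow> I k M' o' \<Longrightarrow> wp B c (\<lambda>M'' o''. I (Suc k) (M''(i := (M'' i)(0 := Suc k))) o'') M' o'"
    and fin: "\<And>M' o'. \<forall>a. a \<notin> insert i (writes c) \<longrightarrow> M' a = M a \<Longrightarrow> I n M' o' \<Longrightarrow> Q M' o'"
  shows "wp B (For i e c) Q M out"
proof -
  let ?b = "\<lambda>M. eval M (V i) < eval M e"
  let ?c = "Seq c (Assign i (Add (V i) (Const 1)))"
  have ev: "eval M' e = n" if "\<forall>a. a \<notin> insert i (writes c) \<longrightarrow> M' a = M a" for M'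
    using n(1) eval_cong[of e M' M] that e by blast
  \<comment> \<open>Here \<open>k\<close> passes are done and \<open>j\<close> passes are still to
    come.\<close>
  have "iter j ?b (wp B ?c) Q M' o'"
    if "j + k = n" "\<forall>a. a \<notin> insert i (writes c) \<longrightarrow> M' a = M a" "M' i 0 = k" "I k M' o'" for j k M' o'
    using that
  proof (induction j arbitrary: k M' o')
    case 0
    then show ?case using ev[OF 0(2)] fin[OF 0(2)] by simp
  next
    case (Suc j)
    have "k < n" using Suc.prems(1) by simp
    then have "wp B c (\<lambda>M'' o''. I (Suc k) (M''(i := (M'' i)(0 := Suc k))) o'') M' o'"
      using Suc.prems(2-4) by (rule step)
    then have "wp B ?c (iter j ?b (wp B ?c) Q) M' o'"
      unfolding wp.simps
    proof (rule wp_conseq, goal_cases)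
      case (1 M'' o'')
      have *: "M'' i 0 = k" using 1(1) i Suc.prems(3) by simp
      have "iter j ?b (wp B ?c) Q (M''(i := (M'' i)(0 := Suc k))) o''"
      proof (rule Suc.IH)
        show "j + Suc k = n" using Suc.prems(1) by simp
        show "\<forall>a. a \<notin> insert i (writes c) \<longrightarrow> (M''(i := (M'' i)(0 := Suc k))) a = M a"
          using 1(1) Suc.prems(2) by simp
        show "(M''(i := (M'' i)(0 := Suc k))) i 0 = Suc k" by simp
      qed (rule 1(2))
      then show ?case using * by simp
    qed
    moreover have "M' i 0 < eval M' e" using ev[OF Suc.prems(2)] Suc.prems(1,3) by simp
    ultimately show ?case by simp
  qed
  from this[of n 0 "M(i := (M i)(0 := 0))" out]
  have "iter n ?b (wp B ?c) Q (M(i := (M i)(0 := 0))) out" using base by simp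
  then show ?thesis
    unfolding For_def wp.simps eval.simps using n(2) by blast
qed

text \<open>For loops whose only lasting effect is their output. What is known of the memory comes
  from the frame condition, and the invariant is always the output printed so far.\<close>

lemma wp_For_emit:
  assumes "i \<notin> writes c" "reads e \<inter> insert i (writes c) = {}"
    and n: "eval M e = n" "n \<le> B"
    and step: "\<And>k M' o'. k < n \<Longrightarrow> \<forall>a. a \<notin> insert i (writes c) \<longrightarrow> M' a = M a \<Longrightarrow> M' i 0 = k
        \<Longrightarrow> wp B c (\<lambda>M'' o''. o'' = o' @ f k) M' o'"
    and fin: "\<And>M'. \<forall>a. a \<notin> insert i (writes c) \<longrightarrow> M' a = M a \<Longrightarrow> Q M' (out @ concat (map f [0..<n]))"
  shows "wp B (For i e c) Q M out"
proof (rule wp_For[where I = "\<lambda>k M' o'. o' = out @ concat (map f [0..<k])", OF assms(1,2) n])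
  fix k M' o'
  assume "k < n" "\<forall>a. a \<notin> insert i (writes c) \<longrightarrow> M' a = M a" "M' i 0 = k"
    and o': "o' = out @ concat (map f [0..<k])"
  from step[OF this(1-3), of o']
  show "wp B c (\<lambda>M'' o''. o'' = out @ concat (map f [0..<Suc k])) M' o'"
    by (rule wp_conseq) (simp add: o')
next
  fix M' o'
  assume "\<forall>a. a \<notin> insert i (writes c) \<longrightarrow> M' a = M a" "o' = out @ concat (map f [0..<n])"
  then show "Q M' o'" using fin[of M'] by simp
qed simp

primrec block :: "prog list \<Rightarrow> prog" where
  "block [] = Skip"
| "block (c # cs) = Seq c (block cs)"

text \<open>Repeated addition. Only the factor \<open>e1\<close> counts passes and has to be
  bounded, so a factor known to be small is put first and the other one may be large.\<close>

definition MulTo :: "nat \<Rightarrow> nat \<Rightarrow> expr \<Rightarrow> expr \<Rightarrow> prog" where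
  "MulTo z i e1 e2 = Seq (Assign z (Const 0)) (For i e1 (Assign z (Add (V z) e2)))"

lemma writes_MulTo [simp]: "writes (MulTo z i e1 e2) = {z, i}"
  by (auto simp: MulTo_def)

lemma wp_MulTo:
  assumes "z \<noteq> i" "z \<notin> reads e1" "i \<notin> reads e1" "z \<notin> reads e2" "i \<notin> reads e2" "eval M e1 \<le> B"
    and Q: "\<And>M'. \<forall>a. a \<noteq> z \<and> a \<noteq> i \<longrightarrow> M' a = M a \<Longrightarrow> M' z 0 = eval M e1 * eval M e2 \<Longrightarrow> Q M' out"
  shows "wp B (MulTo z i e1 e2) Q M out"
proof -
  let ?M = "M(z := (M z)(0 := 0))"
  have e1: "eval ?M e1 = eval M e1" using assms by (intro eval_cong) auto
  have "wp B (For i e1 (Assign z (Add (V z) e2))) Q ?M out"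
  proof (rule wp_For[where I = "\<lambda>k M' o'. M' z 0 = k * eval M e2 \<and> o' = out"])
    show "i \<notin> writes (Assign z (Add (V z) e2))" using assms by simp
    show "reads e1 \<inter> insert i (writes (Assign z (Add (V z) e2))) = {}" using assms by simp
    show "eval ?M e1 = eval M e1" by (rule e1)
    show "eval M e1 \<le> B" by fact
    show "(?M(i := (?M i)(0 := 0))) z 0 = 0 * eval M e2 \<and> out = out" using assms by simp
  next
    fix k M' o'
    assume fr: "\<forall>a. a \<notin> insert i (writes (Assign z (Add (V z) e2))) \<longrightarrow> M' a = ?M a"
      and I: "M' z 0 = k * eval M e2 \<and> o' = out"
    have "eval M' e2 = eval M e2"
    proof (rule eval_cong)
      fix a assume "a \<in> reads e2"
      then have "a \<noteq> i" "a \<noteq> z" using assms by metis+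
      then show "M' a = M a" using fr by simp
    qed
    then show "wp B (Assign z (Add (V z) e2))
      (\<lambda>M'' o''. (M''(i := (M'' i)(0 := Suc k))) z 0 = Suc k * eval M e2 \<and> o'' = out) M' o'"
      using I assms(1) by simp
  next
    fix M' o'
    assume fr: "\<forall>a. a \<notin> insert i (writes (Assign z (Add (V z) e2))) \<longrightarrow> M' a = ?M a"
      and I: "M' z 0 = eval M e1 * eval M e2 \<and> o' = out"
    then show "Q M' o'" using Q[of M'] by simp
  qed
  then show ?thesis by (simp add: MulTo_def)
qed

definition IfEq :: "expr \<Rightarrow> expr \<Rightarrow> prog \<Rightarrow> prog \<Rightarrow> prog" where
  "IfEq e1 e2 c1 c2 = Cond e1 e2 c2 (Cond e2 e1 c2 c1)"

lemma writes_IfEq [simp]: "writes (IfEq e1 e2 c1 c2) = writes c1 \<union> writes c2"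
  by (auto simp: IfEq_def)

lemma wp_IfEq [simp]:
  "wp B (IfEq e1 e2 c1 c2) Q M out =
    (if eval M e1 = eval M e2 then wp B c1 Q M out else wp B c2 Q M out)"
  by (auto simp: IfEq_def)

text \<open>With the address of each row tabulated, an entry is reached by one addition. The running
  pointer in \<open>d + 12\<close> ends just behind the table.\<close>

definition Offsets :: "nat \<Rightarrow> prog" where
  "Offsets d = For (d + 13) (V (d + 4))
    (Seq (Put (d + 5) (V (d + 13)) (V (d + 12))) (Assign (d + 12) (Add (V (d + 12)) (V (d + 4)))))"

lemma writes_Offsets [simp]: "writes (Offsets d) = {d + 13, d + 5, d + 12}"
  by (auto simp: Offsets_def)

lemma wp_Offsets:
  assumes h: "M (d + 4) 0 = h" "h \<le> B"
    and Q: "\<And>M'. \<forall>a. a \<notin> {d + 13, d + 5, d + 12} \<longrightarrow> M' a = M a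
      \<Longrightarrow> \<forall>g<h. M' (d + 5) g = M (d + 12) 0 + g * h \<Longrightarrow> M' (d + 12) 0 = M (d + 12) 0 + h * h \<Longrightarrow> Q M' out"
  shows "wp B (Offsets d) Q M out"
  unfolding Offsets_def
  by (rule wp_For[where I = "\<lambda>k M' o'. (\<forall>g<k. M' (d + 5) g = M (d + 12) 0 + g * h)
      \<and> M' (d + 12) 0 = M (d + 12) 0 + k * h \<and> o' = out" and n = h])
    (use h in \<open>auto simp: less_Suc_eq intro!: Q\<close>)

text \<open>Division by counting: passing from a number to its successor either raises the remainder
  or resets it and raises the quotient. Entry 0 of both tables is expected to be 0
  beforehand.\<close>

definition DivMod :: "nat \<Rightarrow> prog" where
  "DivMod d = For (d + 13) (V (d + 8))
    (Cond (Add (Get (d + 10) (V (d + 13))) (Const 1)) (V (d + 1))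
      (Seq (Put (d + 10) (Add (V (d + 13)) (Const 1)) (Add (Get (d + 10) (V (d + 13))) (Const 1)))
        (Put (d + 9) (Add (V (d + 13)) (Const 1)) (Get (d + 9) (V (d + 13)))))
      (Seq (Put (d + 10) (Add (V (d + 13)) (Const 1)) (Const 0))
        (Put (d + 9) (Add (V (d + 13)) (Const 1)) (Add (Get (d + 9) (V (d + 13))) (Const 1)))))"

lemma writes_DivMod [simp]: "writes (DivMod d) = {d + 13, d + 10, d + 9}"
  by (auto simp: DivMod_def)

lemma wp_DivMod:
  assumes p: "M (d + 1) 0 = p" "p > 0" and s: "M (d + 8) 0 = s" "s \<le> B"
    and z: "M (d + 9) 0 = 0" "M (d + 10) 0 = 0"
    and Q: "\<And>M'. \<forall>a. a \<notin> {d + 13, d + 10, d + 9} \<longrightarrow> M' a = M a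
      \<Longrightarrow> \<forall>v<s. M' (d + 9) v = v div p \<and> M' (d + 10) v = v mod p \<Longrightarrow> Q M' out"
  shows "wp B (DivMod d) Q M out"
  unfolding DivMod_def
proof (rule wp_For[where I = "\<lambda>k M' o'. (\<forall>v\<le>k. M' (d + 9) v = v div p \<and> M' (d + 10) v = v mod p) \<and> o' = out"
      and n = s], goal_cases)
  case (6 k M' o')
  have p': "M' (d + 1) 0 = p" using 6 p by simp
  show ?case
  proof (cases "k mod p + 1 < p")
    case True
    then have "Suc k div p = k div p" "Suc k mod p = k mod p + 1"
      using div_Suc mod_Suc by auto
    then show ?thesis using 6 p' True by (auto simp: le_Suc_eq)
  next
    case False
    then have "Suc (k mod p) = p" using p mod_less_divisor[of p k] by linarith
    then have "Suc k div p = k div p + 1" "Suc k mod p = 0"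
      using div_Suc mod_Suc by auto
    then show ?thesis using 6 p' False by (auto simp: le_Suc_eq)
  qed
qed (use p s z Q in auto)

text \<open>Nested loops visit the pairs \<open>(v, g)\<close> in the order of the numbers
  \<open>v * h + g\<close>, which is the numbering used for vectors with group elements and for
  matrices stored by rows.\<close>

lemma concat_nested:
  "concat (map (\<lambda>v. concat (map (\<lambda>g. F (v * h + g)) [0..<h])) [0..<s]) = concat (map F [0..<s * h])"
proof (induction s)
  case (Suc s)
  have "[0..<s * h + h] = [0..<s * h] @ map (\<lambda>g. s * h + g) [0..<h]"
    using map_add_upt[of "s * h" h] upt_add_eq_append[of 0 "s * h" h] by (simp add: add.commute)
  then show ?case using Suc by (simp add: add.commute comp_def)
qed simp

lemma mat_entries_altdef:
  "mat_entries A = concat (map (\<lambda>i. map (\<lambda>j. A $$ (i, j)) [0..<dim_col A]) [0..<dim_row A])"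
  by (simp add: mat_entries_def mat_to_list_def)

lemma mat_entries_eq:
  "mat_entries A = map (\<lambda>k. A $$ (k div dim_col A, k mod dim_col A)) [0..<dim_row A * dim_col A]"
proof -
  let ?c = "dim_col A"
  let ?f = "\<lambda>k. A $$ (k div ?c, k mod ?c)"
  have "map (\<lambda>j. A $$ (i, j)) [0..<?c] = concat (map (\<lambda>j. [?f (i * ?c + j)]) [0..<?c])" for i
    unfolding concat_map_singleton by (rule map_cong) auto
  then have "mat_entries A = concat (map (\<lambda>i. concat (map (\<lambda>j. [?f (i * ?c + j)]) [0..<?c])) [0..<dim_row A])"
    unfolding mat_entries_altdef by (rule arg_cong[where f = concat, OF map_cong[OF refl]])
  also have "\<dots> = concat (map (\<lambda>k. [?f k]) [0..<dim_row A * ?c])"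
    by (rule concat_nested)
  also have "\<dots> = map ?f [0..<dim_row A * ?c]"
    by (rule concat_map_singleton)
  finally show ?thesis .
qed

lemma length_mat_entries [simp]: "length (mat_entries A) = dim_row A * dim_col A"
  by (simp add: mat_entries_eq)

lemma mat_entries_nth:
  assumes "i < dim_row A" "j < dim_col A"
  shows "mat_entries A ! (i * dim_col A + j) = A $$ (i, j)"
proof -
  have "i * dim_col A + j < dim_row A * dim_col A"
    using assms mult_le_mono1[of "Suc i" "dim_row A" "dim_col A"] by simp
  then show ?thesis using assms by (simp add: mat_entries_eq)
qed

lemma nth_concat_uniform:
  assumes "\<And>xs. xs \<in> set xss \<Longrightarrow> length xs = l" "i < length xss" "j < l"
  shows "concat xss ! (i * l + j) = xss ! i ! j"
  using assms
proof (induction xss arbitrary: i)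
  case (Cons xs xss)
  then show ?case by (cases i) (auto simp: nth_append)
qed simp

lemma length_concat_uniform:
  "(\<And>xs. xs \<in> set xss \<Longrightarrow> length xs = l) \<Longrightarrow> length (concat xss) = length xss * l"
  by (induction xss) auto

lemma init_mem_Suc: "k < length xs \<Longrightarrow> init_mem xs 0 (Suc k) = xs ! k"
  by (simp add: init_mem_def nth_default_def)

lemma init_mem_other: "a \<noteq> 0 \<Longrightarrow> init_mem xs a = (\<lambda>_. 0)"
  by (simp add: init_mem_def)

text \<open>The bound for the loops may exceed the size by a constant \<open>k\<close>; composing
  the cost polynomial with \<open>[:k, 1:]\<close> absorbs it. The map on instances need not be
  named in advance: it is chosen from the existential postcondition.\<close>

lemma poly_time_reducibleI:
  fixes A :: "'a problem" and B :: "'b problem"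
  assumes c: "\<And>x. x \<in> instances A \<Longrightarrow> wp (inst_size A x + k) c (\<lambda>M out. \<exists>y. out = encode B y \<and> y \<in> instances B
      \<and> (x \<in> positive A \<longleftrightarrow> y \<in> positive B) \<and> inst_size B y \<le> poly Q (inst_size A x)) (init_mem (encode A x)) []"
  shows "A \<le>\<^sub>p B"
proof -
  obtain P where P: "\<forall>n. cost n c = poly P n" using cost_poly by blast
  define ok where "ok x y \<longleftrightarrow> y \<in> instances B \<and> (x \<in> positive A \<longleftrightarrow> y \<in> positive B)
    \<and> inst_size B y \<le> poly Q (inst_size A x)
    \<and> (\<exists>t \<le> poly (pcompose P [:k, 1:]) (inst_size A x). computes_in c (encode A x) t (encode B y))" for x y
  have "\<exists>y. ok x y" if "x \<in> instances A" for x
    using wp_sound[OF c[OF that]] P unfolding ok_def computes_in_def poly_pcompose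
    by (auto simp: add.commute)
  then obtain f where f: "\<And>x. x \<in> instances A \<Longrightarrow> ok x (f x)" by metis
  show ?thesis
    unfolding poly_time_reducible_def
    by (rule exI[of _ f], rule exI[of _ c], rule exI[of _ "pcompose P [:k, 1:]"], rule exI[of _ Q])
      (rule ballI, drule f, simp add: ok_def)
qed

section \<open>Split extensions and representations\<close>

lemma Zp_vecI: "dim_vec v = m \<Longrightarrow> (\<And>i. i < m \<Longrightarrow> v $ i < p) \<Longrightarrow> v \<in> Zp_vec p m"
  by (auto simp: Zp_vec_def)

lemma Zp_vecD: "v \<in> Zp_vec p m \<Longrightarrow> dim_vec v = m" "v \<in> Zp_vec p m \<Longrightarrow> i < m \<Longrightarrow> v $ i < p"
  by (auto simp: Zp_vec_def)

lemma Zp_matD: "A \<in> Zp_mat p m \<Longrightarrow> dim_row A = m" "A \<in> Zp_mat p m \<Longrightarrow> dim_col A = m"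
    "A \<in> Zp_mat p m \<Longrightarrow> i < m \<Longrightarrow> j < m \<Longrightarrow> A $$ (i, j) < p"
  by (auto simp: Zp_mat_def)

lemma vec_mod_index [simp]: "i < dim_vec v \<Longrightarrow> vec_mod p v $ i = v $ i mod p"
  by (simp add: vec_mod_def)

lemma dim_vec_mod [simp]: "dim_vec (vec_mod p v) = dim_vec v"
  by (simp add: vec_mod_def)

lemma vec_mod_Zp_vec: "p > 0 \<Longrightarrow> dim_vec v = m \<Longrightarrow> vec_mod p v \<in> Zp_vec p m"
  by (rule Zp_vecI) auto

lemma vec_mod_ident: "v \<in> Zp_vec p m \<Longrightarrow> vec_mod p v = v"
  by (intro eq_vecI) (auto simp: Zp_vecD)

lemma zero_Zp_vec: "p > 0 \<Longrightarrow> 0\<^sub>v m \<in> Zp_vec p m"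
  by (rule Zp_vecI) auto

lemma mat_mod_index [simp]:
  "i < dim_row A \<Longrightarrow> j < dim_col A \<Longrightarrow> mat_mod p A $$ (i, j) = A $$ (i, j) mod p"
  "dim_row (mat_mod p A) = dim_row A" "dim_col (mat_mod p A) = dim_col A"
  by (simp_all add: mat_mod_def)

lemma mult_mat_vec_index:
  "dim_vec v = dim_col A \<Longrightarrow> i < dim_row A
    \<Longrightarrow> (A *\<^sub>v v) $ i = (\<Sum>j<dim_col A. A $$ (i, j) * v $ j)"
  by (simp add: scalar_prod_def atLeast0LessThan)

lemma sum_mod_cong:
  fixes f g :: "'a \<Rightarrow> nat"
  shows "(\<And>i. i \<in> A \<Longrightarrow> f i mod p = g i mod p) \<Longrightarrow> sum f A mod p = sum g A mod p"
  using sum.cong[of A A "\<lambda>i. f i mod p" "\<lambda>i. g i mod p"] mod_sum_eq[of f p A] mod_sum_eq[of g p A]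
  by simp

lemma vec_mod_mult_vec_mod:
  assumes "dim_vec v = dim_col A"
  shows "vec_mod p (A *\<^sub>v vec_mod p v) = vec_mod p (A *\<^sub>v v)"
proof (rule eq_vecI)
  fix i assume i: "i < dim_vec (vec_mod p (A *\<^sub>v v))"
  have "(\<Sum>j<dim_col A. A $$ (i, j) * (v $ j mod p)) mod p = (\<Sum>j<dim_col A. A $$ (i, j) * v $ j) mod p"
    by (rule sum_mod_cong) (simp add: mod_mult_right_eq)
  moreover have "(\<Sum>j<dim_col A. A $$ (i, j) * vec_mod p v $ j) = (\<Sum>j<dim_col A. A $$ (i, j) * (v $ j mod p))"
    using assms by (intro sum.cong) auto
  ultimately show "vec_mod p (A *\<^sub>v vec_mod p v) $ i = vec_mod p (A *\<^sub>v v) $ i"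
    using i assms by (simp add: mult_mat_vec_index del: index_mult_mat_vec)
qed simp

lemma vec_mod_mat_mod_mult:
  assumes "dim_vec v = dim_col A"
  shows "vec_mod p (mat_mod p A *\<^sub>v v) = vec_mod p (A *\<^sub>v v)"
proof (rule eq_vecI)
  fix i assume i: "i < dim_vec (vec_mod p (A *\<^sub>v v))"
  have "(\<Sum>j<dim_col A. (A $$ (i, j) mod p) * v $ j) mod p = (\<Sum>j<dim_col A. A $$ (i, j) * v $ j) mod p"
    by (rule sum_mod_cong) (simp add: mod_mult_left_eq)
  moreover have "(\<Sum>j<dim_col A. mat_mod p A $$ (i, j) * v $ j) = (\<Sum>j<dim_col A. (A $$ (i, j) mod p) * v $ j)"
    using i by (intro sum.cong) auto
  ultimately show "vec_mod p (mat_mod p A *\<^sub>v v) $ i = vec_mod p (A *\<^sub>v v) $ i"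
    using i assms by (simp add: mult_mat_vec_index del: index_mult_mat_vec)
qed simp

lemma vec_mod_add_cong:
  assumes "dim_vec u = dim_vec v"
  shows "vec_mod p (vec_mod p u + v) = vec_mod p (u + v)"
  using assms by (intro eq_vecI) (auto simp: mod_add_left_eq)

text \<open>Unit vectors pick out the columns; they are reduced because \<open>p > 1\<close>.
  Identities between the matrices of a representation can thus be verified on vectors, that is,
  inside the group.\<close>

lemma Zp_mat_eqI:
  assumes A: "A \<in> Zp_mat p m" and B: "B \<in> Zp_mat p m" and p: "p > 1"
    and eq: "\<And>v. v \<in> Zp_vec p m \<Longrightarrow> vec_mod p (A *\<^sub>v v) = vec_mod p (B *\<^sub>v v)"
  shows "A = B"
proof (rule eq_matI)
  fix i j assume ij: "i < dim_row B" "j < dim_col B"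
  then have ij: "i < m" "j < m" using B by (auto simp: Zp_matD)
  have v: "unit_vec m j \<in> Zp_vec p m" using p ij by (intro Zp_vecI) (auto simp: unit_vec_def)
  have col: "vec_mod p (C *\<^sub>v unit_vec m j) $ i = C $$ (i, j)" if "C \<in> Zp_mat p m" for C
  proof -
    have "(C *\<^sub>v unit_vec m j) $ i = (\<Sum>k<m. C $$ (i, k) * unit_vec m j $ k)"
      using that ij by (subst mult_mat_vec_index) (auto simp: Zp_matD)
    also have "\<dots> = (\<Sum>k<m. if k = j then C $$ (i, k) else 0)"
      using ij by (intro sum.cong) (auto simp: unit_vec_def)
    also have "\<dots> = C $$ (i, j)" using ij by simp
    finally show ?thesis using that ij by (simp add: Zp_matD del: index_mult_mat_vec)
  qed
  show "A $$ (i, j) = B $$ (i, j)" using eq[OF v] col[OF A] col[OF B] by metis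
qed (use A B in \<open>auto simp: Zp_matD\<close>)

lemma epiI: "f \<in> hom G H \<Longrightarrow> f ` carrier G = carrier H \<Longrightarrow> f \<in> epi G H"
  by (simp add: epi_def)

text \<open>In general not a subgroup. That it is closed under multiplication is one of the
  conditions on a suitable pair of primes.\<close>

definition tor :: "('a, 'b) monoid_scheme \<Rightarrow> nat \<Rightarrow> 'a set" where
  "tor G p = {x \<in> carrier G. x [^]\<^bsub>G\<^esub> p = \<one>\<^bsub>G\<^esub>}"

lemma (in group) pow_coprime_one:
  assumes x: "x \<in> carrier G" and "x [^] (a::nat) = \<one>" "x [^] (b::nat) = \<one>" "coprime a b"
  shows "x = \<one>"
proof -
  have "ord x dvd a" "ord x dvd b" using assms pow_eq_id by auto
  then have "ord x = 1" using \<open>coprime a b\<close> coprime_common_divisor_nat by blast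
  then show ?thesis using ord_eq_1[OF x] by simp
qed

lemma elementary_abelianD:
  assumes "elementary_abelian q G"
  shows "prime q" "comm_group G" "group G" "finite (carrier G)"
    "x \<in> carrier G \<Longrightarrow> x [^]\<^bsub>G\<^esub> q = \<one>\<^bsub>G\<^esub>"
  using assms by (auto simp: elementary_abelian_def comm_group.axioms)

text \<open>Sylow's theorem for the exponent 1 yields a subgroup of order \<open>p\<close>. If
  \<open>p\<close> differed from \<open>q\<close>, its non-trivial elements would have the coprime
  exponents \<open>p\<close> and \<open>q\<close>.\<close>

lemma elementary_abelian_order_prime_factor:
  assumes H: "elementary_abelian q H" and p: "prime p" "p dvd card (carrier H)"
  shows "p = q"
proof (rule ccontr)
  assume "p \<noteq> q"
  interpret H: group H using elementary_abelianD(3)[OF H] .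
  have fin: "finite (carrier H)" using elementary_abelianD(4)[OF H] .
  obtain m where m: "Coset.order H = p ^ 1 * m" using p(2) by (auto simp: Coset.order_def)
  obtain K where K: "subgroup K H" "card K = p"
    using sylow_thm[OF p(1) H.is_group m fin] by auto
  have "1 < card K" using K(2) p(1) prime_gt_1_nat by simp
  then have "\<not> K \<subseteq> {\<one>\<^bsub>H\<^esub>}" using card_mono[of "{\<one>\<^bsub>H\<^esub>}" K] by auto
  then obtain x where x: "x \<in> K" "x \<noteq> \<one>\<^bsub>H\<^esub>" by blast
  have Kg: "group (H\<lparr>carrier := K\<rparr>)" by (rule group.subgroup_imp_group[OF elementary_abelianD(3)[OF H] K(1)])
  have xH: "x \<in> carrier H" by (rule subgroup.mem_carrier[OF K(1) x(1)])
  have "x [^]\<^bsub>H\<lparr>carrier := K\<rparr>\<^esub> Coset.order (H\<lparr>carrier := K\<rparr>) = \<one>\<^bsub>H\<lparr>carrier := K\<rparr>\<^esub>"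
    using x(1) by (intro group.pow_order_eq_1[OF Kg]) simp
  then have "x [^]\<^bsub>H\<^esub> p = \<one>\<^bsub>H\<^esub>" using K(2) by (simp add: Coset.order_def flip: H.nat_pow_consistent)
  moreover have "x [^]\<^bsub>H\<^esub> q = \<one>\<^bsub>H\<^esub>" using elementary_abelianD(5)[OF H xH] .
  moreover have "coprime p q" using p(1) elementary_abelianD(1)[OF H] \<open>p \<noteq> q\<close> by (simp add: primes_coprime)
  ultimately show False using H.pow_coprime_one[OF xH] x(2) by blast
qed

text \<open>The common ground of both reductions: \<open>E\<close> writes the torsion of
  \<open>G\<close> additively, \<open>c\<close> is the quotient map, onto the group of the table,
  and \<open>s\<close> is a splitting, whose image is a complement. The splitting exists only in the
  proofs; no program computes it. The condition \<open>act\<close> concerns all elements of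
  \<open>G\<close>, not just those in the image of \<open>s\<close>: as the torsion is abelian,
  conjugation on it depends only on the coset.\<close>

locale split_ext =
  fixes G :: "('a, 'b) monoid_scheme" and p q :: nat and R :: rep
    and E :: "nat vec \<Rightarrow> 'a" and c :: "'a \<Rightarrow> nat" and s :: "nat \<Rightarrow> 'a"
  assumes primes: "prime p" "prime q" "p \<noteq> q"
    and group: "group G" and finite: "finite (carrier G)"
    and table: "cayley_table (grp R)"
    and elem_ab: "elementary_abelian q (table_group (grp R))"
    and length_mats: "length (rep_mats R) = dim_row (grp R)"
    and mats: "\<And>h. h \<in> carrier (table_group (grp R)) \<Longrightarrow> rep_mats R ! h \<in> Zp_mat p (rep_dim R)"
    and E_bij: "bij_betw E (Zp_vec p (rep_dim R)) (tor G p)"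
    and E_add: "\<And>u v. u \<in> Zp_vec p (rep_dim R) \<Longrightarrow> v \<in> Zp_vec p (rep_dim R)
      \<Longrightarrow> E (vec_mod p (u + v)) = E u \<otimes>\<^bsub>G\<^esub> E v"
    and c_hom: "c \<in> hom G (table_group (grp R))"
    and s_hom: "s \<in> hom (table_group (grp R)) G"
    and c_s: "\<And>h. h \<in> carrier (table_group (grp R)) \<Longrightarrow> c (s h) = h"
    and c_one: "\<And>x. x \<in> carrier G \<Longrightarrow> c x = \<one>\<^bsub>table_group (grp R)\<^esub> \<longleftrightarrow> x \<in> tor G p"
    and act: "\<And>x v. x \<in> carrier G \<Longrightarrow> v \<in> Zp_vec p (rep_dim R)
      \<Longrightarrow> E (vec_mod p ((rep_mats R ! c x) *\<^sub>v v)) = x \<otimes>\<^bsub>G\<^esub> E v \<otimes>\<^bsub>G\<^esub> inv\<^bsub>G\<^esub> x"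
begin

abbreviation "H \<equiv> table_group (grp R)"
abbreviation "m \<equiv> rep_dim R"
abbreviation "W \<equiv> Zp_vec p m"

sublocale G: group G using group .
sublocale H: comm_group H using elementary_abelianD(2)[OF elem_ab] .
sublocale c: group_hom G H c by unfold_locales (rule c_hom)
sublocale s: group_hom H G s by unfold_locales (rule s_hom)

lemma p_pos: "p > 0" using primes prime_gt_0_nat by blast

lemma E_tor: "v \<in> W \<Longrightarrow> E v \<in> tor G p" using E_bij bij_betwE by blast
lemma tor_closed: "x \<in> tor G p \<Longrightarrow> x \<in> carrier G" by (simp add: tor_def)
lemma E_closed: "v \<in> W \<Longrightarrow> E v \<in> carrier G" using E_tor tor_closed by blast
lemma E_inj: "u \<in> W \<Longrightarrow> v \<in> W \<Longrightarrow> E u = E v \<Longrightarrow> u = v"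
  using E_bij by (auto simp: bij_betw_def inj_on_def)
lemma E_surj: "x \<in> tor G p \<Longrightarrow> \<exists>v \<in> W. x = E v"
  using E_bij by (auto simp: bij_betw_def)

lemma add_closed: "u \<in> W \<Longrightarrow> v \<in> W \<Longrightarrow> vec_mod p (u + v) \<in> W"
  using p_pos by (intro vec_mod_Zp_vec) (auto simp: Zp_vecD)
lemma act_closed: "h \<in> carrier H \<Longrightarrow> v \<in> W \<Longrightarrow> vec_mod p ((rep_mats R ! h) *\<^sub>v v) \<in> W"
  using p_pos mats[of h] by (intro vec_mod_Zp_vec) (auto dest: Zp_matD)
lemma smult_closed: "v \<in> W \<Longrightarrow> vec_mod p (k \<cdot>\<^sub>v v) \<in> W"
  using p_pos by (intro vec_mod_Zp_vec) (auto simp: Zp_vecD)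

lemma E_zero: "E (0\<^sub>v m) = \<one>\<^bsub>G\<^esub>"
proof -
  have 0: "0\<^sub>v m \<in> W" using p_pos by (rule zero_Zp_vec)
  have "vec_mod p (0\<^sub>v m + 0\<^sub>v m) = 0\<^sub>v m" by (intro eq_vecI) auto
  then have "E (0\<^sub>v m) \<otimes>\<^bsub>G\<^esub> E (0\<^sub>v m) = E (0\<^sub>v m)" using E_add[OF 0 0] by simp
  then show ?thesis using G.l_cancel_one[OF E_closed[OF 0] E_closed[OF 0]] by simp
qed

lemma E_smult: "v \<in> W \<Longrightarrow> E (vec_mod p (k \<cdot>\<^sub>v v)) = E v [^]\<^bsub>G\<^esub> k"
proof (induction k)
  case 0
  have "vec_mod p (0 \<cdot>\<^sub>v v) = 0\<^sub>v m" using 0 by (intro eq_vecI) (auto simp: Zp_vecD)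
  then show ?case using E_zero by simp
next
  case (Suc k)
  have "vec_mod p (Suc k \<cdot>\<^sub>v v) = vec_mod p (vec_mod p (k \<cdot>\<^sub>v v) + v)"
    by (subst vec_mod_add_cong) (auto intro!: arg_cong[of _ _ "vec_mod p"] eq_vecI)
  then show ?case using E_add[OF smult_closed[of v k] \<open>v \<in> W\<close>] Suc by simp
qed

lemma tor_comm: "x \<in> tor G p \<Longrightarrow> y \<in> tor G p \<Longrightarrow> x \<otimes>\<^bsub>G\<^esub> y = y \<otimes>\<^bsub>G\<^esub> x"
proof -
  assume "x \<in> tor G p" "y \<in> tor G p"
  then obtain u v where uv: "u \<in> W" "v \<in> W" "x = E u" "y = E v" using E_surj by metis
  then have "u + v = v + u" by (intro comm_add_vec[of _ m]) (auto simp: Zp_vec_def)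
  then show ?thesis using E_add uv by metis
qed

lemma tor_kernel: "tor G p = kernel G H c"
  using c_one by (auto simp: kernel_def tor_def)

lemma tor_normal: "tor G p \<lhd> G"
  unfolding tor_kernel by (rule c.normal_kernel)

lemma sc: "x \<in> carrier G \<Longrightarrow> s (c x) \<in> carrier G" by simp

lemma tor_part: "x \<in> carrier G \<Longrightarrow> x \<otimes>\<^bsub>G\<^esub> inv\<^bsub>G\<^esub> s (c x) \<in> tor G p"
  using c_one[of "x \<otimes>\<^bsub>G\<^esub> inv\<^bsub>G\<^esub> s (c x)"] c_s by simp

lemma decomp: "x \<in> carrier G \<Longrightarrow> x = (x \<otimes>\<^bsub>G\<^esub> inv\<^bsub>G\<^esub> s (c x)) \<otimes>\<^bsub>G\<^esub> s (c x)"
  by (simp add: G.m_assoc)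

lemma pow_q_tor: "x \<in> carrier G \<Longrightarrow> x [^]\<^bsub>G\<^esub> q \<in> tor G p"
  using c_one[of "x [^]\<^bsub>G\<^esub> q"] elementary_abelianD(5)[OF elem_ab, of "c x"] by (simp add: c.hom_nat_pow)

lemma tor_inter_s: "h \<in> carrier H \<Longrightarrow> s h \<in> tor G p \<Longrightarrow> h = \<one>\<^bsub>H\<^esub>"
  using c_one[of "s h"] c_s by simp

lemma mats_one: "rep_mats R ! \<one>\<^bsub>H\<^esub> = 1\<^sub>m m"
proof (rule Zp_mat_eqI)
  show "1 < p" using primes prime_gt_1_nat by blast
  then show "1\<^sub>m m \<in> Zp_mat p m" by (auto simp: Zp_mat_def)
  fix v assume v: "v \<in> W"
  have "E (vec_mod p (rep_mats R ! \<one>\<^bsub>H\<^esub> *\<^sub>v v)) = E v"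
    using act[of "\<one>\<^bsub>G\<^esub>" v] v E_closed by simp
  then have "vec_mod p (rep_mats R ! \<one>\<^bsub>H\<^esub> *\<^sub>v v) = v"
    using E_inj act_closed v by simp
  also have "v = vec_mod p (1\<^sub>m m *\<^sub>v v)"
    using v vec_mod_ident[OF v] by (subst one_mult_mat_vec) (auto simp: Zp_vec_def)
  finally show "vec_mod p (rep_mats R ! \<one>\<^bsub>H\<^esub> *\<^sub>v v) = vec_mod p (1\<^sub>m m *\<^sub>v v)" .
qed (rule mats, simp)

text \<open>Conjugation by a product is the composite of the conjugations. As \<open>E\<close> is
  injective and a matrix is determined by its action, the same holds for the matrices modulo
  \<open>p\<close>.\<close>

lemma mats_mult:
  assumes h: "h \<in> carrier H" and k: "k \<in> carrier H"
  shows "rep_mats R ! (h \<otimes>\<^bsub>H\<^esub> k) = mat_mod p ((rep_mats R ! h) * (rep_mats R ! k))"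
proof (rule Zp_mat_eqI)
  let ?A = "rep_mats R ! h" and ?B = "rep_mats R ! k"
  have A: "?A \<in> carrier_mat m m" and B: "?B \<in> carrier_mat m m"
    using mats h k by (auto simp: Zp_mat_def)
  show "1 < p" using primes prime_gt_1_nat by blast
  then show "mat_mod p (?A * ?B) \<in> Zp_mat p m"
    using A B by (auto simp: Zp_mat_def mat_mod_def)
  fix v assume v: "v \<in> W"
  let ?x = "s h" and ?y = "s k"
  have xy: "?x \<in> carrier G" "?y \<in> carrier G" using h k by auto
  have "E (vec_mod p (rep_mats R ! (h \<otimes>\<^bsub>H\<^esub> k) *\<^sub>v v)) = (?x \<otimes>\<^bsub>G\<^esub> ?y) \<otimes>\<^bsub>G\<^esub> E v \<otimes>\<^bsub>G\<^esub> inv\<^bsub>G\<^esub> (?x \<otimes>\<^bsub>G\<^esub> ?y)"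
    using act[of "?x \<otimes>\<^bsub>G\<^esub> ?y" v] v xy h k c_s by simp
  also have "\<dots> = ?x \<otimes>\<^bsub>G\<^esub> (?y \<otimes>\<^bsub>G\<^esub> E v \<otimes>\<^bsub>G\<^esub> inv\<^bsub>G\<^esub> ?y) \<otimes>\<^bsub>G\<^esub> inv\<^bsub>G\<^esub> ?x"
    using xy E_closed[OF v] by (simp add: G.inv_mult_group G.m_assoc)
  also have "\<dots> = E (vec_mod p (?A *\<^sub>v vec_mod p (?B *\<^sub>v v)))"
    using act[OF xy(2) v] act[OF xy(1) act_closed[OF k v]] h k c_s by simp
  finally have "vec_mod p (rep_mats R ! (h \<otimes>\<^bsub>H\<^esub> k) *\<^sub>v v) = vec_mod p (?A *\<^sub>v vec_mod p (?B *\<^sub>v v))"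
    by (rule E_inj[rotated 2]) (use act_closed h k v in auto)
  also have "\<dots> = vec_mod p (?A *\<^sub>v (?B *\<^sub>v v))"
    using A B by (intro vec_mod_mult_vec_mod) auto
  also have "?A *\<^sub>v (?B *\<^sub>v v) = (?A * ?B) *\<^sub>v v"
    using A B v by (subst assoc_mult_mat_vec[of _ m m _ m]) (auto simp: Zp_vec_def)
  also have "vec_mod p \<dots> = vec_mod p (mat_mod p (?A * ?B) *\<^sub>v v)"
    using B v by (intro vec_mod_mat_mod_mult[symmetric]) (auto simp: Zp_vecD)
  finally show "vec_mod p (rep_mats R ! (h \<otimes>\<^bsub>H\<^esub> k) *\<^sub>v v) = vec_mod p (mat_mod p (?A * ?B) *\<^sub>v v)" .
qed (use mats h k in auto)

lemma is_rep: "is_rep p R"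
  unfolding is_rep_def
proof (intro conjI table length_mats homI)
  fix h assume h: "h \<in> carrier H"
  have "mat_mod p (rep_mats R ! h * rep_mats R ! (inv\<^bsub>H\<^esub> h)) = 1\<^sub>m m"
    "mat_mod p (rep_mats R ! (inv\<^bsub>H\<^esub> h) * rep_mats R ! h) = 1\<^sub>m m"
    using mats_mult[of h "inv\<^bsub>H\<^esub> h"] mats_mult[of "inv\<^bsub>H\<^esub> h" h] h mats_one by auto
  then show "rep_mats R ! h \<in> carrier (GL m p)"
    using mats h by (auto simp: GL_def intro!: bexI[of _ "rep_mats R ! (inv\<^bsub>H\<^esub> h)"])
next
  fix h k assume "h \<in> carrier H" "k \<in> carrier H"
  then show "rep_mats R ! (h \<otimes>\<^bsub>H\<^esub> k) = (rep_mats R ! h) \<otimes>\<^bsub>GL m p\<^esub> (rep_mats R ! k)"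
    using mats_mult by (simp add: GL_def)
qed

text \<open>The complement of the torsion is the image of \<open>s\<close>. The orders are coprime
  because a common prime factor would equal both \<open>p\<close> and \<open>q\<close>.\<close>

lemma Coprime_ElemAb: "Coprime ElemAb ElemAb G"
proof -
  let ?N = "tor G p" and ?K = "s ` carrier H"
  have K: "subgroup ?K G" by (rule s.img_is_subgroup)
  have N: "subgroup ?N G" using tor_normal normal_imp_subgroup by blast
  have NE: "elementary_abelian p (G\<lparr>carrier := ?N\<rparr>)"
    unfolding elementary_abelian_def
  proof (intro conjI ballI primes)
    show "comm_group (G\<lparr>carrier := ?N\<rparr>)"
      using tor_comm by (intro group.group_comm_groupI G.subgroup_imp_group N) auto
    show "finite (carrier (G\<lparr>carrier := ?N\<rparr>))" using finite by (simp add: tor_def)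
    fix x assume "x \<in> carrier (G\<lparr>carrier := ?N\<rparr>)"
    then show "x [^]\<^bsub>G\<lparr>carrier := ?N\<rparr>\<^esub> p = \<one>\<^bsub>G\<lparr>carrier := ?N\<rparr>\<^esub>"
      using G.nat_pow_consistent[of x p ?N] by (simp add: tor_def)
  qed
  have KE: "elementary_abelian q (G\<lparr>carrier := ?K\<rparr>)"
    unfolding elementary_abelian_def
  proof (intro conjI ballI primes)
    show "comm_group (G\<lparr>carrier := ?K\<rparr>)"
      by (intro group.group_comm_groupI G.subgroup_imp_group K)
        (auto simp flip: s.hom_mult simp: H.m_comm)
    show "finite (carrier (G\<lparr>carrier := ?K\<rparr>))"
      using elementary_abelianD(4)[OF elem_ab] by simp
    fix x assume "x \<in> carrier (G\<lparr>carrier := ?K\<rparr>)"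
    then obtain h where h: "h \<in> carrier H" "x = s h" by auto
    then show "x [^]\<^bsub>G\<lparr>carrier := ?K\<rparr>\<^esub> q = \<one>\<^bsub>G\<lparr>carrier := ?K\<rparr>\<^esub>"
      using G.nat_pow_consistent[of x q ?K] elementary_abelianD(5)[OF elem_ab, of h]
      by (simp flip: s.hom_nat_pow)
  qed
  have "coprime (card ?N) (card ?K)"
  proof (rule ccontr)
    assume "\<not> coprime (card ?N) (card ?K)"
    then obtain r where r: "prime r" "r dvd card ?N" "r dvd card ?K"
      using prime_factor_nat[of "gcd (card ?N) (card ?K)"] by (auto simp: coprime_iff_gcd_eq_1)
    then show False
      using elementary_abelian_order_prime_factor[OF NE, of r]
        elementary_abelian_order_prime_factor[OF KE, of r] primes by simp
  qed
  moreover have "?N <#>\<^bsub>G\<^esub> ?K = carrier G"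
  proof
    show "?N <#>\<^bsub>G\<^esub> ?K \<subseteq> carrier G" by (auto simp: set_mult_def tor_def)
    show "carrier G \<subseteq> ?N <#>\<^bsub>G\<^esub> ?K"
    proof
      fix x assume x: "x \<in> carrier G"
      show "x \<in> ?N <#>\<^bsub>G\<^esub> ?K"
        unfolding set_mult_def using decomp[OF x] tor_part[OF x] c.hom_closed[OF x] by blast
    qed
  qed
  moreover have "?N \<inter> ?K = {\<one>\<^bsub>G\<^esub>}"
  proof
    show "?N \<inter> ?K \<subseteq> {\<one>\<^bsub>G\<^esub>}"
    proof
      fix x assume "x \<in> ?N \<inter> ?K"
      then obtain h where "h \<in> carrier H" "x = s h" "s h \<in> tor G p" by blast
      then show "x \<in> {\<one>\<^bsub>G\<^esub>}" using tor_inter_s[of h] s.hom_one by simp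
    qed
    show "{\<one>\<^bsub>G\<^esub>} \<subseteq> ?N \<inter> ?K"
      using subgroup.one_closed[OF N] subgroup.one_closed[OF K] by blast
  qed
  ultimately show ?thesis
    unfolding Coprime_def ElemAb_def using group finite tor_normal K NE KE by blast
qed

end

section \<open>Coprime extensions of elementary abelian groups\<close>

lemma (in group) elementary_abelian_subgroup_iff:
  assumes K: "subgroup K G" and fin: "finite (carrier G)"
  shows "elementary_abelian r (G\<lparr>carrier := K\<rparr>)
    \<longleftrightarrow> prime r \<and> (\<forall>x\<in>K. \<forall>y\<in>K. x \<otimes> y = y \<otimes> x) \<and> (\<forall>x\<in>K. x [^] r = \<one>)"
proof -
  have "comm_group (G\<lparr>carrier := K\<rparr>) \<longleftrightarrow> (\<forall>x\<in>K. \<forall>y\<in>K. x \<otimes> y = y \<otimes> x)"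
  proof
    assume "comm_group (G\<lparr>carrier := K\<rparr>)"
    then have "comm_monoid (G\<lparr>carrier := K\<rparr>)" by (simp add: comm_group_def)
    from comm_monoid.m_comm[OF this] show "\<forall>x\<in>K. \<forall>y\<in>K. x \<otimes> y = y \<otimes> x" by simp
  next
    assume "\<forall>x\<in>K. \<forall>y\<in>K. x \<otimes> y = y \<otimes> x"
    then show "comm_group (G\<lparr>carrier := K\<rparr>)"
      by (intro group.group_comm_groupI subgroup_imp_group K) auto
  qed
  moreover have "finite K" using subgroup.subset[OF K] fin finite_subset by metis
  moreover have "x [^]\<^bsub>G\<lparr>carrier := K\<rparr>\<^esub> r = x [^] r" for x by (simp flip: nat_pow_consistent)
  ultimately show ?thesis by (auto simp: elementary_abelian_def)
qed

lemma (in group) prime_dvd_card_subgroup: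
  fixes p :: nat
  assumes K: "subgroup K G" and p: "prime p" and x: "x \<in> K" "x [^] p = \<one>" "x \<noteq> \<one>"
  shows "p dvd card K"
proof -
  have xG: "x \<in> carrier G" by (rule subgroup.mem_carrier[OF K x(1)])
  have "x [^]\<^bsub>G\<lparr>carrier := K\<rparr>\<^esub> Coset.order (G\<lparr>carrier := K\<rparr>) = \<one>\<^bsub>G\<lparr>carrier := K\<rparr>\<^esub>"
    using x(1) by (intro group.pow_order_eq_1[OF subgroup_imp_group[OF K]]) simp
  then have "x [^] card K = \<one>" by (simp add: Coset.order_def flip: nat_pow_consistent)
  then have "ord x dvd card K" using pow_eq_id[OF xG] by simp
  moreover have "ord x dvd p" using pow_eq_id[OF xG] x(2) by simp
  then have "ord x = p" using p x(3) ord_eq_1[OF xG] by (auto simp: prime_nat_iff)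
  ultimately show ?thesis by simp
qed

lemma (in group) Coprime_ElemAbE:
  assumes "Coprime ElemAb ElemAb G"
  obtains N K and r r' :: nat where "finite (carrier G)" "N \<lhd> G" "subgroup N G" "subgroup K G" "prime r" "prime r'"
    "\<forall>x\<in>N. \<forall>y\<in>N. x \<otimes> y = y \<otimes> x" "\<forall>x\<in>N. x [^] r = \<one>"
    "\<forall>x\<in>K. \<forall>y\<in>K. x \<otimes> y = y \<otimes> x" "\<forall>x\<in>K. x [^] r' = \<one>"
    "\<forall>x\<in>carrier G. \<exists>n\<in>N. \<exists>k\<in>K. x = n \<otimes> k" "N \<inter> K = {\<one>}" "coprime (card N) (card K)"
proof -
  from assms obtain N K and r r' :: nat where *: "finite (carrier G)" "N \<lhd> G" "subgroup K G"
    "elementary_abelian r (G\<lparr>carrier := N\<rparr>)" "elementary_abelian r' (G\<lparr>carrier := K\<rparr>)"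
    "N <#> K = carrier G" "N \<inter> K = {\<one>}" "coprime (card N) (card K)"
    unfolding Coprime_def ElemAb_def by blast
  have "subgroup N G" using *(2) normal_imp_subgroup by blast
  moreover have "\<exists>n\<in>N. \<exists>k\<in>K. x = n \<otimes> k" if "x \<in> carrier G" for x
    using that unfolding *(6)[symmetric] set_mult_def by blast
  ultimately show thesis
    using * elementary_abelian_subgroup_iff[of N r] elementary_abelian_subgroup_iff[of K r']
    by (intro that[of N K r r']) metis+
qed

text \<open>A prime exponent \<open>r\<close> other than \<open>p\<close> and \<open>q\<close> is
  coprime to \<open>q * p\<close>, which is an exponent as well. Then the subgroup is trivial and
  both alternatives hold.\<close>

lemma (in group) one_of_prime_exponents:
  fixes p q r :: nat
  assumes K: "subgroup K G" and r: "prime r" "\<And>x. x \<in> K \<Longrightarrow> x [^] r = \<one>"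
    and pq: "prime p" "prime q" "\<And>x. x \<in> K \<Longrightarrow> (x [^] q) [^] p = \<one>"
  shows "(\<forall>x\<in>K. x [^] p = \<one>) \<or> (\<forall>x\<in>K. x [^] q = \<one>)"
proof (cases "r = p \<or> r = q")
  case False
  then have "coprime r (q * p)" using r(1) pq by (simp add: primes_coprime)
  moreover have "x [^] (q * p) = \<one>" if "x \<in> K" for x
    using pq(3)[OF that] subgroup.mem_carrier[OF K that] by (simp add: nat_pow_pow)
  ultimately have "x = \<one>" if "x \<in> K" for x
    using pow_coprime_one[of x r "q * p"] r(2) subgroup.mem_carrier[OF K that] that by metis
  then show ?thesis using nat_pow_one by metis
qed (use r in auto)

lemma (in group) subgroup_pow_closed: "subgroup K G \<Longrightarrow> x \<in> K \<Longrightarrow> x [^] (j::nat) \<in> K"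
  by (induction j) (auto intro: subgroup.one_closed subgroup.m_closed)

text \<open>Modulo the normal subgroup, the factor \<open>n\<close> disappears from every power;
  conjugation collects its copies on the left.\<close>

lemma (in normal) mult_pow:
  assumes n: "n \<in> H" and k: "k \<in> carrier G"
  shows "\<exists>n'\<in>H. (n \<otimes> k) [^] (j::nat) = n' \<otimes> k [^] j"
proof (induction j)
  case (Suc j)
  then obtain n' where n': "n' \<in> H" "(n \<otimes> k) [^] j = n' \<otimes> k [^] j" by metis
  have c: "n \<in> carrier G" "n' \<in> carrier G" using n n' by (auto intro: mem_carrier)
  let ?l = "k [^] j \<otimes> n \<otimes> inv (k [^] j)"
  have "?l \<in> H" using n k by (simp add: inv_op_closed2)
  moreover have "(n \<otimes> k) [^] Suc j = n' \<otimes> ?l \<otimes> k [^] Suc j"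
    using n' c k by (simp add: m_assoc inv_solve_left)
  ultimately show ?case using subgroup.m_closed[OF subgroup_axioms n'(1)] by metis
qed (use n k in auto)

text \<open>The decomposition supplied by the class need not belong to \<open>(p, q)\<close>. All
  elements have exponent \<open>q * p\<close>, so each of the two factors has exponent
  \<open>p\<close> or \<open>q\<close>. If the exponents differ, the factor of exponent
  \<open>p\<close> is the torsion and the other one its complement. If they agree, coprimality of
  the orders makes one factor trivial, and the whole group is either the torsion or the
  complement.\<close>

lemma (in group) tor_complement:
  fixes p q :: nat
  assumes C: "Coprime ElemAb ElemAb G" and pq: "prime p" "prime q" "p \<noteq> q"
    and closed: "\<And>x y. x \<in> tor G p \<Longrightarrow> y \<in> tor G p \<Longrightarrow> x \<otimes> y \<in> tor G p"
    and expo: "\<And>x. x \<in> carrier G \<Longrightarrow> x [^] q \<in> tor G p"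
  shows "\<exists>K. subgroup K G \<and> (\<forall>x\<in>K. \<forall>y\<in>K. x \<otimes> y = y \<otimes> x) \<and> (\<forall>x\<in>K. x [^] q = \<one>)
    \<and> (\<forall>x\<in>tor G p. \<forall>y\<in>tor G p. x \<otimes> y = y \<otimes> x) \<and> (\<forall>x\<in>carrier G. \<exists>n\<in>tor G p. \<exists>k\<in>K. x = n \<otimes> k)"
proof -
  obtain N K and r r' :: nat where fin: "finite (carrier G)" and N: "N \<lhd> G" "subgroup N G"
    and K: "subgroup K G" and rr: "prime r" "prime r'"
    and Nc: "\<forall>x\<in>N. \<forall>y\<in>N. x \<otimes> y = y \<otimes> x" and Nr: "\<forall>x\<in>N. x [^] r = \<one>"
    and Kc: "\<forall>x\<in>K. \<forall>y\<in>K. x \<otimes> y = y \<otimes> x" and Kr: "\<forall>x\<in>K. x [^] r' = \<one>"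
    and NK: "\<forall>x\<in>carrier G. \<exists>n\<in>N. \<exists>k\<in>K. x = n \<otimes> k"
    and int: "N \<inter> K = {\<one>}" and cop: "coprime (card N) (card K)"
    using C by (rule Coprime_ElemAbE)
  note NK = bspec[OF NK] and Nc = bspec[OF bspec[OF Nc]] and Kc = bspec[OF bspec[OF Kc]]
    and Nr = bspec[OF Nr] and Kr = bspec[OF Kr]
  have NG: "x \<in> carrier G" if "x \<in> N" for x by (rule subgroup.mem_carrier[OF N(2) that])
  have KG: "x \<in> carrier G" if "x \<in> K" for x by (rule subgroup.mem_carrier[OF K that])
  have torG: "x \<in> carrier G" if "x \<in> tor G p" for x using that by (simp add: tor_def)
  have tor_inv: "inv x \<in> tor G p" if "x \<in> tor G p" for x using that by (simp add: tor_def nat_pow_inv)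
  have qp: "(x [^] q) [^] p = \<one>" if "x \<in> carrier G" for x using expo[OF that] by (simp add: tor_def)
  have cpq: "coprime p q" using pq by (simp add: primes_coprime)
  have tor_q: "x = \<one>" if "x \<in> tor G p" "x [^] q = \<one>" for x
    using that pow_coprime_one[of x p q] cpq by (simp add: tor_def)
  have N_type: "(\<forall>x\<in>N. x [^] p = \<one>) \<or> (\<forall>x\<in>N. x [^] q = \<one>)"
    using one_of_prime_exponents[OF N(2) rr(1) Nr pq(1,2)] qp NG by metis
  have K_type: "(\<forall>x\<in>K. x [^] p = \<one>) \<or> (\<forall>x\<in>K. x [^] q = \<one>)"
    using one_of_prime_exponents[OF K rr(2) Kr pq(1,2)] qp KG by metis
  have trivial: "(\<forall>x\<in>N. x = \<one>) \<or> (\<forall>x\<in>K. x = \<one>)"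
    if l: "prime (l :: nat)" "\<forall>x\<in>N. x [^] l = \<one>" "\<forall>x\<in>K. x [^] l = \<one>" for l
  proof (rule ccontr)
    assume "\<not> ?thesis"
    then obtain x y where "x \<in> N" "x \<noteq> \<one>" "y \<in> K" "y \<noteq> \<one>" by metis
    then have "l dvd card N" "l dvd card K"
      using l prime_dvd_card_subgroup[OF N(2) l(1)] prime_dvd_card_subgroup[OF K l(1)] by metis+
    then show False using cop l(1) coprime_common_divisor_nat[of "card N" "card K" l] by (metis not_prime_1)
  qed
  have comm_trivial: "x \<otimes> y = y \<otimes> x"
    if t: "(\<forall>x\<in>N. x = \<one>) \<or> (\<forall>x\<in>K. x = \<one>)" and x: "x \<in> carrier G" and y: "y \<in> carrier G" for x y
    using t
  proof
    assume "\<forall>x\<in>N. x = \<one>"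
    then have "x \<in> K" "y \<in> K" using NK[OF x] NK[OF y] KG by auto
    then show ?thesis by (rule Kc)
  next
    assume "\<forall>x\<in>K. x = \<one>"
    then have "x \<in> N" "y \<in> N" using NK[OF x] NK[OF y] NG by auto
    then show ?thesis by (rule Nc)
  qed
  have q_trivial: "x [^] q = \<one>"
    if t: "(\<forall>x\<in>N. x = \<one>) \<or> (\<forall>x\<in>K. x = \<one>)" and x: "x \<in> carrier G"
      and "\<forall>x\<in>N. x [^] q = \<one>" "\<forall>x\<in>K. x [^] q = \<one>" for x
  proof -
    have "x \<in> N \<or> x \<in> K" using t NK[OF x] NG KG by auto
    then show ?thesis using that by blast
  qed
  consider "\<forall>x\<in>N. x [^] p = \<one>" "\<forall>x\<in>K. x [^] q = \<one>" | "\<forall>x\<in>N. x [^] q = \<one>" "\<forall>x\<in>K. x [^] p = \<one>"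
    | "\<forall>x\<in>N. x [^] p = \<one>" "\<forall>x\<in>K. x [^] p = \<one>" | "\<forall>x\<in>N. x [^] q = \<one>" "\<forall>x\<in>K. x [^] q = \<one>"
    using N_type K_type by metis
  then show ?thesis
  proof cases
    case 1
    have N_tor: "n \<in> tor G p" if "n \<in> N" for n using 1(1) NG that by (simp add: tor_def)
    have tor_N: "x \<in> N" if x: "x \<in> tor G p" for x
    proof -
      obtain n k where nk: "n \<in> N" "k \<in> K" "x = n \<otimes> k" using NK torG[OF x] by metis
      then have "k = inv n \<otimes> x" using NG KG by (simp add: inv_solve_left)
      then have "k \<in> tor G p" using closed tor_inv N_tor nk(1) x by metis
      then have "k = \<one>" using tor_q 1(2) nk(2) by metis
      then show ?thesis using nk NG by simp
    qed
    show ?thesis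
      using K Kc 1 Nc tor_N N_tor NK by (intro exI[of _ K]) metis
  next
    \<comment> \<open>The roles are exchanged: the given complement \<open>K\<close> is the torsion,
      and the normal subgroup \<open>N\<close> complements it. Conjugation moves the factor from
      \<open>N\<close> behind the one from \<open>K\<close>.\<close>
    case 2
    have K_tor: "k \<in> tor G p" if "k \<in> K" for k using 2(2) KG that by (simp add: tor_def)
    have tor_K: "x \<in> K" if x: "x \<in> tor G p" for x
    proof -
      obtain n k where nk: "n \<in> N" "k \<in> K" "x = n \<otimes> k" using NK torG[OF x] by metis
      then have "n = x \<otimes> inv k" using NG KG by (simp add: inv_solve_right)
      then have "n \<in> tor G p" using closed tor_inv K_tor nk(2) x by metis
      then have "n = \<one>" using tor_q 2(1) nk(1) by metis
      then show ?thesis using nk KG by simp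
    qed
    have "\<exists>n\<in>tor G p. \<exists>k\<in>N. x = n \<otimes> k" if x: "x \<in> carrier G" for x
    proof -
      obtain n k where nk: "n \<in> N" "k \<in> K" "x = n \<otimes> k" using NK[OF x] by metis
      have "inv k \<otimes> n \<otimes> k \<in> N" using normal.inv_op_closed1[OF N(1) KG[OF nk(2)] nk(1)] .
      moreover have "x = k \<otimes> (inv k \<otimes> n \<otimes> k)" using nk NG KG by (simp add: m_assoc[symmetric])
      ultimately show ?thesis using K_tor[OF nk(2)] by metis
    qed
    then show ?thesis
      using N Nc 2 Kc tor_K by (intro exI[of _ N]) metis
  next
    case 3
    have "x \<in> tor G p" if "x \<in> carrier G" for x
      using NK[OF that] closed 3 NG KG by (auto simp: tor_def)
    then have "\<exists>n\<in>tor G p. \<exists>k\<in>{\<one>}. x = n \<otimes> k" if "x \<in> carrier G" for x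
      using that by (intro bexI[of _ x] bexI[of _ \<one>]) auto
    then show ?thesis
      using comm_trivial[OF trivial[OF pq(1) 3]] torG
      by (intro exI[of _ "{\<one>}"] conjI triv_subgroup ballI) auto
  next
    case 4
    note t = trivial[OF pq(2) 4]
    have "tor G p \<subseteq> {\<one>}" using tor_q q_trivial[OF t _ 4] torG by auto
    moreover have "\<one> \<in> tor G p" by (simp add: tor_def)
    then have "\<exists>n\<in>tor G p. \<exists>k\<in>carrier G. x = n \<otimes> k" if "x \<in> carrier G" for x
      using that by (intro bexI[of _ \<one>] bexI[of _ x]) auto
    ultimately show ?thesis
      using comm_trivial[OF t] q_trivial[OF t _ 4] torG
      by (intro exI[of _ "carrier G"] conjI subgroup_self ballI) auto
  qed
qed

text \<open>A non-trivial factor determines its prime, which divides the order of the factor and so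
  respects the bound. For a trivial factor any prime other than that of the other factor will do; 2
  or 3 is one, and the summand 4 keeps both in range.\<close>

lemma (in group) ex_tor_primes:
  assumes C: "Coprime ElemAb ElemAb G"
  shows "\<exists>p q :: nat. prime p \<and> prime q \<and> p \<noteq> q \<and> p < card (carrier G) + 4 \<and> q < card (carrier G) + 4
    \<and> (\<forall>x\<in>tor G p. \<forall>y\<in>tor G p. x \<otimes> y \<in> tor G p) \<and> (\<forall>x\<in>carrier G. x [^] q \<in> tor G p)"
proof -
  obtain N K and r r' :: nat where fin: "finite (carrier G)" and N: "N \<lhd> G" "subgroup N G"
    and K: "subgroup K G" and rr: "prime r" "prime r'"
    and Nc: "\<forall>x\<in>N. \<forall>y\<in>N. x \<otimes> y = y \<otimes> x" and Nr: "\<forall>x\<in>N. x [^] r = \<one>"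
    and Kc: "\<forall>x\<in>K. \<forall>y\<in>K. x \<otimes> y = y \<otimes> x" and Kr: "\<forall>x\<in>K. x [^] r' = \<one>"
    and NK: "\<forall>x\<in>carrier G. \<exists>n\<in>N. \<exists>k\<in>K. x = n \<otimes> k"
    and int: "N \<inter> K = {\<one>}" and cop: "coprime (card N) (card K)"
    using C by (rule Coprime_ElemAbE)
  note NK = bspec[OF NK] and Nc = bspec[OF bspec[OF Nc]] and Kc = bspec[OF bspec[OF Kc]]
    and Nr = bspec[OF Nr] and Kr = bspec[OF Kr]
  have NG: "x \<in> carrier G" if "x \<in> N" for x by (rule subgroup.mem_carrier[OF N(2) that])
  have KG: "x \<in> carrier G" if "x \<in> K" for x by (rule subgroup.mem_carrier[OF K that])
  have bound: "l < card (carrier G) + 4" if "subgroup L G" "prime (l :: nat)" "x \<in> L" "x [^] l = \<one>" "x \<noteq> \<one>" for L l x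
  proof -
    have "L \<subseteq> carrier G" using that(1) by (rule subgroup.subset)
    then have "card L \<le> card (carrier G)" "finite L" using fin by (simp_all add: card_mono finite_subset)
    moreover have "card L > 0" using \<open>finite L\<close> that(3) by (auto simp: card_gt_0_iff)
    ultimately show ?thesis using prime_dvd_card_subgroup[OF that] dvd_imp_le[of l "card L"] by linarith
  qed
  have other: "\<exists>l'. prime l' \<and> l' \<noteq> l \<and> l' < card (carrier G) + 4" for l :: nat
    by (cases "l = 2") (auto intro: exI[of _ 2] exI[of _ 3])
  have "\<exists>p q :: nat. prime p \<and> prime q \<and> p \<noteq> q \<and> p < card (carrier G) + 4 \<and> q < card (carrier G) + 4
      \<and> (\<forall>x\<in>N. x [^] p = \<one>) \<and> (\<forall>x\<in>K. x [^] q = \<one>)"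
  proof (cases "\<forall>x\<in>N. x = \<one>")
    case N1: True
    then have N1: "\<forall>x\<in>N. x [^] l = \<one>" for l :: nat by auto
    show ?thesis
    proof (cases "\<forall>x\<in>K. x = \<one>")
      case True
      then have "\<forall>x\<in>K. x [^] l = \<one>" for l :: nat by auto
      then show ?thesis using N1 by (intro exI[of _ 2] exI[of _ 3]) auto
    next
      case False
      then have "r' < card (carrier G) + 4" using bound[OF K rr(2)] Kr by metis
      then show ?thesis using other[of r'] N1 Kr rr by metis
    qed
  next
    case False
    then obtain n where n: "n \<in> N" "n \<noteq> \<one>" by metis
    have r: "r < card (carrier G) + 4" using bound[OF N(2) rr(1) n(1) Nr[OF n(1)] n(2)] .
    show ?thesis
    proof (cases "\<forall>x\<in>K. x = \<one>")
      case True
      then have "\<forall>x\<in>K. x [^] l = \<one>" for l :: nat by auto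
      then show ?thesis using other[of r] Nr rr r by metis
    next
      case False
      then obtain k where k: "k \<in> K" "k \<noteq> \<one>" by metis
      have r': "r' < card (carrier G) + 4" using bound[OF K rr(2) k(1) Kr[OF k(1)] k(2)] .
      have "r \<noteq> r'"
        using prime_dvd_card_subgroup[OF N(2) rr(1) n(1) Nr[OF n(1)] n(2)]
          prime_dvd_card_subgroup[OF K rr(2) k(1) Kr[OF k(1)] k(2)]
          coprime_common_divisor_nat[OF cop] rr not_prime_1 by metis
      then show ?thesis using rr r r' Nr Kr by metis
    qed
  qed
  then obtain p q :: nat where pq: "prime p" "prime q" "p \<noteq> q" "p < card (carrier G) + 4" "q < card (carrier G) + 4"
      "\<forall>x\<in>N. x [^] p = \<one>" "\<forall>x\<in>K. x [^] q = \<one>"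
    by metis
  \<comment> \<open>If \<open>n k\<close> has trivial \<open>p\<close>-th power, then
    \<open>k [^] p\<close> lies in the intersection of the factors, so \<open>k\<close> has the
    coprime exponents \<open>p\<close> and \<open>q\<close>.\<close>
  have tor_def': "tor G p = N"
  proof
    show "N \<subseteq> tor G p" using pq(6) NG by (auto simp: tor_def)
    show "tor G p \<subseteq> N"
    proof
      fix x assume x: "x \<in> tor G p"
      then have "x \<in> carrier G" by (simp add: tor_def)
      then obtain n k where nk: "n \<in> N" "k \<in> K" "x = n \<otimes> k" using NK by metis
      obtain n' where n': "n' \<in> N" "x [^] p = n' \<otimes> k [^] p"
        using normal.mult_pow[OF N(1) nk(1) KG[OF nk(2)]] nk(3) by metis
      have "n' \<otimes> k [^] p = \<one>" using n' x by (simp add: tor_def)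
      then have "inv n' = k [^] p" using n' NG KG nk(2) by (metis inv_equality inv_inv nat_pow_closed)
      then have "k [^] p \<in> N" using subgroup.m_inv_closed[OF N(2) n'(1)] by metis
      moreover have "k [^] p \<in> K" using nk(2) K by (simp add: subgroup_pow_closed)
      ultimately have "k [^] p = \<one>" using int by blast
      moreover have "k [^] q = \<one>" using pq(7) nk(2) by blast
      moreover have "coprime p q" using pq by (simp add: primes_coprime)
      ultimately have "k = \<one>" using pow_coprime_one KG[OF nk(2)] by metis
      then show "x \<in> N" using nk NG by simp
    qed
  qed
  have "x [^] q \<in> N" if x: "x \<in> carrier G" for x
  proof -
    obtain n k where nk: "n \<in> N" "k \<in> K" "x = n \<otimes> k" using NK[OF x] by metis
    then obtain n' where "n' \<in> N" "x [^] q = n' \<otimes> k [^] q"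
      using normal.mult_pow[OF N(1) nk(1) KG[OF nk(2)]] nk(3) by metis
    then show ?thesis using pq(7) nk(2) NG by simp
  qed
  then show ?thesis using pq tor_def' subgroup.m_closed[OF N(2)] by metis
qed

section \<open>The representation on the torsion subgroup\<close>

lemma digit_sum_less:
  fixes f :: "nat \<Rightarrow> nat"
  shows "(\<And>k. k < m \<Longrightarrow> f k < p) \<Longrightarrow> (\<Sum>k<m. f k * p ^ k) < p ^ m"
proof (induction m)
  case (Suc m)
  then have 1: "(\<Sum>k<m. f k * p ^ k) < p ^ m" by simp
  have "Suc (f m) * p ^ m \<le> p * p ^ m" using Suc.prems[of m] by (intro mult_le_mono1) simp
  then show ?case using 1 by simp
qed simp

lemma digit_of_digit_sum:
  fixes f :: "nat \<Rightarrow> nat"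
  shows "(\<And>k. k < m \<Longrightarrow> f k < p) \<Longrightarrow> j < m \<Longrightarrow> (\<Sum>k<m. f k * p ^ k) div p ^ j mod p = f j"
proof (induction m)
  case (Suc m)
  have p: "p > 0" using Suc.prems(1)[of m] by simp
  show ?case
  proof (cases "j = m")
    case True
    have "(\<Sum>k<m. f k * p ^ k) < p ^ m" using Suc.prems(1) by (intro digit_sum_less) simp
    then have "((\<Sum>k<m. f k * p ^ k) + f m * p ^ m) div p ^ m = f m" using p by simp
    then show ?thesis using True Suc.prems(1)[of m] by simp
  next
    case False
    then have j: "j < m" using Suc.prems(2) by simp
    have "p ^ m = p ^ j * (p * p ^ (m - j - 1))"
      using j by (simp flip: power_Suc power_add)
    then have "((\<Sum>k<m. f k * p ^ k) + f m * p ^ m) div p ^ j = (\<Sum>k<m. f k * p ^ k) div p ^ j + p * (f m * p ^ (m - j - 1))"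
      using p by (simp add: mult.left_commute div_add1_eq)
    then show ?thesis using Suc j by simp
  qed
qed simp

lemma digit_sum_of_digits: "(\<Sum>k<m. (i div p ^ k mod p) * p ^ k) = i mod (p ^ m :: nat)"
proof (induction m)
  case (Suc m)
  then show ?case using mod_mult2_eq[of i "p ^ m" p] by (simp add: mult.commute)
qed simp

definition vec_code :: "nat \<Rightarrow> nat vec \<Rightarrow> nat" where
  "vec_code p v = (\<Sum>k<dim_vec v. v $ k * p ^ k)"

definition vec_decode :: "nat \<Rightarrow> nat \<Rightarrow> nat \<Rightarrow> nat vec" where
  "vec_decode p m i = vec m (\<lambda>k. i div p ^ k mod p)"

lemma vec_decode_Zp_vec: "p > 0 \<Longrightarrow> vec_decode p m i \<in> Zp_vec p m"
  by (rule Zp_vecI) (auto simp: vec_decode_def)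

lemma vec_code_less: "v \<in> Zp_vec p m \<Longrightarrow> vec_code p v < p ^ m"
  unfolding vec_code_def by (simp add: Zp_vecD digit_sum_less)

lemma vec_code_digit: "v \<in> Zp_vec p m \<Longrightarrow> j < m \<Longrightarrow> vec_code p v div p ^ j mod p = v $ j"
  unfolding vec_code_def by (simp add: Zp_vecD digit_of_digit_sum)

lemma vec_decode_code: "v \<in> Zp_vec p m \<Longrightarrow> vec_decode p m (vec_code p v) = v"
  by (rule eq_vecI) (auto simp: vec_decode_def vec_code_digit Zp_vecD)

lemma vec_code_decode: "i < p ^ m \<Longrightarrow> vec_code p (vec_decode p m i) = i"
  by (simp add: vec_code_def vec_decode_def digit_sum_of_digits)

lemma vec_code_bij: "p > 0 \<Longrightarrow> bij_betw (vec_code p) (Zp_vec p m) {..<p ^ m}"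
  by (rule bij_betw_byWitness[where f' = "vec_decode p m"])
    (auto simp: vec_decode_code vec_code_decode vec_code_less vec_decode_Zp_vec)

text \<open>The group laws are inherited along any surjection compatible with the products.
  Injectivity is not assumed, so this covers the numbering of cosets as well as that of the elements
  of a semidirect product. As the neutral element of a table is given by a description, its
  uniqueness is part of the proof.\<close>

lemma cayley_table_of_surj:
  assumes G: "group G" and T: "T \<in> carrier_mat n n" and c: "c ` carrier G = {..<n}"
    and mult: "\<And>x y. x \<in> carrier G \<Longrightarrow> y \<in> carrier G \<Longrightarrow> c (x \<otimes>\<^bsub>G\<^esub> y) = T $$ (c x, c y)"
  shows "cayley_table T" "c \<in> hom G (table_group T)" "\<one>\<^bsub>table_group T\<^esub> = c \<one>\<^bsub>G\<^esub>"
    "carrier (table_group T) = {..<n}"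
proof -
  interpret G: group G by (rule G)
  have n: "dim_row T = n" "dim_col T = n" using T by auto
  have c_less: "c x < n" if "x \<in> carrier G" for x using c that by auto
  have c_surj: "\<exists>x\<in>carrier G. i = c x" if "i < n" for i using c that by (metis imageE lessThan_iff)
  let ?e = "c \<one>\<^bsub>G\<^esub>"
  have e: "?e < n" using c_less by simp
  have unit: "T $$ (?e, i) = i" "T $$ (i, ?e) = i" if i: "i < n" for i
  proof -
    obtain x where x: "x \<in> carrier G" "i = c x" using c_surj[OF i] by metis
    then show "T $$ (?e, i) = i" "T $$ (i, ?e) = i"
      using mult[of "\<one>\<^bsub>G\<^esub>" x] mult[of x "\<one>\<^bsub>G\<^esub>"] by simp_all
  qed
  have "(THE e. e < n \<and> (\<forall>x<n. T $$ (e, x) = x \<and> T $$ (x, e) = x)) = ?e"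
  proof (rule the_equality)
    fix e' assume e': "e' < n \<and> (\<forall>x<n. T $$ (e', x) = x \<and> T $$ (x, e') = x)"
    then have "T $$ (e', ?e) = ?e" using e by simp
    then show "e' = ?e" using unit(2) e' by simp
  qed (use e unit in simp)
  then show one: "\<one>\<^bsub>table_group T\<^esub> = ?e" by (simp add: table_group_def n)
  show carr: "carrier (table_group T) = {..<n}" by (simp add: table_group_def n)
  have m: "i \<otimes>\<^bsub>table_group T\<^esub> j = T $$ (i, j)" for i j by (simp add: table_group_def)
  have "group (table_group T)"
  proof (rule groupI)
    fix i j assume "i \<in> carrier (table_group T)" "j \<in> carrier (table_group T)"
    then obtain x y where xy: "x \<in> carrier G" "i = c x" "y \<in> carrier G" "j = c y"
      using c_surj unfolding carr lessThan_iff by metis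
    then show "i \<otimes>\<^bsub>table_group T\<^esub> j \<in> carrier (table_group T)"
      unfolding m carr using mult[of x y] c_less[of "x \<otimes>\<^bsub>G\<^esub> y"] by simp
    fix k assume "k \<in> carrier (table_group T)"
    then obtain z where z: "z \<in> carrier G" "k = c z" using c_surj unfolding carr lessThan_iff by metis
    show "i \<otimes>\<^bsub>table_group T\<^esub> j \<otimes>\<^bsub>table_group T\<^esub> k = i \<otimes>\<^bsub>table_group T\<^esub> (j \<otimes>\<^bsub>table_group T\<^esub> k)"
      unfolding m using xy z mult[symmetric] by (simp add: G.m_assoc)
  next
    fix i assume i: "i \<in> carrier (table_group T)"
    show "\<one>\<^bsub>table_group T\<^esub> \<otimes>\<^bsub>table_group T\<^esub> i = i" unfolding one m using i unit by (simp add: carr)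
    obtain x where x: "x \<in> carrier G" "i = c x" using i c_surj unfolding carr lessThan_iff by metis
    have "c (inv\<^bsub>G\<^esub> x) \<otimes>\<^bsub>table_group T\<^esub> i = \<one>\<^bsub>table_group T\<^esub>"
      unfolding one m using x mult[of "inv\<^bsub>G\<^esub> x" x] by simp
    then show "\<exists>j\<in>carrier (table_group T). j \<otimes>\<^bsub>table_group T\<^esub> i = \<one>\<^bsub>table_group T\<^esub>"
      using c_less[of "inv\<^bsub>G\<^esub> x"] x unfolding carr by auto
  qed (use one carr e in simp)
  then show "cayley_table T" by (simp add: cayley_table_def n)
  show "c \<in> hom G (table_group T)" using mult c_less by (auto simp: hom_def carr m)
qed

text \<open>A linear combination in multiplicative notation. The order of the factors is fixed
  because the surrounding group need not be abelian.\<close>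

primrec lin :: "('a, 'b) monoid_scheme \<Rightarrow> (nat \<Rightarrow> 'a) \<Rightarrow> (nat \<Rightarrow> nat) \<Rightarrow> nat \<Rightarrow> 'a" where
  "lin G b w 0 = \<one>\<^bsub>G\<^esub>"
| "lin G b w (Suc m) = lin G b w m \<otimes>\<^bsub>G\<^esub> b m [^]\<^bsub>G\<^esub> w m"

lemma lin_cong:
  "(\<And>k. k < m \<Longrightarrow> b k = b' k) \<Longrightarrow> (\<And>k. k < m \<Longrightarrow> w k = w' k) \<Longrightarrow> lin G b w m = lin G b' w' m"
  by (induction m) auto

context group begin

lemma lin_closed: "(\<And>k. k < m \<Longrightarrow> b k \<in> carrier G) \<Longrightarrow> lin G b w m \<in> carrier G"
  by (induction m) auto

lemma lin_zero: "lin G b (\<lambda>_. 0) m = \<one>"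
  by (induction m) auto

lemma pow_mod_exponent: "x \<in> carrier G \<Longrightarrow> x [^] (p::nat) = \<one> \<Longrightarrow> x [^] (n mod p) = x [^] n"
proof -
  assume x: "x \<in> carrier G" "x [^] p = \<one>"
  have "x [^] n = x [^] (p * (n div p) + n mod p)" by simp
  also have "\<dots> = x [^] (p * (n div p)) \<otimes> x [^] (n mod p)" using x(1) by (rule nat_pow_mult[symmetric])
  also have "x [^] (p * (n div p)) = \<one>" using x by (simp flip: nat_pow_pow)
  finally show ?thesis using x(1) by simp
qed

lemma lin_conj:
  assumes g: "g \<in> carrier G" and b: "\<And>k. k < m \<Longrightarrow> b k \<in> carrier G"
  shows "g \<otimes> lin G b w m \<otimes> inv g = lin G (\<lambda>k. g \<otimes> b k \<otimes> inv g) w m"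
  using b
proof (induction m)
  case (Suc m)
  have cancel: "inv g \<otimes> (g \<otimes> x) = x" if "x \<in> carrier G" for x
    using that g by (simp flip: m_assoc)
  have pow: "(g \<otimes> x \<otimes> inv g) [^] (j::nat) = g \<otimes> x [^] j \<otimes> inv g" if "x \<in> carrier G" for x j
    using that g by (induction j) (auto simp: m_assoc cancel)
  have "g \<otimes> lin G b w (Suc m) \<otimes> inv g = (g \<otimes> lin G b w m \<otimes> inv g) \<otimes> (g \<otimes> b m [^] w m \<otimes> inv g)"
    using Suc.prems g lin_closed[of m b w] by (simp add: m_assoc cancel)
  then show ?case using Suc pow[of "b m"] by simp
qed (use g in simp)

lemma lin_tor:
  assumes N: "\<And>x y. x \<in> tor G p \<Longrightarrow> y \<in> tor G p \<Longrightarrow> x \<otimes> y \<in> tor G p"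
    and b: "\<And>k. k < m \<Longrightarrow> b k \<in> tor G p"
  shows "lin G b w m \<in> tor G p"
  using b
proof (induction m)
  case (Suc m)
  have "b m [^] j \<in> tor G p" for j :: nat
    using Suc.prems[of m] N by (induction j) (auto simp: tor_def)
  then show ?case using Suc N by simp
qed (simp add: tor_def)

lemma lin_add:
  assumes N: "\<And>x y. x \<in> tor G p \<Longrightarrow> y \<in> tor G p \<Longrightarrow> x \<otimes> y \<in> tor G p"
    and comm: "\<And>x y. x \<in> tor G p \<Longrightarrow> y \<in> tor G p \<Longrightarrow> x \<otimes> y = y \<otimes> x"
    and b: "\<And>k. k < m \<Longrightarrow> b k \<in> tor G p"
  shows "lin G b (\<lambda>k. (u k + v k) mod p) m = lin G b u m \<otimes> lin G b v m"
  using b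
proof (induction m)
  case (Suc m)
  have tc: "x \<in> tor G p \<Longrightarrow> x \<in> carrier G" for x by (simp add: tor_def)
  have bm: "b m \<in> carrier G" "b m [^] p = \<one>" using Suc.prems[of m] by (simp_all add: tor_def)
  have pw: "b m [^] j \<in> tor G p" for j :: nat
    using Suc.prems[of m] N by (induction j) (auto simp: tor_def)
  have l: "lin G b w m \<in> tor G p" for w using lin_tor[of p m b w] N Suc.prems by simp
  have "lin G b (\<lambda>k. (u k + v k) mod p) (Suc m) = (lin G b u m \<otimes> lin G b v m) \<otimes> (b m [^] u m \<otimes> b m [^] v m)"
    using Suc bm by (simp add: pow_mod_exponent nat_pow_mult)
  also have "\<dots> = lin G b u m \<otimes> (lin G b v m \<otimes> b m [^] u m) \<otimes> b m [^] v m"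
    using bm tc[OF l] by (simp add: m_assoc)
  also have "\<dots> = lin G b u m \<otimes> (b m [^] u m \<otimes> lin G b v m) \<otimes> b m [^] v m"
    using comm[OF l[of v] pw[of "u m"]] by simp
  also have "\<dots> = lin G b u (Suc m) \<otimes> lin G b v (Suc m)"
    using bm tc[OF l] by (simp add: m_assoc)
  finally show ?case .
qed simp

lemma lin_smult:
  assumes N: "\<And>x y. x \<in> tor G p \<Longrightarrow> y \<in> tor G p \<Longrightarrow> x \<otimes> y \<in> tor G p"
    and comm: "\<And>x y. x \<in> tor G p \<Longrightarrow> y \<in> tor G p \<Longrightarrow> x \<otimes> y = y \<otimes> x"
    and b: "\<And>k. k < m \<Longrightarrow> b k \<in> tor G p"
  shows "lin G b (\<lambda>k. u k * j mod p) m = lin G b u m [^] (j::nat)"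
proof (induction j)
  case (Suc j)
  have "lin G b (\<lambda>k. u k * Suc j mod p) m = lin G b (\<lambda>k. (u k * j mod p + u k) mod p) m"
    by (intro lin_cong) (auto simp: mod_add_left_eq mod_add_right_eq add.commute)
  then show ?case using Suc lin_add[OF N comm b, where u = "\<lambda>k. u k * j mod p" and v = u] by simp
qed (simp add: lin_zero)

text \<open>This is the product of a matrix and a vector in the exponents: the columns of
  \<open>A\<close> are combined with the weights \<open>w\<close>. It converts conjugation, known on
  a basis, into the action of a matrix.\<close>

lemma lin_lin:
  assumes N: "\<And>x y. x \<in> tor G p \<Longrightarrow> y \<in> tor G p \<Longrightarrow> x \<otimes> y \<in> tor G p"
    and comm: "\<And>x y. x \<in> tor G p \<Longrightarrow> y \<in> tor G p \<Longrightarrow> x \<otimes> y = y \<otimes> x"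
    and b: "\<And>k. k < m \<Longrightarrow> b k \<in> tor G p"
  shows "lin G (\<lambda>j. lin G b (\<lambda>a. A a j) m) w n = lin G b (\<lambda>a. (\<Sum>j<n. A a j * w j) mod p) m"
proof (induction n)
  case (Suc n)
  have "lin G b (\<lambda>a. (\<Sum>j<Suc n. A a j * w j) mod p) m
      = lin G b (\<lambda>a. ((\<Sum>j<n. A a j * w j) mod p + A a n * w n mod p) mod p) m"
    by (intro lin_cong) (auto simp: mod_simps)
  also have "\<dots> = lin G b (\<lambda>a. (\<Sum>j<n. A a j * w j) mod p) m \<otimes> lin G b (\<lambda>a. A a n) m [^] w n"
    using lin_add[OF N comm b, where u = "\<lambda>a. (\<Sum>j<n. A a j * w j) mod p" and v = "\<lambda>a. A a n * w n mod p"]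
      lin_smult[OF N comm b, where u = "\<lambda>a. A a n" and j = "w n"] by simp
  finally show ?case using Suc by simp
qed (simp add: lin_zero)

end

text \<open>Here \<open>b\<close> is a basis of the torsion, \<open>pos\<close> the inverse of the
  enumeration of its combinations, \<open>r\<close> picks representatives of the cosets and
  \<open>c\<close> numbers them. Column \<open>j\<close> of a matrix consists of the base-p digits
  of the position of the conjugate of \<open>b j\<close>.\<close>

definition quotient_rep :: "('a, 'b) monoid_scheme \<Rightarrow> nat \<Rightarrow> nat \<Rightarrow> (nat \<Rightarrow> 'a) \<Rightarrow> ('a \<Rightarrow> nat)
    \<Rightarrow> nat \<Rightarrow> (nat \<Rightarrow> 'a) \<Rightarrow> ('a \<Rightarrow> nat) \<Rightarrow> rep" where
  "quotient_rep G p m b pos h r c =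
    \<lparr>grp = mat h h (\<lambda>(i, j). c (r i \<otimes>\<^bsub>G\<^esub> r j)), rep_dim = m,
     rep_mats = map (\<lambda>i. mat m m (\<lambda>(a, j).
       pos (r i \<otimes>\<^bsub>G\<^esub> b j \<otimes>\<^bsub>G\<^esub> inv\<^bsub>G\<^esub> r i) div p ^ a mod p)) [0..<h]\<rparr>"

context group begin

lemma conj_pow:
  assumes "g \<in> carrier G" "x \<in> carrier G"
  shows "(g \<otimes> x \<otimes> inv g) [^] (j::nat) = g \<otimes> x [^] j \<otimes> inv g"
proof -
  have "inv g \<otimes> (g \<otimes> y) = y" if "y \<in> carrier G" for y
    using that assms by (simp flip: m_assoc)
  then show ?thesis using assms by (induction j) (auto simp: m_assoc)
qed

lemma conj_tor: "g \<in> carrier G \<Longrightarrow> x \<in> tor G p \<Longrightarrow> g \<otimes> x \<otimes> inv g \<in> tor G p"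
  by (simp add: tor_def conj_pow)

text \<open>Restricted to the complement from \<open>tor_complement\<close>, \<open>c\<close> is a
  bijection onto the numbers of the cosets; its inverse is the splitting. The representatives
  \<open>r\<close> are unrelated to this complement and may be arbitrary, since elements of one
  coset act alike on the abelian torsion.\<close>

lemma split_ext_quotient_rep:
  fixes p q m h :: nat
  assumes C: "Coprime ElemAb ElemAb G" and pq: "prime p" "prime q" "p \<noteq> q"
    and closed: "\<And>x y. x \<in> tor G p \<Longrightarrow> y \<in> tor G p \<Longrightarrow> x \<otimes> y \<in> tor G p"
    and expo: "\<And>x. x \<in> carrier G \<Longrightarrow> x [^] q \<in> tor G p"
    and b: "\<And>k. k < m \<Longrightarrow> b k \<in> tor G p"
    and pos: "\<And>y. y \<in> tor G p \<Longrightarrow> pos y < p ^ m \<and> lin G b (\<lambda>k. pos y div p ^ k mod p) m = y"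
    and inj: "inj_on (\<lambda>i. lin G b (\<lambda>k. i div p ^ k mod p) m) {..<p ^ m}"
    and r: "\<And>i. i < h \<Longrightarrow> r i \<in> carrier G \<and> c (r i) = i"
    and c_less: "\<And>x. x \<in> carrier G \<Longrightarrow> c x < h"
    and c_eq: "\<And>x y. x \<in> carrier G \<Longrightarrow> y \<in> carrier G \<Longrightarrow> c x = c y \<longleftrightarrow> x \<otimes> inv y \<in> tor G p"
  shows "\<exists>E s. split_ext G p q (quotient_rep G p m b pos h r c) E c s"
proof -
  let ?R = "quotient_rep G p m b pos h r c"
  let ?T = "grp ?R" and ?H = "table_group (grp ?R)"
  have p: "p > 0" "p > 1" using pq prime_gt_0_nat prime_gt_1_nat by blast+
  have fin: "finite (carrier G)" using C by (simp add: Coprime_def)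
  have "\<exists>K. subgroup K G \<and> (\<forall>x\<in>K. \<forall>y\<in>K. x \<otimes> y = y \<otimes> x) \<and> (\<forall>x\<in>K. x [^] q = \<one>)
    \<and> (\<forall>x\<in>tor G p. \<forall>y\<in>tor G p. x \<otimes> y = y \<otimes> x) \<and> (\<forall>x\<in>carrier G. \<exists>n\<in>tor G p. \<exists>k\<in>K. x = n \<otimes> k)"
    by (rule tor_complement[OF C pq]) (rule closed expo; assumption)+
  then obtain K where K: "subgroup K G" and Kc: "\<forall>x\<in>K. \<forall>y\<in>K. x \<otimes> y = y \<otimes> x" and Kq: "\<forall>x\<in>K. x [^] q = \<one>"
    and comm: "\<forall>x\<in>tor G p. \<forall>y\<in>tor G p. x \<otimes> y = y \<otimes> x"
    and dec: "\<forall>x\<in>carrier G. \<exists>n\<in>tor G p. \<exists>k\<in>K. x = n \<otimes> k"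
    by (elim exE conjE) (rule that)
  note comm = bspec[OF bspec[OF comm]]
  have KG: "k \<in> carrier G" if "k \<in> K" for k by (rule subgroup.mem_carrier[OF K that])
  have torG: "x \<in> carrier G" if "x \<in> tor G p" for x using that by (simp add: tor_def)
  have lt: "lin G b w m \<in> tor G p" for w
    by (rule lin_tor) (rule closed b; assumption)+
  have cancel: "inv g \<otimes> (g \<otimes> y) = y" "g \<otimes> (inv g \<otimes> y) = y" if "g \<in> carrier G" "y \<in> carrier G" for g y
    using that by (simp_all flip: m_assoc)
  have rG: "r (c x) \<in> carrier G" if "x \<in> carrier G" for x using r[OF c_less[OF that]] by simp
  have rc: "c (r (c x)) = c x" if "x \<in> carrier G" for x using r[OF c_less[OF that]] by simp
  have r_tor: "x \<otimes> inv r (c x) \<in> tor G p" if "x \<in> carrier G" for x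
    using c_eq[OF that rG[OF that]] rc[OF that] by simp
  \<comment> \<open>A product and the product of the representatives differ by a torsion element
    times a conjugate of one.\<close>
  have c_mult: "c (x \<otimes> y) = c (r (c x) \<otimes> r (c y))" if x: "x \<in> carrier G" and y: "y \<in> carrier G" for x y
  proof -
    have "(x \<otimes> y) \<otimes> inv (r (c x) \<otimes> r (c y))
        = (x \<otimes> inv r (c x)) \<otimes> (r (c x) \<otimes> (y \<otimes> inv r (c y)) \<otimes> inv r (c x))"
      using x y rG by (simp add: m_assoc inv_mult_group cancel)
    also have "\<dots> \<in> tor G p" using closed r_tor conj_tor rG x y by metis
    finally show ?thesis using c_eq rG x y by simp
  qed
  have T: "?T \<in> carrier_mat h h" by (simp add: quotient_rep_def)
  have c_img: "c ` carrier G = {..<h}"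
  proof
    show "c ` carrier G \<subseteq> {..<h}" using c_less by auto
    show "{..<h} \<subseteq> c ` carrier G" using r by (metis imageI lessThan_iff subsetI)
  qed
  have T_mult: "c (x \<otimes> y) = ?T $$ (c x, c y)" if "x \<in> carrier G" "y \<in> carrier G" for x y
    using c_mult[OF that] c_less that by (simp add: quotient_rep_def)
  note T_facts = cayley_table_of_surj[OF is_group T c_img T_mult]
  interpret c: group_hom G ?H c
    using T_facts(1,2) is_group by (simp add: group_hom_def group_hom_axioms_def cayley_table_def)
  have tor_K: "x = \<one>" if "x \<in> tor G p" "x \<in> K" for x
    using pow_coprime_one[of x p q] that Kq pq by (simp add: tor_def primes_coprime)
  have c_inj: "inj_on c K"
  proof (rule inj_onI)
    fix k l assume kl: "k \<in> K" "l \<in> K" "c k = c l"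
    then have "k \<otimes> inv l \<in> tor G p" using c_eq KG by simp
    moreover have "k \<otimes> inv l \<in> K"
      using kl K by (simp add: subgroup.m_closed subgroup.m_inv_closed)
    ultimately have "k \<otimes> inv l = \<one>" by (rule tor_K)
    then show "k = l" using KG kl by (metis inv_closed inv_equality inv_inv)
  qed
  have c_K: "\<exists>k\<in>K. c k = i" if i: "i < h" for i
  proof -
    obtain n k where nk: "n \<in> tor G p" "k \<in> K" "r i = n \<otimes> k" using dec r[OF i] by metis
    then have "r i \<otimes> inv k \<in> tor G p" using KG torG by (simp add: m_assoc)
    then have "c (r i) = c k" using c_eq[of "r i" k] KG nk(2) r[OF i] by simp
    then show ?thesis using r[OF i] nk(2) by metis
  qed
  define s where "s = inv_into K c"
  have s: "s i \<in> K" "c (s i) = i" if "i < h" for i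
    using c_K[OF that] unfolding s_def by (metis imageI inv_into_into, metis imageI f_inv_into_f)
  have H_mult: "i \<otimes>\<^bsub>?H\<^esub> j = c (s i \<otimes> s j)" if "i < h" "j < h" for i j
    using that s KG by simp
  have s_hom: "s \<in> hom ?H G"
  proof (rule homI)
    fix i assume "i \<in> carrier ?H"
    then show "s i \<in> carrier G" using s KG T_facts(4) by simp
  next
    fix i j assume "i \<in> carrier ?H" "j \<in> carrier ?H"
    then have ij: "i < h" "j < h" using T_facts(4) by simp_all
    then show "s (i \<otimes>\<^bsub>?H\<^esub> j) = s i \<otimes> s j"
      unfolding H_mult[OF ij] using c_inj s subgroup.m_closed[OF K, of "s i" "s j"] by (simp add: s_def)
  qed
  have H_elem: "elementary_abelian q ?H"
    unfolding elementary_abelian_def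
  proof (intro conjI ballI pq)
    have "i \<otimes>\<^bsub>?H\<^esub> j = j \<otimes>\<^bsub>?H\<^esub> i" if "i < h" "j < h" for i j
      using H_mult that Kc s by metis
    then show "comm_group ?H"
      using T_facts(4) by (intro group.group_comm_groupI c.H.is_group) simp_all
    show "finite (carrier ?H)" using T_facts(4) by simp
    fix i assume "i \<in> carrier ?H"
    then have i: "i < h" using T_facts(4) by simp
    have "c (s i) [^]\<^bsub>?H\<^esub> q = c (s i [^] q)" using KG s(1)[OF i] by (simp add: c.hom_nat_pow)
    then show "i [^]\<^bsub>?H\<^esub> q = \<one>\<^bsub>?H\<^esub>" using s[OF i] Kq by simp
  qed
  define E where "E v = lin G b (\<lambda>k. v $ k) m" for v
  have dim: "rep_dim ?R = m" by (simp add: quotient_rep_def)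
  have E_bij: "bij_betw E (Zp_vec p m) (tor G p)"
  proof -
    let ?E = "\<lambda>i. lin G b (\<lambda>k. i div p ^ k mod p) m"
    have "?E ` {..<p ^ m} = tor G p"
    proof
      show "?E ` {..<p ^ m} \<subseteq> tor G p" by (rule image_subsetI) (rule lt)
      show "tor G p \<subseteq> ?E ` {..<p ^ m}"
      proof
        fix y assume "y \<in> tor G p"
        from pos[OF this] show "y \<in> ?E ` {..<p ^ m}" by (intro image_eqI[of _ _ "pos y"]) simp_all
      qed
    qed
    then have "bij_betw ?E {..<p ^ m} (tor G p)" using inj by (simp add: bij_betw_def)
    then have "bij_betw (?E \<circ> vec_code p) (Zp_vec p m) (tor G p)"
      using vec_code_bij[OF p(1)] by (rule bij_betw_trans[rotated])
    moreover have "(?E \<circ> vec_code p) v = E v" if "v \<in> Zp_vec p m" for v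
      unfolding E_def comp_def using that by (intro lin_cong) (simp_all add: vec_code_digit)
    ultimately show ?thesis using bij_betw_cong[of "Zp_vec p m" E "?E \<circ> vec_code p"] by simp
  qed
  have E_tor: "E v \<in> tor G p" for v unfolding E_def by (rule lt)
  have act: "E (vec_mod p ((rep_mats ?R ! c x) *\<^sub>v v)) = x \<otimes> E v \<otimes> inv x"
    if x: "x \<in> carrier G" and v: "v \<in> Zp_vec p m" for x v
  proof -
    let ?r = "r (c x)" and ?A = "rep_mats ?R ! c x"
    let ?n = "x \<otimes> inv ?r"
    have A: "?A = mat m m (\<lambda>(a, j). pos (?r \<otimes> b j \<otimes> inv ?r) div p ^ a mod p)"
      using c_less[OF x] by (simp add: quotient_rep_def)
    have r': "?r \<in> carrier G" by (rule rG[OF x])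
    \<comment> \<open>With \<open>x\<close> written as \<open>?n\<close> times the representative,
      the torsion element \<open>?n\<close> commutes with the conjugate in the middle and
      cancels.\<close>
    have "x \<otimes> E v \<otimes> inv x = ?n \<otimes> (?r \<otimes> E v \<otimes> inv ?r) \<otimes> inv ?n"
      using x r' torG[OF E_tor[of v]] by (simp add: m_assoc inv_mult_group cancel)
    also have "\<dots> = (?r \<otimes> E v \<otimes> inv ?r) \<otimes> ?n \<otimes> inv ?n"
      using comm[OF r_tor[OF x] conj_tor[OF r' E_tor[of v]]] by simp
    also have "\<dots> = ?r \<otimes> E v \<otimes> inv ?r"
      using x r' torG[OF E_tor[of v]] by (simp add: m_assoc)
    also have "\<dots> = lin G (\<lambda>j. ?r \<otimes> b j \<otimes> inv ?r) (\<lambda>k. v $ k) m"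
      unfolding E_def using r' torG[OF b] by (rule lin_conj)
    also have "\<dots> = lin G (\<lambda>j. lin G b (\<lambda>a. ?A $$ (a, j)) m) (\<lambda>k. v $ k) m"
    proof (rule lin_cong)
      fix j assume j: "j < m"
      have "?r \<otimes> b j \<otimes> inv ?r = lin G b (\<lambda>k. pos (?r \<otimes> b j \<otimes> inv ?r) div p ^ k mod p) m"
        using pos[OF conj_tor[OF r' b[OF j]]] by simp
      also have "\<dots> = lin G b (\<lambda>a. ?A $$ (a, j)) m"
        using j by (intro lin_cong) (simp_all add: A)
      finally show "?r \<otimes> b j \<otimes> inv ?r = lin G b (\<lambda>a. ?A $$ (a, j)) m" .
    qed simp
    also have "\<dots> = lin G b (\<lambda>a. (\<Sum>j<m. ?A $$ (a, j) * v $ j) mod p) m"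
      by (rule lin_lin) (rule closed comm b; assumption)+
    also have "\<dots> = E (vec_mod p (?A *\<^sub>v v))"
      unfolding E_def using v A
      by (intro lin_cong) (simp_all add: mult_mat_vec_index Zp_vecD del: index_mult_mat_vec)
    finally show ?thesis by simp
  qed
  have "split_ext G p q ?R E c s"
  proof (rule split_ext.intro, goal_cases)
    case 6 show ?case by (rule T_facts(1))
  next
    case 8 show ?case using T by (simp add: quotient_rep_def)
  next
    case (9 i)
    then have "i < h" using T_facts(4) by simp
    then show ?case using p by (auto simp: quotient_rep_def Zp_mat_def)
  next
    case 10 show ?case using E_bij dim by simp
  next
    case (11 u v)
    have "E (vec_mod p (u + v)) = lin G b (\<lambda>k. (u $ k + v $ k) mod p) m"
      unfolding E_def using 11 by (intro lin_cong) (simp_all add: dim Zp_vecD)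
    also have "\<dots> = E u \<otimes> E v"
      unfolding E_def by (rule lin_add) (rule closed comm b; assumption)+
    finally show ?case .
  next
    case 13 from s_hom show ?case .
  next
    case (14 i) then show ?case using s(2) T_facts(4) by simp
  next
    case (15 x)
    then show ?case using c_eq[OF 15 one_closed] by simp
  next
    case (16 x v) then show ?case using act dim by simp
  qed (rule pq fin H_elem T_facts(2) is_group s_hom)+
  then show ?thesis by blast
qed

end

text \<open>Transports the structure from semidirect products, whose elements are pairs, to their
  tables. The representation stays the same.\<close>

lemma split_ext_iso:
  assumes S: "split_ext G p q R E c s" and G': "group G'"
    and f: "f \<in> hom G G'" and bij: "bij_betw f (carrier G) (carrier G')"
  shows "split_ext G' p q R (f \<circ> E) (c \<circ> inv_into (carrier G) f) (f \<circ> s)"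
proof -
  interpret split_ext G p q R E c s by (rule S)
  interpret f: group_hom G G' f using f G' group by (simp add: group_hom_def group_hom_axioms_def)
  let ?g = "inv_into (carrier G) f"
  have gf: "?g (f x) = x" if "x \<in> carrier G" for x using that bij by (simp add: bij_betw_def)
  have fg: "f (?g y) = y" "?g y \<in> carrier G" if "y \<in> carrier G'" for y
    using that bij by (auto simp: bij_betw_def f_inv_into_f inv_into_into)
  have f_eq: "f x = f y \<longleftrightarrow> x = y" if "x \<in> carrier G" "y \<in> carrier G" for x y
    using that gf by metis
  have f_tor: "f x \<in> tor G' p \<longleftrightarrow> x \<in> tor G p" if "x \<in> carrier G" for x
    using that f_eq[of "x [^]\<^bsub>G\<^esub> p" "\<one>\<^bsub>G\<^esub>"] by (simp add: tor_def f.hom_nat_pow)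
  have tor_img: "f ` tor G p = tor G' p"
  proof
    show "f ` tor G p \<subseteq> tor G' p" using f_tor tor_closed by (metis image_subsetI)
    show "tor G' p \<subseteq> f ` tor G p"
    proof
      fix y assume y: "y \<in> tor G' p"
      then have "y \<in> carrier G'" by (simp add: tor_def)
      then show "y \<in> f ` tor G p" using f_tor[of "?g y"] fg[of y] y by (metis imageI)
    qed
  qed
  show ?thesis
  proof (rule split_ext.intro, goal_cases)
    case 10
    have "bij_betw f (tor G p) (tor G' p)"
      using bij tor_closed tor_img by (intro bij_betw_subset[OF bij]) auto
    with E_bij show ?case by (rule bij_betw_trans)
  next
    case (11 u v) then show ?case by (simp add: E_add E_closed)
  next
    case 12
    show ?case
    proof (rule homI)
      fix x assume "x \<in> carrier G'"
      then show "(c \<circ> ?g) x \<in> carrier H" using fg by simp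
    next
      fix x y assume xy: "x \<in> carrier G'" "y \<in> carrier G'"
      then have "?g (x \<otimes>\<^bsub>G'\<^esub> y) = ?g x \<otimes>\<^bsub>G\<^esub> ?g y"
        using gf[of "?g x \<otimes>\<^bsub>G\<^esub> ?g y"] fg by simp
      then show "(c \<circ> ?g) (x \<otimes>\<^bsub>G'\<^esub> y) = (c \<circ> ?g) x \<otimes>\<^bsub>H\<^esub> (c \<circ> ?g) y" using xy fg by simp
    qed
  next
    case 13 show ?case by (intro homI) simp_all
  next
    case (14 i) then show ?case by (simp add: gf c_s)
  next
    case (15 y) then show ?case using c_one[of "?g y"] f_tor[of "?g y"] fg by simp
  next
    case (16 y v)
    then show ?case using act[of "?g y" v] fg[of y] E_closed[of v] f.hom_inv[of "?g y"] by simp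
  next
    case 5
    show ?case using bij finite bij_betw_finite by metis
  qed (rule primes G' table elem_ab length_mats mats; assumption?)+
qed

section \<open>Epimorphisms and epivalences\<close>

text \<open>An arbitrary preimage \<open>x\<close> need not be torsion, but its power with exponent
  \<open>q * k\<close> is. If \<open>q * k\<close> is 1 modulo \<open>p\<close>, this power still
  maps to \<open>y\<close>, because \<open>y\<close> has exponent \<open>p\<close>.\<close>

lemma epi_tor_surj:
  assumes G1: "group G1" and G2: "group G2" and f: "f \<in> epi G1 G2" and pq: "coprime q p" "p > 1"
    and expo: "\<And>x. x \<in> carrier G1 \<Longrightarrow> x [^]\<^bsub>G1\<^esub> q \<in> tor G1 p" and y: "y \<in> tor G2 p"
  shows "\<exists>x\<in>tor G1 p. f x = y"
proof -
  have hom: "f \<in> hom G1 G2" and surj: "f ` carrier G1 = carrier G2" using f by (simp_all add: epi_def)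
  interpret f: group_hom G1 G2 f using G1 G2 hom by (simp add: group_hom_def group_hom_axioms_def)
  have yc: "y \<in> carrier G2" "y [^]\<^bsub>G2\<^esub> p = \<one>\<^bsub>G2\<^esub>" using y by (simp_all add: tor_def)
  obtain x where x: "x \<in> carrier G1" "f x = y" using surj yc(1) by (metis imageE)
  obtain k where "[q * k = Suc 0] (mod p)" using cong_solve_coprime_nat[OF pq(1)] by blast
  then have k: "q * k mod p = 1" using pq(2) by (simp add: cong_def)
  have "((x [^]\<^bsub>G1\<^esub> q) [^]\<^bsub>G1\<^esub> k) [^]\<^bsub>G1\<^esub> p = ((x [^]\<^bsub>G1\<^esub> q) [^]\<^bsub>G1\<^esub> p) [^]\<^bsub>G1\<^esub> k"
    using x(1) by (simp add: f.G.nat_pow_pow ac_simps)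
  then have "(x [^]\<^bsub>G1\<^esub> q) [^]\<^bsub>G1\<^esub> k \<in> tor G1 p" using expo[OF x(1)] x(1) by (simp add: tor_def)
  moreover have "f ((x [^]\<^bsub>G1\<^esub> q) [^]\<^bsub>G1\<^esub> k) = y [^]\<^bsub>G2\<^esub> (q * k)"
    using x yc(1) by (simp add: f.hom_nat_pow f.H.nat_pow_pow)
  moreover have "y [^]\<^bsub>G2\<^esub> (q * k) = y"
    using f.H.pow_mod_exponent[OF yc, of "q * k"] k yc(1) by simp
  ultimately show ?thesis by metis
qed

theorem epi_iff_epivalent:
  assumes 1: "split_ext G1 p q R1 E1 c1 s1" and 2: "split_ext G2 p q R2 E2 c2 s2"
  shows "epi G1 G2 \<noteq> {} \<longleftrightarrow> epivalent (p, R1, R2)"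
proof -
  interpret A: split_ext G1 p q R1 E1 c1 s1 by (rule 1)
  interpret B: split_ext G2 p q R2 E2 c2 s2 by (rule 2)
  show ?thesis
  proof
    assume "epi G1 G2 \<noteq> {}"
    then obtain f where f: "f \<in> hom G1 G2" and surj: "f ` carrier G1 = carrier G2"
      by (auto simp: epi_def)
    interpret f: group_hom G1 G2 f by unfold_locales (rule f)
    have f_tor: "f x \<in> tor G2 p" if "x \<in> tor G1 p" for x
      using that f.hom_nat_pow[of x p] by (auto simp: tor_def)
    have f_tor_surj: "\<exists>x \<in> tor G1 p. f x = y" if "y \<in> tor G2 p" for y
    proof (rule epi_tor_surj[OF A.group B.group _ _ _ _ that])
      show "f \<in> epi G1 G2" using f surj by (rule epiI)
      show "coprime q p" "p > 1" using A.primes prime_gt_1_nat by (simp_all add: primes_coprime)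
    qed (rule A.pow_q_tor)
    \<comment> \<open>The restriction of \<open>f\<close> to the torsion, in coordinates.\<close>
    define \<rho> where "\<rho> v = inv_into B.W E2 (f (E1 v))" for v
    have \<rho>: "\<rho> v \<in> B.W" "E2 (\<rho> v) = f (E1 v)" if "v \<in> A.W" for v
      using f_tor[OF A.E_tor[OF that]] B.E_bij unfolding \<rho>_def bij_betw_def
      by (auto simp: inv_into_into f_inv_into_f)
    define \<phi> where "\<phi> h = c2 (f (s1 h))" for h
    have \<phi>_hom: "\<phi> \<in> hom A.H B.H" by (rule homI) (auto simp: \<phi>_def)
    \<comment> \<open>Since \<open>f\<close> maps torsion to torsion, \<open>c2\<close> does not see
      the torsion part of \<open>x\<close>; in particular \<open>\<phi>\<close> does not depend on
      the choice of the splitting.\<close>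
    have c2f: "c2 (f x) = \<phi> (c1 x)" if x: "x \<in> carrier G1" for x
    proof -
      have "c2 (f (x \<otimes>\<^bsub>G1\<^esub> inv\<^bsub>G1\<^esub> s1 (c1 x))) = \<one>\<^bsub>B.H\<^esub>"
        using f_tor[OF A.tor_part[OF x]] B.c_one B.tor_closed by metis
      moreover have "c2 (f x) = c2 (f (x \<otimes>\<^bsub>G1\<^esub> inv\<^bsub>G1\<^esub> s1 (c1 x)) \<otimes>\<^bsub>G2\<^esub> f (s1 (c1 x)))"
        using A.decomp[OF x] f.hom_mult[of "x \<otimes>\<^bsub>G1\<^esub> inv\<^bsub>G1\<^esub> s1 (c1 x)" "s1 (c1 x)"] x
        by (metis A.G.inv_closed A.G.m_closed A.sc)
      moreover have "x \<otimes>\<^bsub>G1\<^esub> inv\<^bsub>G1\<^esub> s1 (c1 x) \<in> carrier G1" using x by simp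
      ultimately show ?thesis
        unfolding \<phi>_def using x by (metis A.sc B.H.l_one B.c.hom_closed B.c.hom_mult f.hom_closed)
    qed
    have "\<phi> ` carrier A.H = carrier B.H"
    proof
      show "\<phi> ` carrier A.H \<subseteq> carrier B.H" using \<phi>_hom by (auto simp: hom_def)
      show "carrier B.H \<subseteq> \<phi> ` carrier A.H"
      proof
        fix k assume k: "k \<in> carrier B.H"
        then obtain x where "x \<in> carrier G1" "f x = s2 k" using surj B.s.hom_closed by (metis imageE)
        then show "k \<in> \<phi> ` carrier A.H" using c2f[of x] B.c_s[OF k] by auto
      qed
    qed
    then have \<phi>: "\<phi> \<in> epi A.H B.H" using \<phi>_hom by (simp add: epi_def)
    have "Zp_linear p A.m B.m \<rho>"
      unfolding Zp_linear_def
    proof (intro conjI ballI allI impI funcsetI)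
      show "\<rho> u \<in> B.W" if "u \<in> A.W" for u using \<rho> that by blast
      fix u v assume u: "u \<in> A.W" and v: "v \<in> A.W"
      show "\<rho> (vec_mod p (u + v)) = vec_mod p (\<rho> u + \<rho> v)"
        by (rule B.E_inj) (use u v \<rho> A.add_closed B.add_closed in
          \<open>simp_all add: A.E_add B.E_add A.E_closed\<close>)
    next
      fix k v assume v: "v \<in> A.W"
      show "\<rho> (vec_mod p (k \<cdot>\<^sub>v v)) = vec_mod p (k \<cdot>\<^sub>v \<rho> v)"
        by (rule B.E_inj) (use v \<rho> A.smult_closed B.smult_closed in
          \<open>simp_all add: A.E_smult B.E_smult A.E_closed f.hom_nat_pow\<close>)
    qed
    moreover have "\<rho> ` A.W = B.W"
    proof
      show "\<rho> ` A.W \<subseteq> B.W" using \<rho> by blast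
      show "B.W \<subseteq> \<rho> ` A.W"
      proof
        fix w assume w: "w \<in> B.W"
        obtain x where x: "x \<in> tor G1 p" "f x = E2 w" using f_tor_surj[OF B.E_tor[OF w]] by blast
        obtain v where v: "v \<in> A.W" "x = E1 v" using A.E_surj[OF x(1)] by blast
        then have "w = \<rho> v" using \<rho>[OF v(1)] x w B.E_inj by metis
        then show "w \<in> \<rho> ` A.W" using v by blast
      qed
    qed
    moreover have "\<rho> (vec_mod p ((rep_mats R1 ! h) *\<^sub>v v)) = vec_mod p ((rep_mats R2 ! \<phi> h) *\<^sub>v \<rho> v)"
      if h: "h \<in> carrier A.H" and v: "v \<in> A.W" for h v
    proof (rule B.E_inj)
      have \<phi>h: "\<phi> h \<in> carrier B.H" using \<phi>_hom h by (auto simp: hom_def)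
      show "\<rho> (vec_mod p ((rep_mats R1 ! h) *\<^sub>v v)) \<in> B.W"
        using \<rho> A.act_closed h v by blast
      show "vec_mod p ((rep_mats R2 ! \<phi> h) *\<^sub>v \<rho> v) \<in> B.W"
        using \<rho> B.act_closed \<phi>h v by blast
      have "E2 (\<rho> (vec_mod p ((rep_mats R1 ! h) *\<^sub>v v))) = f (s1 h \<otimes>\<^bsub>G1\<^esub> E1 v \<otimes>\<^bsub>G1\<^esub> inv\<^bsub>G1\<^esub> s1 h)"
        using \<rho> A.act_closed[OF h v] A.act[of "s1 h" v] A.c_s h v by simp
      also have "\<dots> = f (s1 h) \<otimes>\<^bsub>G2\<^esub> E2 (\<rho> v) \<otimes>\<^bsub>G2\<^esub> inv\<^bsub>G2\<^esub> f (s1 h)"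
        using h v \<rho> A.E_closed by simp
      also have "\<dots> = E2 (vec_mod p ((rep_mats R2 ! \<phi> h) *\<^sub>v \<rho> v))"
        using B.act[of "f (s1 h)" "\<rho> v"] \<rho> h v by (simp add: \<phi>_def)
      finally show "E2 (\<rho> (vec_mod p ((rep_mats R1 ! h) *\<^sub>v v))) = E2 (vec_mod p ((rep_mats R2 ! \<phi> h) *\<^sub>v \<rho> v))" .
    qed
    ultimately show "epivalent (p, R1, R2)" unfolding epivalent_def using \<phi> by blast
  next
    assume "epivalent (p, R1, R2)"
    then obtain \<phi> \<rho> where \<phi>: "\<phi> \<in> hom A.H B.H" "\<phi> ` carrier A.H = carrier B.H"
      and lin: "Zp_linear p A.m B.m \<rho>" and \<rho>_surj: "\<rho> ` A.W = B.W"
      and eqv: "\<And>h v. h \<in> carrier A.H \<Longrightarrow> v \<in> A.W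
        \<Longrightarrow> \<rho> (vec_mod p ((rep_mats R1 ! h) *\<^sub>v v)) = vec_mod p ((rep_mats R2 ! \<phi> h) *\<^sub>v \<rho> v)"
      unfolding epivalent_def epi_def by auto
    interpret \<phi>: group_hom A.H B.H \<phi> by unfold_locales (rule \<phi>(1))
    define \<theta> where "\<theta> x = E2 (\<rho> (inv_into A.W E1 x))" for x
    have \<rho>_closed: "\<rho> v \<in> B.W" if "v \<in> A.W" for v using \<rho>_surj that by (metis imageI)
    have \<theta>: "\<theta> (E1 v) = E2 (\<rho> v)" if "v \<in> A.W" for v
      using that A.E_bij by (simp add: \<theta>_def bij_betw_def)
    have \<theta>_closed: "\<theta> x \<in> carrier G2" if "x \<in> tor G1 p" for x
      using A.E_surj[OF that] \<theta> \<rho>_closed B.E_closed by auto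
    have \<theta>_mult: "\<theta> (x \<otimes>\<^bsub>G1\<^esub> y) = \<theta> x \<otimes>\<^bsub>G2\<^esub> \<theta> y" if xy: "x \<in> tor G1 p" "y \<in> tor G1 p" for x y
    proof -
      obtain u v where uv: "u \<in> A.W" "v \<in> A.W" "x = E1 u" "y = E1 v" using A.E_surj xy by metis
      have "x \<otimes>\<^bsub>G1\<^esub> y = E1 (vec_mod p (u + v))" using A.E_add uv by simp
      then have "\<theta> (x \<otimes>\<^bsub>G1\<^esub> y) = E2 (\<rho> (vec_mod p (u + v)))" using \<theta> A.add_closed uv by simp
      also have "\<dots> = E2 (vec_mod p (\<rho> u + \<rho> v))" using lin uv by (simp add: Zp_linear_def)
      finally show ?thesis using uv \<theta> B.E_add \<rho>_closed by simp
    qed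
    \<comment> \<open>Equivariance of \<open>\<rho>\<close> expressed in the groups. All elements
      above \<open>\<phi> (c1 x)\<close> act alike; \<open>s2\<close> supplies the one that occurs
      in the definition of \<open>g\<close>.\<close>
    have \<theta>_conj: "\<theta> (x \<otimes>\<^bsub>G1\<^esub> y \<otimes>\<^bsub>G1\<^esub> inv\<^bsub>G1\<^esub> x)
        = s2 (\<phi> (c1 x)) \<otimes>\<^bsub>G2\<^esub> \<theta> y \<otimes>\<^bsub>G2\<^esub> inv\<^bsub>G2\<^esub> s2 (\<phi> (c1 x))"
      if x: "x \<in> carrier G1" and y: "y \<in> tor G1 p" for x y
    proof -
      obtain v where v: "v \<in> A.W" "y = E1 v" using A.E_surj y by metis
      have "\<theta> (x \<otimes>\<^bsub>G1\<^esub> y \<otimes>\<^bsub>G1\<^esub> inv\<^bsub>G1\<^esub> x) = E2 (\<rho> (vec_mod p ((rep_mats R1 ! c1 x) *\<^sub>v v)))"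
        using \<theta>[OF A.act_closed[OF A.c.hom_closed[OF x] v(1)]] A.act[OF x v(1)] v(2) by simp
      also have "\<dots> = E2 (vec_mod p ((rep_mats R2 ! \<phi> (c1 x)) *\<^sub>v \<rho> v))" using eqv x v by simp
      also have "\<dots> = s2 (\<phi> (c1 x)) \<otimes>\<^bsub>G2\<^esub> E2 (\<rho> v) \<otimes>\<^bsub>G2\<^esub> inv\<^bsub>G2\<^esub> s2 (\<phi> (c1 x))"
        using B.act[of "s2 (\<phi> (c1 x))" "\<rho> v"] B.c_s \<rho>_closed x v by simp
      finally show ?thesis using \<theta> v by simp
    qed
    let ?t = "\<lambda>x. x \<otimes>\<^bsub>G1\<^esub> inv\<^bsub>G1\<^esub> s1 (c1 x)" and ?S = "\<lambda>x. s2 (\<phi> (c1 x))"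
    \<comment> \<open>The torsion part is mapped by \<open>\<theta>\<close> and the part in the
      complement by \<open>\<phi>\<close>, read through the splittings.\<close>
    define g where "g x = \<theta> (?t x) \<otimes>\<^bsub>G2\<^esub> ?S x" for x
    \<comment> \<open>Taking torsion parts is a homomorphism only up to conjugation, which
      \<open>\<theta>_conj\<close> carries over to the second group.\<close>
    have t_mult: "?t (x \<otimes>\<^bsub>G1\<^esub> y) = ?t x \<otimes>\<^bsub>G1\<^esub> (s1 (c1 x) \<otimes>\<^bsub>G1\<^esub> ?t y \<otimes>\<^bsub>G1\<^esub> inv\<^bsub>G1\<^esub> s1 (c1 x))"
      if "x \<in> carrier G1" "y \<in> carrier G1" for x y
      using that by (simp add: A.G.inv_mult_group A.G.m_assoc A.G.inv_solve_left)
    have "g \<in> hom G1 G2"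
    proof (rule homI)
      fix x assume "x \<in> carrier G1"
      then show "g x \<in> carrier G2" using \<theta>_closed A.tor_part by (simp add: g_def)
    next
      fix x y assume x: "x \<in> carrier G1" and y: "y \<in> carrier G1"
      have conj: "s1 (c1 x) \<otimes>\<^bsub>G1\<^esub> ?t y \<otimes>\<^bsub>G1\<^esub> inv\<^bsub>G1\<^esub> s1 (c1 x) \<in> tor G1 p"
        using A.tor_part[OF y] x normal.inv_op_closed2[OF A.tor_normal] by simp
      have "g (x \<otimes>\<^bsub>G1\<^esub> y) = \<theta> (?t x) \<otimes>\<^bsub>G2\<^esub> (?S x \<otimes>\<^bsub>G2\<^esub> \<theta> (?t y) \<otimes>\<^bsub>G2\<^esub> inv\<^bsub>G2\<^esub> ?S x) \<otimes>\<^bsub>G2\<^esub> (?S x \<otimes>\<^bsub>G2\<^esub> ?S y)"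
        unfolding g_def t_mult[OF x y] \<theta>_mult[OF A.tor_part[OF x] conj]
        using \<theta>_conj[of "s1 (c1 x)" "?t y"] A.tor_part[OF y] x y A.c_s by simp
      also have "\<dots> = g x \<otimes>\<^bsub>G2\<^esub> g y"
        using x y \<theta>_closed[OF A.tor_part[OF x]] \<theta>_closed[OF A.tor_part[OF y]]
        by (simp add: g_def B.G.m_assoc) (simp flip: B.G.m_assoc)
      finally show "g (x \<otimes>\<^bsub>G1\<^esub> y) = g x \<otimes>\<^bsub>G2\<^esub> g y" .
    qed
    moreover have "carrier G2 \<subseteq> g ` carrier G1"
    proof
      fix y assume y: "y \<in> carrier G2"
      obtain w where w: "w \<in> B.W" "y \<otimes>\<^bsub>G2\<^esub> inv\<^bsub>G2\<^esub> s2 (c2 y) = E2 w"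
        using B.E_surj[OF B.tor_part[OF y]] by blast
      obtain v where v: "v \<in> A.W" "w = \<rho> v" using w \<rho>_surj by (metis imageE)
      obtain h where h: "h \<in> carrier A.H" "c2 y = \<phi> h" using \<phi>(2) B.c.hom_closed[OF y] by (metis imageE)
      \<comment> \<open>The torsion part and the quotient part of \<open>y\<close> are lifted
        separately.\<close>
      let ?x = "E1 v \<otimes>\<^bsub>G1\<^esub> s1 h"
      have "c1 (E1 v) = \<one>\<^bsub>A.H\<^esub>" using A.c_one A.E_tor A.E_closed v by metis
      then have cx: "c1 ?x = h" using A.E_closed v h A.c_s by simp
      then have "?t ?x = E1 v" using A.E_closed v h by (simp add: A.G.m_assoc)
      then have "g ?x = E2 w \<otimes>\<^bsub>G2\<^esub> s2 (c2 y)" unfolding g_def cx using \<theta> v h by simp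
      also have "\<dots> = y" using w(2) B.decomp[OF y] by simp
      finally show "y \<in> g ` carrier G1" using A.E_closed v h
        by (metis A.G.m_closed A.s.hom_closed image_eqI)
    qed
    ultimately have "g \<in> epi G1 G2" by (auto simp: epi_def hom_def)
    then show "epi G1 G2 \<noteq> {}" by blast
  qed
qed

section \<open>Semidirect products\<close>

definition semidirect :: "nat \<Rightarrow> rep \<Rightarrow> (nat vec \<times> nat) monoid" where
  "semidirect p R =
    \<lparr>carrier = Zp_vec p (rep_dim R) \<times> carrier (table_group (grp R)),
     monoid.mult = (\<lambda>(v, g) (w, k). (vec_mod p (v + (rep_mats R ! g) *\<^sub>v w), g \<otimes>\<^bsub>table_group (grp R)\<^esub> k)),
     one = (0\<^sub>v (rep_dim R), \<one>\<^bsub>table_group (grp R)\<^esub>)\<rparr>"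

definition pair_code :: "nat \<Rightarrow> nat \<Rightarrow> nat vec \<times> nat \<Rightarrow> nat" where
  "pair_code p h = (\<lambda>(v, g). vec_code p v * h + g)"

definition semidirect_table :: "nat \<Rightarrow> rep \<Rightarrow> nat mat" where
  "semidirect_table p R =
    (let h = dim_row (grp R); n = p ^ rep_dim R * h;
       dec = (\<lambda>x. (vec_decode p (rep_dim R) (x div h), x mod h))
     in mat n n (\<lambda>(x, y). pair_code p h (dec x \<otimes>\<^bsub>semidirect p R\<^esub> dec y)))"

locale rep_ext =
  fixes p q :: nat and R :: rep
  assumes primes: "prime p" "prime q" "p \<noteq> q" and is_rep: "is_rep p R"
    and elem_ab: "elementary_abelian q (table_group (grp R))"
begin

abbreviation "H \<equiv> table_group (grp R)"
abbreviation "m \<equiv> rep_dim R"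
abbreviation "W \<equiv> Zp_vec p m"
abbreviation "A h \<equiv> rep_mats R ! h"
abbreviation "S \<equiv> semidirect p R"

sublocale H: group H using elementary_abelianD(3)[OF elem_ab] .

lemma p_pos: "p > 0" using primes prime_gt_0_nat by blast

lemma A_GL: "h \<in> carrier H \<Longrightarrow> A h \<in> carrier (GL m p)"
  using is_rep by (auto simp: is_rep_def hom_def)

lemma A_Zp: "h \<in> carrier H \<Longrightarrow> A h \<in> Zp_mat p m"
  using A_GL by (auto simp: GL_def)

lemma A_mat: "h \<in> carrier H \<Longrightarrow> A h \<in> carrier_mat m m"
  using A_Zp by (auto simp: Zp_mat_def)

lemma A_mult: "h \<in> carrier H \<Longrightarrow> k \<in> carrier H \<Longrightarrow> A (h \<otimes>\<^bsub>H\<^esub> k) = mat_mod p (A h * A k)"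
  using is_rep by (auto simp: is_rep_def hom_def GL_def)

lemma W_carrier: "v \<in> W \<Longrightarrow> v \<in> carrier_vec m"
  by (auto simp: Zp_vec_def)

lemma act_closed: "h \<in> carrier H \<Longrightarrow> v \<in> carrier_vec m \<Longrightarrow> A h *\<^sub>v v \<in> carrier_vec m"
  using A_mat by (metis mult_mat_vec_carrier)

lemma mod_closed: "v \<in> carrier_vec m \<Longrightarrow> vec_mod p v \<in> W"
  using p_pos by (intro vec_mod_Zp_vec) auto

lemma vec_mod_add_right:
  "u \<in> carrier_vec m \<Longrightarrow> v \<in> carrier_vec m \<Longrightarrow> vec_mod p (u + vec_mod p v) = vec_mod p (u + v)"
  by (intro eq_vecI) (auto simp: mod_add_right_eq)

lemma vec_mod_add_left:
  "u \<in> carrier_vec m \<Longrightarrow> v \<in> carrier_vec m \<Longrightarrow> vec_mod p (vec_mod p u + v) = vec_mod p (u + v)"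
  by (intro vec_mod_add_cong) auto

lemma act_vec_mod:
  "h \<in> carrier H \<Longrightarrow> v \<in> carrier_vec m \<Longrightarrow> vec_mod p (A h *\<^sub>v vec_mod p v) = vec_mod p (A h *\<^sub>v v)"
  using A_mat[of h] by (intro vec_mod_mult_vec_mod) auto

lemma act_mult:
  assumes "h \<in> carrier H" "k \<in> carrier H" "v \<in> carrier_vec m"
  shows "vec_mod p (A (h \<otimes>\<^bsub>H\<^esub> k) *\<^sub>v v) = vec_mod p (A h *\<^sub>v (A k *\<^sub>v v))"
proof -
  have "vec_mod p (A (h \<otimes>\<^bsub>H\<^esub> k) *\<^sub>v v) = vec_mod p ((A h * A k) *\<^sub>v v)"
    unfolding A_mult[OF assms(1,2)] using A_mat[OF assms(1)] A_mat[OF assms(2)] assms(3) by (intro vec_mod_mat_mod_mult) auto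
  also have "(A h * A k) *\<^sub>v v = A h *\<^sub>v (A k *\<^sub>v v)"
    using A_mat[OF assms(1)] A_mat[OF assms(2)] assms(3) by (intro assoc_mult_mat_vec[of _ m m _ m]) auto
  finally show ?thesis .
qed

text \<open>The matrix of the neutral element is an invertible idempotent and hence the identity.
  This has to be derived, since membership in \<open>hom\<close> demands compatibility with products
  only. The argument runs on vectors, with a left inverse \<open>B\<close>.\<close>

lemma act_one:
  assumes v: "v \<in> W"
  shows "vec_mod p (A \<one>\<^bsub>H\<^esub> *\<^sub>v v) = v"
proof -
  let ?M = "A \<one>\<^bsub>H\<^esub>"
  have vc: "v \<in> carrier_vec m" by (rule W_carrier[OF v])
  have M: "?M \<in> carrier_mat m m" by (rule A_mat) simp
  obtain B where B: "B \<in> carrier_mat m m" "mat_mod p (B * ?M) = 1\<^sub>m m"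
    using A_GL[of "\<one>\<^bsub>H\<^esub>"] by (auto simp: GL_def Zp_mat_def)
  have BM: "vec_mod p (B *\<^sub>v (?M *\<^sub>v u)) = vec_mod p u" if u: "u \<in> carrier_vec m" for u
  proof -
    have "B *\<^sub>v (?M *\<^sub>v u) = (B * ?M) *\<^sub>v u"
      using B M u by (intro assoc_mult_mat_vec[of _ m m _ m, symmetric]) auto
    also have "vec_mod p \<dots> = vec_mod p (mat_mod p (B * ?M) *\<^sub>v u)"
      using B M u by (intro vec_mod_mat_mod_mult[symmetric]) auto
    also have "\<dots> = vec_mod p u" using B(2) u by simp
    finally show ?thesis .
  qed
  have Mv: "?M *\<^sub>v v \<in> carrier_vec m" using M vc by auto
  have MMv: "?M *\<^sub>v (?M *\<^sub>v v) \<in> carrier_vec m" using M Mv by auto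
  have "vec_mod p (?M *\<^sub>v v) = vec_mod p (B *\<^sub>v (?M *\<^sub>v (?M *\<^sub>v v)))"
    using BM[OF Mv] by simp
  also have "\<dots> = vec_mod p (B *\<^sub>v vec_mod p (?M *\<^sub>v (?M *\<^sub>v v)))"
    using B M MMv by (intro vec_mod_mult_vec_mod[symmetric]) auto
  also have "vec_mod p (?M *\<^sub>v (?M *\<^sub>v v)) = vec_mod p (?M *\<^sub>v v)"
    using act_mult[of "\<one>\<^bsub>H\<^esub>" "\<one>\<^bsub>H\<^esub>" v] vc by simp
  also have "vec_mod p (B *\<^sub>v vec_mod p (?M *\<^sub>v v)) = vec_mod p (B *\<^sub>v (?M *\<^sub>v v))"
    using B M Mv by (intro vec_mod_mult_vec_mod) auto
  also have "\<dots> = v" using BM[OF vc] vec_mod_ident[OF v] by simp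
  finally show ?thesis .
qed

lemma S_carrier: "carrier S = W \<times> carrier H" by (simp add: semidirect_def)
lemma S_mult: "(v, g) \<otimes>\<^bsub>S\<^esub> (w, k) = (vec_mod p (v + A g *\<^sub>v w), g \<otimes>\<^bsub>H\<^esub> k)"
  by (simp add: semidirect_def)
lemma S_one: "\<one>\<^bsub>S\<^esub> = (0\<^sub>v m, \<one>\<^bsub>H\<^esub>)" by (simp add: semidirect_def)

lemma act_zero: "h \<in> carrier H \<Longrightarrow> A h *\<^sub>v 0\<^sub>v m = 0\<^sub>v m"
  using A_mat[of h] by (intro eq_vecI) (auto simp: mult_mat_vec_index simp del: index_mult_mat_vec)

lemma S_mult_closed:
  assumes "v \<in> W" "g \<in> carrier H" "w \<in> W" "k \<in> carrier H"
  shows "vec_mod p (v + A g *\<^sub>v w) \<in> W"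
  using assms W_carrier act_closed by (intro mod_closed add_carrier_vec) auto

lemma group_S: "group S"
proof (rule groupI)
  fix x y assume "x \<in> carrier S" "y \<in> carrier S"
  then show "x \<otimes>\<^bsub>S\<^esub> y \<in> carrier S"
    by (cases x; cases y) (auto simp: S_carrier S_mult intro: S_mult_closed)
next
  show "\<one>\<^bsub>S\<^esub> \<in> carrier S" using zero_Zp_vec[OF p_pos] by (simp add: S_carrier S_one)
next
  fix x y z assume xyz: "x \<in> carrier S" "y \<in> carrier S" "z \<in> carrier S"
  obtain v g w k u l where e: "x = (v, g)" "y = (w, k)" "z = (u, l)" by (cases x; cases y; cases z)
  have c: "v \<in> carrier_vec m" "w \<in> carrier_vec m" "u \<in> carrier_vec m"
    and h: "g \<in> carrier H" "k \<in> carrier H" "l \<in> carrier H"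
    using xyz W_carrier by (auto simp: e S_carrier)
  have c': "A g *\<^sub>v w \<in> carrier_vec m" "A k *\<^sub>v u \<in> carrier_vec m"
    "A g *\<^sub>v (A k *\<^sub>v u) \<in> carrier_vec m" "A (g \<otimes>\<^bsub>H\<^esub> k) *\<^sub>v u \<in> carrier_vec m"
    using c h act_closed by auto
  have "vec_mod p (vec_mod p (v + A g *\<^sub>v w) + A (g \<otimes>\<^bsub>H\<^esub> k) *\<^sub>v u)
      = vec_mod p ((v + A g *\<^sub>v w) + A (g \<otimes>\<^bsub>H\<^esub> k) *\<^sub>v u)"
    using c c' by (intro vec_mod_add_left) auto
  also have "\<dots> = vec_mod p ((v + A g *\<^sub>v w) + A g *\<^sub>v (A k *\<^sub>v u))"
    using c c' h act_mult by (metis add_carrier_vec vec_mod_add_right)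
  also have "(v + A g *\<^sub>v w) + A g *\<^sub>v (A k *\<^sub>v u) = v + A g *\<^sub>v (w + A k *\<^sub>v u)"
    using c c' A_mat[OF h(1)] by (simp add: mult_add_distrib_mat_vec assoc_add_vec[of _ m])
  also have "vec_mod p \<dots> = vec_mod p (v + A g *\<^sub>v vec_mod p (w + A k *\<^sub>v u))"
    using c c' h act_vec_mod act_closed by (metis add_carrier_vec mod_closed W_carrier vec_mod_add_right)
  finally show "x \<otimes>\<^bsub>S\<^esub> y \<otimes>\<^bsub>S\<^esub> z = x \<otimes>\<^bsub>S\<^esub> (y \<otimes>\<^bsub>S\<^esub> z)"
    using h by (simp add: e S_mult H.m_assoc)
next
  fix x assume "x \<in> carrier S"
  then obtain v g where x: "x = (v, g)" "v \<in> W" "g \<in> carrier H" by (cases x) (auto simp: S_carrier)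
  have "vec_mod p (0\<^sub>v m + A \<one>\<^bsub>H\<^esub> *\<^sub>v v) = v"
    using act_one[OF x(2)] act_closed[of "\<one>\<^bsub>H\<^esub>" v] W_carrier[OF x(2)] by simp
  then show "\<one>\<^bsub>S\<^esub> \<otimes>\<^bsub>S\<^esub> x = x" using x by (simp add: S_one S_mult)
  let ?g = "inv\<^bsub>H\<^esub> g"
  define u where "u = vec_mod p (A ?g *\<^sub>v v)"
  \<comment> \<open>This is the negative of \<open>u\<close>. Where \<open>u\<close> vanishes,
    \<open>p - u $ i\<close> equals \<open>p\<close> and must be reduced again.\<close>
  define w where "w = vec_mod p (vec m (\<lambda>i. p - u $ i))"
  have u: "u \<in> W" unfolding u_def using x W_carrier act_closed by (intro mod_closed) auto
  have w: "w \<in> W" unfolding w_def by (intro mod_closed) auto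
  have "vec_mod p (w + A ?g *\<^sub>v v) = vec_mod p (w + u)"
    unfolding u_def using w x W_carrier act_closed by (intro vec_mod_add_right[symmetric]) auto
  also have "\<dots> = vec_mod p (vec m (\<lambda>i. p - u $ i) + u)"
    unfolding w_def using W_carrier[OF u] by (intro vec_mod_add_left) auto
  also have "\<dots> = 0\<^sub>v m"
    using u by (intro eq_vecI) (auto simp: Zp_vecD less_imp_le)
  finally have "(w, ?g) \<otimes>\<^bsub>S\<^esub> x = \<one>\<^bsub>S\<^esub>" using x by (simp add: S_one S_mult)
  moreover have "(w, ?g) \<in> carrier S" using w x by (simp add: S_carrier)
  ultimately show "\<exists>y\<in>carrier S. y \<otimes>\<^bsub>S\<^esub> x = \<one>\<^bsub>S\<^esub>" by blast
qed

interpretation S: group S by (rule group_S)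

lemma S_pow_snd: "x \<in> carrier S \<Longrightarrow> snd (x [^]\<^bsub>S\<^esub> (j::nat)) = snd x [^]\<^bsub>H\<^esub> j"
proof (induction j)
  case (Suc j)
  have "snd (x \<otimes>\<^bsub>S\<^esub> y) = snd x \<otimes>\<^bsub>H\<^esub> snd y" for x y by (simp add: semidirect_def split_beta)
  then show ?case using Suc by simp
qed (simp add: S_one)

lemma S_mult_kernel:
  assumes "u \<in> W" "v \<in> W"
  shows "(u, \<one>\<^bsub>H\<^esub>) \<otimes>\<^bsub>S\<^esub> (v, \<one>\<^bsub>H\<^esub>) = (vec_mod p (u + v), \<one>\<^bsub>H\<^esub>)"
proof -
  have "vec_mod p (u + A \<one>\<^bsub>H\<^esub> *\<^sub>v v) = vec_mod p (u + vec_mod p (A \<one>\<^bsub>H\<^esub> *\<^sub>v v))"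
    using assms W_carrier act_closed by (intro vec_mod_add_right[symmetric]) auto
  then show ?thesis using act_one[OF assms(2)] by (simp add: S_mult)
qed

lemma S_pow_kernel: "v \<in> W \<Longrightarrow> (v, \<one>\<^bsub>H\<^esub>) [^]\<^bsub>S\<^esub> (j::nat) = (vec_mod p (j \<cdot>\<^sub>v v), \<one>\<^bsub>H\<^esub>)"
proof (induction j)
  case 0
  have "vec_mod p (0 \<cdot>\<^sub>v v) = 0\<^sub>v m" using 0 by (intro eq_vecI) (auto simp: Zp_vecD)
  then show ?case by (simp add: S_one)
next
  case (Suc j)
  have c: "v \<in> carrier_vec m" by (rule W_carrier[OF Suc.prems])
  have "vec_mod p (vec_mod p (j \<cdot>\<^sub>v v) + v) = vec_mod p (Suc j \<cdot>\<^sub>v v)"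
    using c by (subst vec_mod_add_left) (auto intro!: arg_cong[of _ _ "vec_mod p"] eq_vecI)
  moreover have "vec_mod p (j \<cdot>\<^sub>v v) \<in> W" using c by (intro mod_closed) auto
  ultimately show ?case using Suc S_mult_kernel[of "vec_mod p (j \<cdot>\<^sub>v v)" v] by simp
qed

text \<open>The second component of a torsion element has the coprime exponents \<open>p\<close> and
  \<open>q\<close> and is therefore trivial; vectors are annihilated by \<open>p\<close>.\<close>

lemma tor_S: "tor S p = W \<times> {\<one>\<^bsub>H\<^esub>}"
proof
  show "tor S p \<subseteq> W \<times> {\<one>\<^bsub>H\<^esub>}"
  proof
    fix x assume x: "x \<in> tor S p"
    then have xS: "x \<in> carrier S" and "snd (x [^]\<^bsub>S\<^esub> p) = \<one>\<^bsub>H\<^esub>" by (auto simp: tor_def S_one)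
    then have "snd x [^]\<^bsub>H\<^esub> p = \<one>\<^bsub>H\<^esub>" using S_pow_snd by metis
    moreover have sx: "snd x \<in> carrier H" using xS by (auto simp: S_carrier)
    moreover have "snd x [^]\<^bsub>H\<^esub> q = \<one>\<^bsub>H\<^esub>" using elementary_abelianD(5)[OF elem_ab sx] .
    ultimately have "snd x = \<one>\<^bsub>H\<^esub>" using primes H.pow_coprime_one[of "snd x" p q] by (simp add: primes_coprime)
    then show "x \<in> W \<times> {\<one>\<^bsub>H\<^esub>}" using xS by (cases x) (simp add: S_carrier)
  qed
  have "vec_mod p (p \<cdot>\<^sub>v v) = 0\<^sub>v m" if "v \<in> W" for v
    using that by (intro eq_vecI) (auto simp: Zp_vecD)
  then show "W \<times> {\<one>\<^bsub>H\<^esub>} \<subseteq> tor S p" using S_pow_kernel by (auto simp: tor_def S_carrier S_one)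
qed

lemma split_ext_semidirect:
  "split_ext S p q R (\<lambda>v. (v, \<one>\<^bsub>H\<^esub>)) snd (\<lambda>g. (0\<^sub>v m, g))"
proof (rule split_ext.intro, goal_cases)
  case 5
  have "W \<subseteq> vec_decode p m ` {..<p ^ m}"
    using vec_decode_code vec_code_less by (metis image_eqI lessThan_iff subsetI)
  then have "finite W" using finite_surj by blast
  then show ?case using elementary_abelianD(4)[OF elem_ab] by (simp add: S_carrier)
next
  case 8 show ?case using is_rep by (simp add: is_rep_def)
next
  case (9 h) then show ?case by (rule A_Zp)
next
  case 10 show ?case unfolding tor_S by (auto simp: bij_betw_def inj_on_def)
next
  case (11 u v) then show ?case by (simp add: S_mult_kernel)
next
  case 12 show ?case by (auto simp: hom_def semidirect_def)
next
  case 13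
  have "0\<^sub>v m \<in> W" "vec_mod p (0\<^sub>v m) = 0\<^sub>v m" using zero_Zp_vec[OF p_pos] vec_mod_ident by auto
  then show ?case by (auto simp: hom_def S_carrier S_mult act_zero)
next
  case (15 x) then show ?case unfolding tor_S by (cases x) (simp add: S_carrier)
next
  \<comment> \<open>Inverses in the semidirect product need not be computed: the claim is multiplied
    by \<open>x\<close> from the right and compared componentwise.\<close>
  case (16 x v)
  then obtain w g where x: "x = (w, g)" "w \<in> W" "g \<in> carrier H" by (cases x) (auto simp: S_carrier)
  have vw: "v \<in> carrier_vec m" "w \<in> carrier_vec m" using x 16 W_carrier by auto
  have Av: "A g *\<^sub>v v \<in> carrier_vec m" using act_closed x vw by blast
  have Av': "vec_mod p (A g *\<^sub>v v) \<in> W" using Av by (rule mod_closed)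
  have "vec_mod p (vec_mod p (A g *\<^sub>v v) + A \<one>\<^bsub>H\<^esub> *\<^sub>v w) = vec_mod p (vec_mod p (A g *\<^sub>v v) + w)"
    using vec_mod_add_right[OF W_carrier[OF Av'] act_closed[OF H.one_closed vw(2)]] act_one[OF x(2)] by simp
  also have "\<dots> = vec_mod p (w + A g *\<^sub>v v)"
    using vec_mod_add_left[OF Av vw(2)] comm_add_vec[OF Av vw(2)] by simp
  finally have "(vec_mod p (A g *\<^sub>v v), \<one>\<^bsub>H\<^esub>) \<otimes>\<^bsub>S\<^esub> x = x \<otimes>\<^bsub>S\<^esub> (v, \<one>\<^bsub>H\<^esub>)"
    using x by (simp add: S_mult)
  moreover have "x \<in> carrier S" "(v, \<one>\<^bsub>H\<^esub>) \<in> carrier S" "(vec_mod p (A g *\<^sub>v v), \<one>\<^bsub>H\<^esub>) \<in> carrier S"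
    using 16 Av' by (simp_all add: S_carrier)
  ultimately show ?case using x(1) S.inv_solve_right[of "(vec_mod p (A g *\<^sub>v v), \<one>\<^bsub>H\<^esub>)" "x \<otimes>\<^bsub>S\<^esub> (v, \<one>\<^bsub>H\<^esub>)" x]
    by simp
qed (use primes group_S is_rep elem_ab in \<open>auto simp: is_rep_def\<close>)

lemma split_ext_semidirect_table:
  "cayley_table (semidirect_table p R) \<and> (\<exists>E c s. split_ext (table_group (semidirect_table p R)) p q R E c s)"
proof -
  let ?h = "dim_row (grp R)" and ?T = "semidirect_table p R"
  let ?n = "p ^ m * ?h" and ?dec = "\<lambda>x. (vec_decode p m (x div ?h), x mod ?h)"
  have cH: "carrier H = {..<?h}" by (simp add: table_group_def)
  then have h: "?h > 0" using H.one_closed by (metis gr0I lessThan_iff not_less0)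
  have code_less: "pair_code p ?h x < ?n" if "x \<in> carrier S" for x
  proof -
    obtain v g where vg: "x = (v, g)" by (cases x)
    then have x: "x = (v, g)" "v \<in> W" "g < ?h" using that by (simp_all add: S_carrier cH)
    have "Suc (vec_code p v) * ?h \<le> ?n" using vec_code_less[OF x(2)] by (intro mult_le_mono1) simp
    then show ?thesis using x by (simp add: pair_code_def)
  qed
  have dec_code: "?dec (pair_code p ?h x) = x" if "x \<in> carrier S" for x
    using that by (cases x) (simp add: S_carrier cH pair_code_def vec_decode_code)
  have dec_S: "?dec i \<in> carrier S" for i using h vec_decode_Zp_vec[OF p_pos] by (simp add: S_carrier cH)
  have code_dec: "pair_code p ?h (?dec i) = i" if "i < ?n" for i
    using that h by (simp add: pair_code_def vec_code_decode less_mult_imp_div_less)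
  have img: "pair_code p ?h ` carrier S = {..<?n}"
  proof
    show "pair_code p ?h ` carrier S \<subseteq> {..<?n}" using code_less by (metis image_subsetI lessThan_iff)
    show "{..<?n} \<subseteq> pair_code p ?h ` carrier S" using code_dec dec_S by (metis image_eqI lessThan_iff subsetI)
  qed
  have T: "?T \<in> carrier_mat ?n ?n" by (simp add: semidirect_table_def Let_def)
  have mult: "pair_code p ?h (x \<otimes>\<^bsub>S\<^esub> y) = ?T $$ (pair_code p ?h x, pair_code p ?h y)"
    if "x \<in> carrier S" "y \<in> carrier S" for x y
    using that code_less dec_code by (simp add: semidirect_table_def Let_def)
  note facts = cayley_table_of_surj[OF group_S T img mult]
  have "inj_on (pair_code p ?h) (carrier S)" by (rule inj_on_inverseI[of _ ?dec]) (rule dec_code)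
  then have "bij_betw (pair_code p ?h) (carrier S) (carrier (table_group ?T))"
    using img facts(4) by (simp add: bij_betw_def)
  from split_ext_iso[OF split_ext_semidirect _ facts(2) this]
  show ?thesis using facts(1) by (auto simp: cayley_table_def)
qed

end

section \<open>From representations to groups\<close>

text \<open>
  The arrays of the data of one of the two groups are \<open>d + 1, d + 2, \<dots>\<close>, with \<open>d = 100\<close> for the first
  and \<open>d = 200\<close> for the second one; scalars are in cell 0. Here \<open>d + 1\<close> holds \<open>p\<close>, \<open>d + 2\<close> the address
  of the encoded representation, \<open>d + 3\<close> and \<open>d + 4\<close> its dimension \<open>m\<close> and the order \<open>h\<close> of the group,
  \<open>d + 5\<close> and \<open>d + 6\<close> the addresses of the rows of the table and of the matrices, \<open>d + 7\<close> the weights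
  \<open>h p\<^sup>a\<close>, \<open>d + 8\<close> the number \<open>p\<^sup>m\<close> of vectors, \<open>d + 9\<close> and \<open>d + 10\<close> the functions \<open>div p\<close> and
  \<open>mod p\<close>. The element \<open>(v, g)\<close> of the semidirect product is numbered \<open>v h + g\<close>. Since the size of
  an instance does not bound \<open>p\<close> if \<open>m = 0\<close>, loops of length \<open>p\<close> occur only inside loops of length \<open>m\<close>.
\<close>

definition MatOffsets :: "nat \<Rightarrow> prog" where
  "MatOffsets d = For (d + 13) (V (d + 4)) (block
    [Put (d + 6) (V (d + 13)) (V (d + 12)), Assign (d + 12) (Add (V (d + 12)) (V (d + 15)))])"

lemma writes_MatOffsets [simp]: "writes (MatOffsets d) = {d + 13, d + 6, d + 12}"
  by (auto simp: MatOffsets_def)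

lemma wp_MatOffsets:
  assumes h: "M (d + 4) 0 = h" "h \<le> B" and l: "M (d + 15) 0 = l"
    and Q: "\<And>M'. \<forall>a. a \<notin> {d + 13, d + 6, d + 12} \<longrightarrow> M' a = M a
      \<Longrightarrow> \<forall>g<h. M' (d + 6) g = M (d + 12) 0 + g * l \<Longrightarrow> M' (d + 12) 0 = M (d + 12) 0 + h * l \<Longrightarrow> Q M' out"
  shows "wp B (MatOffsets d) Q M out"
  unfolding MatOffsets_def
  by (rule wp_For[where I = "\<lambda>k M' o'. (\<forall>g<k. M' (d + 6) g = M (d + 12) 0 + g * l)
      \<and> M' (d + 12) 0 = M (d + 12) 0 + k * l \<and> o' = out" and n = h])
    (use h l in \<open>auto simp: less_Suc_eq intro!: Q\<close>)

text \<open>The weight with index \<open>a\<close> is what one unit in coordinate \<open>a\<close>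
  contributes to the number of an element. The last one, with index \<open>m\<close>, is the order
  of the semidirect product and is printed as the dimension of its table.\<close>

definition Weights :: "nat \<Rightarrow> prog" where
  "Weights d = block
    [Put (d + 7) (Const 0) (V (d + 4)), Assign (d + 8) (Const 1),
     For (d + 13) (V (d + 3)) (block
      [MulTo (d + 15) (d + 14) (V (d + 1)) (Get (d + 7) (V (d + 13))),
       Put (d + 7) (Add (V (d + 13)) (Const 1)) (V (d + 15)),
       MulTo (d + 15) (d + 14) (V (d + 1)) (V (d + 8)),
       Assign (d + 8) (V (d + 15))])]"

lemma writes_Weights [simp]: "writes (Weights d) = {d + 7, d + 8, d + 13, d + 14, d + 15}"
  by (auto simp: Weights_def)

lemma wp_Weights:
  assumes p: "M (d + 1) 0 = p" "m > 0 \<Longrightarrow> p \<le> B" and h: "M (d + 4) 0 = h" and m: "M (d + 3) 0 = m" "m \<le> B"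
    and Q: "\<And>M'. \<forall>a. a \<notin> {d + 7, d + 8, d + 13, d + 14, d + 15} \<longrightarrow> M' a = M a
      \<Longrightarrow> \<forall>a\<le>m. M' (d + 7) a = h * p ^ a \<Longrightarrow> M' (d + 8) 0 = p ^ m \<Longrightarrow> Q M' out"
  shows "wp B (Weights d) Q M out"
  unfolding Weights_def block.simps wp.simps
proof (rule wp_For[where I = "\<lambda>k M' o'. (\<forall>a\<le>k. M' (d + 7) a = h * p ^ a) \<and> M' (d + 8) 0 = p ^ k \<and> o' = out"
      and n = m], goal_cases)
  case (6 k M' o')
  have p': "M' (d + 1) 0 = p" "p \<le> B" using 6 p by auto
  show ?case
    unfolding wp.simps
  proof (rule wp_MulTo, goal_cases)
    case (7 M1)
    show ?case
      unfolding wp.simps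
    proof (rule wp_MulTo, goal_cases)
      case (7 M2)
      then show ?case using 6 p' \<open>M1 (d + 15) 0 = _\<close> \<open>\<forall>a. _ \<longrightarrow> M1 a = _\<close> by (auto simp: le_Suc_eq)
    qed (use p' 7 in auto)
  qed (use p' in auto)
qed (use m h Q in auto)

definition LoadRep :: "nat \<Rightarrow> prog" where
  "LoadRep d = block
    [Assign (d + 3) (Get 0 (V (d + 2))), Assign (d + 4) (Get 0 (Add (V (d + 2)) (Const 1))),
     Assign (d + 12) (Add (V (d + 2)) (Const 2)), Offsets d,
     MulTo (d + 15) (d + 14) (V (d + 3)) (V (d + 3)), MatOffsets d, Weights d, DivMod d]"

lemma writes_LoadRep [simp]:
  "writes (LoadRep d) = {d + 3, d + 4, d + 5, d + 6, d + 7, d + 8, d + 9, d + 10, d + 12, d + 13, d + 14, d + 15}"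
  by (auto simp: LoadRep_def)

definition rep_loaded :: "mem \<Rightarrow> nat \<Rightarrow> nat \<Rightarrow> nat \<Rightarrow> nat \<Rightarrow> (nat \<Rightarrow> nat \<Rightarrow> nat) \<Rightarrow> (nat \<Rightarrow> nat \<Rightarrow> nat \<Rightarrow> nat) \<Rightarrow> bool" where
  "rep_loaded M d p m h T A \<longleftrightarrow> M (d + 1) 0 = p \<and> M (d + 3) 0 = m \<and> M (d + 4) 0 = h
    \<and> (\<forall>g<h. \<forall>k<h. M 0 (M (d + 5) g + k) = T g k)
    \<and> (\<forall>g<h. \<forall>a<m. \<forall>b<m. M 0 (M (d + 6) g + a * m + b) = A g a b)
    \<and> (\<forall>a\<le>m. M (d + 7) a = h * p ^ a) \<and> M (d + 8) 0 = p ^ m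
    \<and> (\<forall>v<p ^ m. M (d + 9) v = v div p \<and> M (d + 10) v = v mod p)"

lemma rep_loaded_frame:
  "rep_loaded M d p m h T A \<Longrightarrow> (\<And>a. a \<in> {0, d + 1, d + 3, d + 4, d + 5, d + 6, d + 7, d + 8, d + 9, d + 10} \<Longrightarrow> M' a = M a)
    \<Longrightarrow> rep_loaded M' d p m h T A"
  by (simp add: rep_loaded_def)

text \<open>The final value of the pointer in \<open>d + 12\<close> is the address behind the
  encoding; for the first representation this is where the second one begins.\<close>

lemma wp_LoadRep:
  assumes p: "M (d + 1) 0 = p" "p > 0" "m > 0 \<Longrightarrow> p \<le> B" and base: "M (d + 2) 0 = \<beta>"
    and m: "M 0 \<beta> = m" "m \<le> B" and h: "M 0 (\<beta> + 1) = h" "h \<le> B" and pm: "p ^ m \<le> B"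
    and z: "M (d + 9) 0 = 0" "M (d + 10) 0 = 0"
    and T: "\<And>g k. g < h \<Longrightarrow> k < h \<Longrightarrow> M 0 (\<beta> + 2 + g * h + k) = T g k"
    and A: "\<And>g a b. g < h \<Longrightarrow> a < m \<Longrightarrow> b < m \<Longrightarrow> M 0 (\<beta> + 2 + h * h + g * (m * m) + a * m + b) = A g a b"
    and Q: "\<And>M'. \<forall>a. a \<notin> writes (LoadRep d) \<longrightarrow> M' a = M a \<Longrightarrow> rep_loaded M' d p m h T A
      \<Longrightarrow> M' (d + 12) 0 = \<beta> + 2 + h * h + h * (m * m) \<Longrightarrow> Q M' out"
  shows "wp B (LoadRep d) Q M out"
  unfolding LoadRep_def block.simps wp.simps
proof (rule wp_Offsets[where h = h], goal_cases)
  case (3 M1)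
  show ?case
    unfolding wp.simps
  proof (rule wp_MulTo, goal_cases)
    case (7 M2)
    show ?case
      unfolding wp.simps
    proof (rule wp_MatOffsets[where h = h and l = "m * m"], goal_cases)
      case (4 M3)
      show ?case
        unfolding wp.simps
      proof (rule wp_Weights[where p = p and m = m and h = h], goal_cases)
        case (6 M4)
        show ?case
          unfolding wp.simps
        proof (rule wp_DivMod[where p = p and s = "p ^ m"], goal_cases)
          case (7 M5)
          note fr = 3(1) \<open>\<forall>a. a \<noteq> _ \<and> a \<noteq> _ \<longrightarrow> M2 a = M1 a\<close> 4(1) 6(1) 7(1)
          show ?case
          proof (rule Q)
            show "\<forall>a. a \<notin> writes (LoadRep d) \<longrightarrow> M5 a = M a"
              using fr by simp
            show "M5 (d + 12) 0 = \<beta> + 2 + h * h + h * (m * m)"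
              using fr 3 4 base m by simp
            show "rep_loaded M5 d p m h T A"
              unfolding rep_loaded_def
              using fr 3 4 6 7 base m h p T A by simp
          qed
        qed (use p z pm 3 4 6 7 in simp_all)
      qed (use p z m h 3 4 7 base in simp_all)
    qed (use m h 3 7 base in simp_all)
  qed (use m h 3 base in simp_all)
qed (use m h base in simp_all)

section \<open>Computing one product of the semidirect product\<close>

definition Digits :: "nat \<Rightarrow> prog" where
  "Digits d = block
    [Assign (d + 13) (V (d + 19)),
     For (d + 14) (V (d + 3)) (block
      [Put (d + 16) (V (d + 14)) (Get (d + 10) (V (d + 13))),
       Assign (d + 13) (Get (d + 9) (V (d + 13)))])]"

lemma writes_Digits [simp]: "writes (Digits d) = {d + 13, d + 14, d + 16}"
  by (auto simp: Digits_def)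

lemma wp_Digits:
  assumes R: "rep_loaded M d p m h T A" and m: "m \<le> B" and w: "M (d + 19) 0 = w" "w < p ^ m"
    and Q: "\<And>M'. \<forall>a. a \<notin> {d + 13, d + 14, d + 16} \<longrightarrow> M' a = M a
      \<Longrightarrow> \<forall>b<m. M' (d + 16) b = w div p ^ b mod p \<Longrightarrow> Q M' out"
  shows "wp B (Digits d) Q M out"
  unfolding Digits_def block.simps wp.simps
proof (rule wp_For[where I = "\<lambda>k M' o'. (\<forall>b<k. M' (d + 16) b = w div p ^ b mod p)
      \<and> M' (d + 13) 0 = w div p ^ k \<and> o' = out" and n = m], goal_cases)
  case (6 k M' o')
  \<comment> \<open>The quotients never leave the range of the division table.\<close>
  have "w div p ^ k < p ^ m" using w(2) by (meson div_le_dividend order.strict_trans1)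
  moreover have "w div p ^ k div p = w div p ^ Suc k" by (metis div_mult2_eq power_Suc2)
  ultimately show ?case using 6 R by (auto simp: rep_loaded_def less_Suc_eq)
qed (use R m w Q in \<open>auto simp: rep_loaded_def\<close>)

text \<open>A product in the prime field by repeated addition. Both summands are below
  \<open>p\<close>, so a single conditional subtraction per pass keeps the sum reduced.\<close>

definition AddTimes :: "nat \<Rightarrow> prog" where
  "AddTimes d = For (d + 25) (Get 0 (V (d + 21))) (block
    [Assign (d + 23) (Add (V (d + 23)) (Get (d + 16) (V (d + 24)))),
     Cond (V (d + 23)) (V (d + 1)) Skip (Assign (d + 23) (Sub (V (d + 23)) (V (d + 1))))])"

lemma writes_AddTimes [simp]: "writes (AddTimes d) = {d + 23, d + 25}"
  by (auto simp: AddTimes_def)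

lemma wp_AddTimes:
  assumes p: "M (d + 1) 0 = p" and x: "M 0 (M (d + 21) 0) = x" "x \<le> B"
    and D: "M (d + 16) (M (d + 24) 0) = D" "D < p" and s: "M (d + 23) 0 = s mod p"
    and Q: "\<And>M'. \<forall>a. a \<notin> {d + 23, d + 25} \<longrightarrow> M' a = M a
      \<Longrightarrow> M' (d + 23) 0 = (s + x * D) mod p \<Longrightarrow> Q M' out"
  shows "wp B (AddTimes d) Q M out"
  unfolding AddTimes_def
proof (rule wp_For[where I = "\<lambda>k M' o'. M' (d + 23) 0 = (s + k * D) mod p \<and> o' = out" and n = x], goal_cases)
  case (6 k M' o')
  let ?y = "(s + k * D) mod p"
  have e: "(s + Suc k * D) mod p = (?y + D) mod p"
    by (simp add: mod_simps algebra_simps)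
  have "(y + D) mod p = (if y + D < p then y + D else y + D - p)" if "y < p" for y
    using that D(2) le_mod_geq[of p "y + D"] by simp
  then have "(?y + D) mod p = (if ?y + D < p then ?y + D else ?y + D - p)"
    using D(2) by (simp del: mod_add_left_eq)
  then show ?case using 6 p D(1) unfolding e by simp
qed (use x D s Q in auto)

text \<open>The rows of a matrix are stored one after the other, so the pointer left behind in
  \<open>d + 21\<close> is the start of the next row.\<close>

definition RowDot :: "nat \<Rightarrow> prog" where
  "RowDot d = For (d + 24) (V (d + 3)) (block [AddTimes d, Assign (d + 21) (Add (V (d + 21)) (Const 1))])"

lemma writes_RowDot [simp]: "writes (RowDot d) = {d + 21, d + 23, d + 24, d + 25}"
  by (auto simp: RowDot_def)

lemma wp_RowDot:
  assumes p: "M (d + 1) 0 = p" "p > 0" and m: "M (d + 3) 0 = m" "m \<le> B" and ptr: "M (d + 21) 0 = \<pi>"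
    and A: "\<And>b. b < m \<Longrightarrow> M 0 (\<pi> + b) = A b \<and> A b \<le> B"
    and D: "\<And>b. b < m \<Longrightarrow> M (d + 16) b = D b \<and> D b < p" and s: "M (d + 23) 0 = s mod p"
    and Q: "\<And>M'. \<forall>a. a \<notin> {d + 21, d + 23, d + 24, d + 25} \<longrightarrow> M' a = M a
      \<Longrightarrow> M' (d + 21) 0 = \<pi> + m \<Longrightarrow> M' (d + 23) 0 = (s + (\<Sum>b<m. A b * D b)) mod p \<Longrightarrow> Q M' out"
  shows "wp B (RowDot d) Q M out"
  unfolding RowDot_def
proof (rule wp_For[where I = "\<lambda>k M' o'. M' (d + 21) 0 = \<pi> + k
      \<and> M' (d + 23) 0 = (s + (\<Sum>b<k. A b * D b)) mod p \<and> o' = out" and n = m], goal_cases)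
  case (6 k M' o')
  show ?case
    unfolding block.simps wp.simps
    by (rule wp_AddTimes[where p = p and x = "A k" and D = "D k" and s = "s + (\<Sum>b<k. A b * D b)"])
      (use 6 A[of k] D[of k] p in \<open>auto simp: add.assoc\<close>)
qed (use m ptr s Q in auto)

definition Entry :: "nat \<Rightarrow> prog" where
  "Entry d = block
    [Digits d, Assign (d + 21) (Get (d + 6) (V (d + 18))),
     Assign (d + 22) (Get 0 (Add (Get (d + 5) (V (d + 18))) (V (d + 20)))),
     Assign (d + 13) (V (d + 17)),
     For (d + 14) (V (d + 3)) (block
      [Assign (d + 23) (Get (d + 10) (V (d + 13))), Assign (d + 13) (Get (d + 9) (V (d + 13))),
       RowDot d, MulTo (d + 26) (d + 25) (V (d + 23)) (Get (d + 7) (V (d + 14))),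
       Assign (d + 22) (Add (V (d + 22)) (V (d + 26)))]),
     Write (V (d + 22))]"

lemma writes_Entry [simp]:
  "writes (Entry d) = {d + 13, d + 14, d + 16, d + 21, d + 22, d + 23, d + 24, d + 25, d + 26}"
  by (auto simp: Entry_def)

text \<open>The number of the product of \<open>(v, g)\<close> and \<open>(w, k)\<close>, where the
  vectors are given as base-p numbers: digit \<open>a\<close> of the sum of \<open>v\<close> and the
  image of \<open>w\<close> enters with its weight.\<close>

definition entry :: "nat \<Rightarrow> nat \<Rightarrow> nat \<Rightarrow> (nat \<Rightarrow> nat \<Rightarrow> nat) \<Rightarrow> (nat \<Rightarrow> nat \<Rightarrow> nat \<Rightarrow> nat) \<Rightarrow> nat \<Rightarrow> nat \<Rightarrow> nat \<Rightarrow> nat \<Rightarrow> nat" where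
  "entry p m h T A v g w k = T g k
    + (\<Sum>a<m. (v div p ^ a mod p + (\<Sum>b<m. A g a b * (w div p ^ b mod p))) mod p * (h * p ^ a))"

lemma wp_Entry:
  assumes R: "rep_loaded M d p m h T A" and p: "p > 0" "m > 0 \<Longrightarrow> p \<le> B" and m: "m \<le> B"
    and A: "\<And>g a b. g < h \<Longrightarrow> a < m \<Longrightarrow> b < m \<Longrightarrow> A g a b < p"
    and v: "M (d + 17) 0 = v" "v < p ^ m" and g: "M (d + 18) 0 = g" "g < h"
    and w: "M (d + 19) 0 = w" "w < p ^ m" and k: "M (d + 20) 0 = k" "k < h"
  shows "wp B (Entry d) (\<lambda>M' o'. o' = out @ [entry p m h T A v g w k]) M out"
  unfolding Entry_def block.simps wp.simps
proof (rule wp_Digits[OF R m w], goal_cases)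
  case (1 M1)
  have R1: "rep_loaded M1 d p m h T A" by (rule rep_loaded_frame[OF R]) (use 1(1) in auto)
  let ?c = "\<lambda>a. (v div p ^ a mod p + (\<Sum>b<m. A g a b * (w div p ^ b mod p))) mod p"
  show ?case
    unfolding wp.simps
  proof (rule wp_For[where I = "\<lambda>a M' o'. M' (d + 13) 0 = v div p ^ a \<and> M' (d + 21) 0 = M (d + 6) g + a * m
        \<and> M' (d + 22) 0 = T g k + (\<Sum>a'<a. ?c a' * (h * p ^ a')) \<and> o' = out" and n = m], goal_cases)
    case (6 a M2 o2)
    have R2: "rep_loaded M2 d p m h T A" by (rule rep_loaded_frame[OF R1]) (use 6(2) in auto)
    have "M (d + 6) = M2 (d + 6)" using 6(2) 1(1) by simp
    then have A2: "M2 0 (M (d + 6) g + a * m + b) = A g a b" if "b < m" for b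
      using R2 g(2) 6(1) that by (simp add: rep_loaded_def)
    have D2: "M2 (d + 16) b = w div p ^ b mod p" if "b < m" for b
      using 6(2) 1(2) that by simp
    have va: "v div p ^ a < p ^ m" using v(2) by (meson div_le_dividend order.strict_trans1)
    have pB: "p \<le> B" "A g a b < p" if "b < m" for b using p A[OF g(2) 6(1) that] that by auto
    note R2' = R2[unfolded rep_loaded_def]
    show ?case
      unfolding block.simps wp.simps
    proof (rule wp_RowDot[where p = p and m = m and \<pi> = "M (d + 6) g + a * m" and A = "A g a"
          and D = "\<lambda>b. w div p ^ b mod p" and s = "v div p ^ a mod p"], goal_cases)
      case (9 M3)
      have acc: "M3 (d + 23) 0 = ?c a" using 9(3) by simp
      have W3: "M3 (d + 7) (M3 (d + 14) 0) = h * p ^ a"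
        using 9(1) 6(1,3) R2' by simp
      have "?c a < p" using p(1) by simp
      then have cB: "?c a \<le> B" using p(2) 6(1) by (metis gr_implies_not0 gr0I less_imp_le order.strict_trans2)
      show ?case
        unfolding wp.simps
      proof (rule wp_MulTo, goal_cases)
        case (7 M4)
        have "M4 (d + 26) 0 = ?c a * (h * p ^ a)" using 7(2) acc W3 by simp
        moreover have "v div p ^ a div p = v div p ^ Suc a" by (metis div_mult2_eq power_Suc2)
        ultimately show ?case
          using 7(1) 9(1,2) 6(2,4) va R2' by simp
      qed (use acc cB in simp_all)
    next
      case (6 b)
      then show ?case using A2 pB[OF 6] by (simp add: less_imp_le order.strict_trans2 algebra_simps)
    qed (use R2' p m va 6(4) D2 in auto)
  qed (use R1[unfolded rep_loaded_def] 1(1) m v g w k in \<open>auto simp: entry_def\<close>)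
qed

text \<open>Four loops over the components, instead of two over the numbers of elements, spare the
  divisions by \<open>h\<close>; by \<open>concat_nested\<close> they visit the elements in the same
  order.\<close>

definition Table :: "nat \<Rightarrow> prog" where
  "Table d = For (d + 17) (V (d + 8)) (For (d + 18) (V (d + 4)) (For (d + 19) (V (d + 8)) (For (d + 20) (V (d + 4)) (Entry d))))"

lemma writes_Table [simp]:
  "writes (Table d) = {d + 13, d + 14, d + 16, d + 17, d + 18, d + 19, d + 20, d + 21, d + 22, d + 23, d + 24, d + 25, d + 26}"
  by (auto simp: Table_def)

lemma wp_Table:
  assumes R: "rep_loaded M d p m h T A" and p: "p > 0" "m > 0 \<Longrightarrow> p \<le> B" and m: "m \<le> B"
    and A: "\<And>g a b. g < h \<Longrightarrow> a < m \<Longrightarrow> b < m \<Longrightarrow> A g a b < p" and h: "h \<le> B" and pm: "p ^ m \<le> B"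
    and Q: "\<And>M'. \<forall>a. a \<notin> writes (Table d) \<longrightarrow> M' a = M a \<Longrightarrow> Q M' (out @
      concat (map (\<lambda>x. map (\<lambda>y. entry p m h T A (x div h) (x mod h) (y div h) (y mod h)) [0..<p ^ m * h]) [0..<p ^ m * h]))"
  shows "wp B (Table d) Q M out"
proof -
  let ?s = "p ^ m" and ?e = "\<lambda>v g w k. [entry p m h T A v g w k]"
  let ?F = "\<lambda>x y. entry p m h T A (x div h) (x mod h) (y div h) (y mod h)"
  have cnt: "M' (d + 8) 0 = ?s" "M' (d + 4) 0 = h" if "rep_loaded M' d p m h T A" for M'
    using that by (auto simp: rep_loaded_def)
  have "concat (map (\<lambda>v. concat (map (\<lambda>g. concat (map (\<lambda>w. concat (map (\<lambda>k. ?e v g w k) [0..<h])) [0..<?s])) [0..<h])) [0..<?s])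
    = concat (map (\<lambda>v. concat (map (\<lambda>g. concat (map (\<lambda>w. concat (map (\<lambda>k. [?F (v * h + g) (w * h + k)]) [0..<h])) [0..<?s])) [0..<h])) [0..<?s])"
    by (intro arg_cong[where f = concat] map_cong refl) auto
  also have "\<dots> = concat (map (\<lambda>x. concat (map (\<lambda>w. concat (map (\<lambda>k. [?F x (w * h + k)]) [0..<h])) [0..<?s])) [0..<?s * h])"
    by (rule concat_nested)
  also have "\<dots> = concat (map (\<lambda>x. concat (map (\<lambda>y. [?F x y]) [0..<?s * h])) [0..<?s * h])"
    unfolding concat_nested[of "\<lambda>y. [?F x y]" for x] ..
  also have "\<dots> = concat (map (\<lambda>x. map (\<lambda>y. ?F x y) [0..<?s * h]) [0..<?s * h])"
    by (simp add: concat_map_singleton)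
  finally have out: "concat (map (\<lambda>v. concat (map (\<lambda>g. concat (map (\<lambda>w. concat (map (\<lambda>k. ?e v g w k) [0..<h])) [0..<?s])) [0..<h])) [0..<?s])
    = concat (map (\<lambda>x. map (\<lambda>y. ?F x y) [0..<?s * h]) [0..<?s * h])" .
  show ?thesis
    unfolding Table_def
  proof (rule wp_For_emit[where n = ?s and f = "\<lambda>v. concat (map (\<lambda>g. concat (map (\<lambda>w. concat (map (\<lambda>k. ?e v g w k) [0..<h])) [0..<?s])) [0..<h])"], goal_cases)
    case (5 v M1 o1)
    have R1: "rep_loaded M1 d p m h T A" by (rule rep_loaded_frame[OF R]) (use 5(2) in auto)
    show ?case
    proof (rule wp_For_emit[where n = h and f = "\<lambda>g. concat (map (\<lambda>w. concat (map (\<lambda>k. ?e v g w k) [0..<h])) [0..<?s])"], goal_cases)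
      case (5 g M2 o2)
      have R2: "rep_loaded M2 d p m h T A" by (rule rep_loaded_frame[OF R1]) (use 5(2) in auto)
      have v2: "M2 (d + 17) 0 = v" using 5(2) \<open>M1 (d + 17) 0 = v\<close> by simp
      show ?case
      proof (rule wp_For_emit[where n = ?s and f = "\<lambda>w. concat (map (\<lambda>k. ?e v g w k) [0..<h])"], goal_cases)
        case (5 w M3 o3)
        have R3: "rep_loaded M3 d p m h T A" by (rule rep_loaded_frame[OF R2]) (use 5(2) in auto)
        have v3: "M3 (d + 17) 0 = v" "M3 (d + 18) 0 = g" using 5(2) v2 \<open>M2 (d + 18) 0 = g\<close> by simp_all
        show ?case
        proof (rule wp_For_emit[where n = h and f = "\<lambda>k. ?e v g w k"], goal_cases)
          case (5 k M4 o4)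
          have R4: "rep_loaded M4 d p m h T A" by (rule rep_loaded_frame[OF R3]) (use 5(2) in auto)
          have v4: "M4 (d + 17) 0 = v" "M4 (d + 18) 0 = g" "M4 (d + 19) 0 = w"
            using 5(2) v3 \<open>M3 (d + 19) 0 = w\<close> by simp_all
          show ?case
            by (rule wp_Entry[OF R4 p m A v4(1) _ v4(2) _ v4(3)])
              (use 5(1,3) \<open>v < ?s\<close> \<open>g < h\<close> \<open>w < ?s\<close> in auto)
        qed (use cnt[OF R3] h in auto)
      qed (use cnt[OF R2] pm in auto)
    qed (use cnt[OF R1] h in auto)
  next
    case (6 M')
    show ?case unfolding out by (rule Q) (use 6 in auto)
  qed (use cnt[OF R] pm in auto)
qed

text \<open>The length of the input and the prime occupy the first two cells, so the first
  representation starts at address 2.\<close>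

definition rep_to_group_prog :: prog where
  "rep_to_group_prog = block
    [Assign 101 (Get 0 (Const 1)), Assign 102 (Const 2), LoadRep 100,
     Assign 201 (Get 0 (Const 1)), Assign 202 (V 112), LoadRep 200,
     Write (Get 107 (V 103)), Write (Get 207 (V 203)), Table 100, Table 200]"

section \<open>Sizes and encodings\<close>

lemma floorlog_le_self: "floorlog 2 x \<le> x"
  by (rule floorlog_leI) auto

lemma bit_size_le:
  assumes "\<And>x. x \<in> set xs \<Longrightarrow> x \<le> s"
  shows "bit_size xs \<le> length xs * Suc s"
  using assms
proof (induction xs)
  case (Cons x xs)
  then show ?case using floorlog_le_self[of x] by (fastforce simp: bit_size_def)
qed (simp add: bit_size_def)

lemma cayley_table_entry_less:
  assumes "cayley_table T" "x < dim_row T" "y < dim_row T"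
  shows "T $$ (x, y) < dim_row T"
proof -
  have "group (table_group T)" using assms by (simp add: cayley_table_def)
  from monoid.m_closed[OF group.is_monoid[OF this], of x y] show ?thesis
    using assms by (simp add: table_group_def)
qed

text \<open>\<open>[:2, 0, 2:]\<close> counts the two dimensions and the entries of two tables;
  \<open>[:1, 1:]\<close> bounds the bits of a number that is at most \<open>s\<close>.\<close>

lemma bit_size_tables_le:
  assumes T: "cayley_table T1" "cayley_table T2" and n: "dim_row T1 \<le> s" "dim_row T2 \<le> s"
  shows "bit_size (encode_tables (T1, T2)) \<le> poly ([:2, 0, 2:] * [:1, 1:]) s"
proof -
  have sq: "dim_col T1 = dim_row T1" "dim_col T2 = dim_row T2"
    using T by (auto simp: cayley_table_def)
  have ent: "x \<le> s" if ct: "cayley_table T" and ds: "dim_row T \<le> s" and x: "x \<in> set (mat_entries T)" for T x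
  proof -
    have "dim_col T = dim_row T" using ct by (simp add: cayley_table_def)
    then obtain i j where "x = T $$ (i, j)" "i < dim_row T" "j < dim_row T"
      using x unfolding mat_entries_altdef by auto
    then show ?thesis using cayley_table_entry_less[OF ct, of i j] ds by simp
  qed
  have "bit_size (encode_tables (T1, T2)) \<le> length (encode_tables (T1, T2)) * Suc s"
    by (rule bit_size_le) (use n ent[OF T(1) n(1)] ent[OF T(2) n(2)] in \<open>auto simp: encode_tables_def\<close>)
  also have "length (encode_tables (T1, T2)) = 2 + dim_row T1 * dim_row T1 + dim_row T2 * dim_row T2"
    by (simp add: encode_tables_def sq)
  also have "(2 + dim_row T1 * dim_row T1 + dim_row T2 * dim_row T2) * Suc s \<le> (2 + s * s + s * s) * Suc s"
    using n by (intro mult_le_mono1 add_mono mult_mono) auto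
  finally show ?thesis by (simp add: algebra_simps)
qed

lemma entry_semidirect_table:
  assumes R: "rep_ext p q R" and h: "h = dim_row (grp R)" and m: "m = rep_dim R"
    and T: "\<And>g k. g < h \<Longrightarrow> k < h \<Longrightarrow> T g k = grp R $$ (g, k)"
    and A: "\<And>g a b. g < h \<Longrightarrow> a < m \<Longrightarrow> b < m \<Longrightarrow> A g a b = rep_mats R ! g $$ (a, b)"
    and xy: "x < p ^ m * h" "y < p ^ m * h"
  shows "entry p m h T A (x div h) (x mod h) (y div h) (y mod h) = semidirect_table p R $$ (x, y)"
proof -
  interpret rep_ext p q R by (rule R)
  have "h > 0" using xy by (cases h) auto
  then have mod: "x mod h < h" "y mod h < h" by simp_all
  have cH: "carrier H = {..<h}" by (simp add: table_group_def h)
  have Ag: "rep_mats R ! (x mod h) \<in> carrier_mat m m" using A_mat[of "x mod h"] mod cH m by simp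
  let ?v = "vec_decode p m (x div h)" and ?w = "vec_decode p m (y div h)"
  have "entry p m h T A (x div h) (x mod h) (y div h) (y mod h)
      = grp R $$ (x mod h, y mod h) + (\<Sum>a<m. vec_mod p (?v + (rep_mats R ! (x mod h)) *\<^sub>v ?w) $ a * (h * p ^ a))"
    unfolding entry_def using mod Ag
    by (intro arg_cong2[where f = "(+)"] T sum.cong arg_cong2[where f = "(*)"])
      (simp_all add: mult_mat_vec_index vec_decode_def A del: index_mult_mat_vec)
  also have "(\<Sum>a<m. vec_mod p (?v + (rep_mats R ! (x mod h)) *\<^sub>v ?w) $ a * (h * p ^ a))
      = vec_code p (vec_mod p (?v + (rep_mats R ! (x mod h)) *\<^sub>v ?w)) * h"
    using Ag by (simp add: vec_code_def sum_distrib_left mult_ac vec_decode_def)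
  also have "grp R $$ (x mod h, y mod h) + \<dots> = semidirect_table p R $$ (x, y)"
    using xy by (simp add: semidirect_table_def Let_def pair_code_def semidirect_def m h table_group_def)
  finally show ?thesis .
qed

lemma encode_rep_nth:
  assumes R: "is_rep p R" and h: "h = dim_row (grp R)" and m: "m = rep_dim R"
  shows "length (encode_rep R) = 2 + h * h + h * (m * m)"
    "encode_rep R ! 0 = m" "encode_rep R ! 1 = h"
    "g < h \<Longrightarrow> k < h \<Longrightarrow> encode_rep R ! (2 + g * h + k) = grp R $$ (g, k)"
    "g < h \<Longrightarrow> a < m \<Longrightarrow> b < m \<Longrightarrow> encode_rep R ! (2 + h * h + g * (m * m) + a * m + b) = rep_mats R ! g $$ (a, b)"
proof -
  have sq: "dim_col (grp R) = h" using R h by (simp add: is_rep_def cayley_table_def)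
  have len: "length (rep_mats R) = h" using R h by (simp add: is_rep_def)
  have A: "rep_mats R ! g \<in> carrier_mat m m" if "g < h" for g
    using R that h m by (auto simp: is_rep_def hom_def table_group_def GL_def Zp_mat_def)
  have A': "length xs = m * m" if xs: "xs \<in> set (map mat_entries (rep_mats R))" for xs
  proof -
    obtain g where g: "g < h" "xs = mat_entries (rep_mats R ! g)"
      using xs len by (auto simp: in_set_conv_nth)
    show ?thesis using carrier_matD[OF A[OF g(1)]] g(2) by simp
  qed
  have lenc: "length (concat (map mat_entries (rep_mats R))) = h * (m * m)"
    using length_concat_uniform[of "map mat_entries (rep_mats R)" "m * m"] A' len by simp
  show "length (encode_rep R) = 2 + h * h + h * (m * m)"
    using lenc h sq by (simp add: encode_rep_def)
  show "encode_rep R ! 0 = m" "encode_rep R ! 1 = h" by (simp_all add: encode_rep_def h m)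
  show "encode_rep R ! (2 + g * h + k) = grp R $$ (g, k)" if gk: "g < h" "k < h"
  proof -
    have "g * h + k < h * h" using gk mult_le_mono1[of "Suc g" h h] by simp
    moreover have "mat_entries (grp R) ! (g * h + k) = grp R $$ (g, k)"
      using mat_entries_nth[of g "grp R" k] gk h sq by simp
    ultimately show ?thesis using h sq by (simp add: encode_rep_def nth_append)
  qed
  show "encode_rep R ! (2 + h * h + g * (m * m) + a * m + b) = rep_mats R ! g $$ (a, b)"
    if g: "g < h" and ab: "a < m" "b < m"
  proof -
    let ?j = "a * m + b"
    have j: "?j < m * m" using ab mult_le_mono1[of "Suc a" m m] by simp
    have "concat (map mat_entries (rep_mats R)) ! (g * (m * m) + ?j) = map mat_entries (rep_mats R) ! g ! ?j"
      using A' g j len by (intro nth_concat_uniform) auto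
    also have "\<dots> = mat_entries (rep_mats R ! g) ! ?j" using g len by simp
    also have "\<dots> = rep_mats R ! g $$ (a, b)"
      using mat_entries_nth[of a "rep_mats R ! g" b] A[OF g] ab by auto
    finally show ?thesis using h sq by (simp add: encode_rep_def nth_append add.assoc)
  qed
qed

lemma rep_to_group_wp:
  assumes R1: "rep_ext p q R1" and R2: "rep_ext p q R2"
  shows "wp (rep_pair_size (p, R1, R2)) rep_to_group_prog
    (\<lambda>M out. out = encode_tables (semidirect_table p R1, semidirect_table p R2))
    (init_mem (encode_rep_pair (p, R1, R2))) []"
proof -
  interpret A: rep_ext p q R1 by (rule R1)
  interpret B: rep_ext p q R2 by (rule R2)
  let ?S = "rep_pair_size (p, R1, R2)" and ?xs = "encode_rep_pair (p, R1, R2)"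
  let ?M = "init_mem ?xs"
  define m1 h1 m2 h2 where defs: "m1 = rep_dim R1" "h1 = dim_row (grp R1)" "m2 = rep_dim R2" "h2 = dim_row (grp R2)"
  have p1: "p > 1" using A.primes prime_gt_1_nat by blast
  have ord: "Coset.order (table_group (grp R)) = dim_row (grp R)" for R
    by (simp add: Coset.order_def table_group_def)
  have S: "?S = p ^ m1 * h1 + p ^ m2 * h2" by (simp add: rep_pair_size_def ord defs)
  have h_pos: "h1 > 0" "h2 > 0"
    using A.H.one_closed B.H.one_closed by (auto simp: defs table_group_def intro: gr0I)
  have ms: "m \<le> p ^ m" "m > 0 \<Longrightarrow> p \<le> p ^ m" for m
    using p1 power_gt_expt[of p m] self_le_power[of p m] by (auto intro: less_imp_le)
  \<comment> \<open>Groups are not empty, so the size dominates \<open>h\<close> and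
    \<open>p ^ m\<close>, and with the latter also \<open>m\<close>; it dominates \<open>p\<close>
    only if \<open>m\<close> is positive.\<close>
  have le: "h \<le> ?S \<and> p ^ m \<le> ?S \<and> m \<le> ?S \<and> (m > 0 \<longrightarrow> p \<le> ?S)" if S': "p ^ m * h \<le> ?S" and h: "h > 0" for m h
  proof -
    have "p ^ m \<le> p ^ m * h" "h \<le> p ^ m * h" using h p1 by simp_all
    then have "h \<le> ?S" "p ^ m \<le> ?S" using S' by linarith+
    then show ?thesis using ms[of m] by linarith
  qed
  have b1: "h1 \<le> ?S" "p ^ m1 \<le> ?S" "m1 \<le> ?S" "m1 > 0 \<Longrightarrow> p \<le> ?S"
    and b2: "h2 \<le> ?S" "p ^ m2 \<le> ?S" "m2 \<le> ?S" "m2 > 0 \<Longrightarrow> p \<le> ?S"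
    using le[of m1 h1] le[of m2 h2] h_pos S by simp_all
  note e1 = encode_rep_nth[OF A.is_rep defs(2,1)] and e2 = encode_rep_nth[OF B.is_rep defs(4,3)]
  have in1: "?M 0 (2 + i) = encode_rep R1 ! i" if "i < length (encode_rep R1)" for i
    using that init_mem_Suc[of "Suc i" ?xs] by (simp add: encode_rep_pair_def nth_append)
  \<comment> \<open>The length of the first encoding; behind the two leading cells and this encoding
    the second one starts.\<close>
  let ?\<beta> = "2 + h1 * h1 + h1 * (m1 * m1)"
  have in2: "?M 0 (2 + ?\<beta> + i) = encode_rep R2 ! i" if "i < length (encode_rep R2)" for i
    using that init_mem_Suc[of "Suc (length (encode_rep R1) + i)" ?xs]
    by (simp add: encode_rep_pair_def nth_append e1(1) add.assoc)
  let ?T1 = "\<lambda>g k. grp R1 $$ (g, k)" and ?T2 = "\<lambda>g k. grp R2 $$ (g, k)"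
  let ?A1 = "\<lambda>g a b. rep_mats R1 ! g $$ (a, b)" and ?A2 = "\<lambda>g a b. rep_mats R2 ! g $$ (a, b)"
  have row: "g * h + k < h * h" if "g < h" "k < h" for g h k :: nat
    using that mult_le_mono1[of "Suc g" h h] by simp
  have mats: "g * (m * m) + a * m + b < h * (m * m)" if "g < h" "a < m" "b < m" for g h a b m :: nat
    using row[OF that(2,3)] mult_le_mono1[of "Suc g" h "m * m"] that(1) by simp
  have i0: "?M 0 1 = p" "?M 0 2 = m1" "?M 0 3 = h1"
    using init_mem_Suc[of 0 ?xs] in1[of 0] in1[of 1] e1(1-3)
    by (simp_all add: encode_rep_pair_def numeral_3_eq_3 numeral_2_eq_2)
  have i1: "?M 0 (2 + 2 + g * h1 + k) = ?T1 g k" if "g < h1" "k < h1" for g k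
    using in1[of "2 + g * h1 + k"] e1(1,4) row[OF that] that by (simp add: add.assoc eval_nat_numeral)
  have j1: "?M 0 (2 + 2 + h1 * h1 + g * (m1 * m1) + a * m1 + b) = ?A1 g a b" if "g < h1" "a < m1" "b < m1" for g a b
    using in1[of "2 + h1 * h1 + g * (m1 * m1) + a * m1 + b"] e1(1,5) mats[OF that] that by (simp add: add.assoc eval_nat_numeral)
  have i02: "?M 0 (2 + ?\<beta>) = m2" "?M 0 (2 + ?\<beta> + 1) = h2"
    using in2[of 0] in2[of 1] e2(1-3) by simp_all
  have i2: "?M 0 (2 + ?\<beta> + 2 + g * h2 + k) = ?T2 g k" if "g < h2" "k < h2" for g k
    using in2[of "2 + g * h2 + k"] e2(1,4) row[OF that] that by (simp add: add.assoc eval_nat_numeral)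
  have j2: "?M 0 (2 + ?\<beta> + 2 + h2 * h2 + g * (m2 * m2) + a * m2 + b) = ?A2 g a b" if "g < h2" "a < m2" "b < m2" for g a b
    using in2[of "2 + h2 * h2 + g * (m2 * m2) + a * m2 + b"] e2(1,5) mats[OF that] that by (simp add: add.assoc eval_nat_numeral)
  have cH: "carrier (table_group (grp R)) = {..<dim_row (grp R)}" for R by (simp add: table_group_def)
  have A1: "?A1 g a b < p" if "g < h1" "a < m1" "b < m1" for g a b
    using A.A_Zp[of g] that by (simp add: cH defs Zp_mat_def)
  have A2: "?A2 g a b < p" if "g < h2" "a < m2" "b < m2" for g a b
    using B.A_Zp[of g] that by (simp add: cH defs Zp_mat_def)
  have ent: "concat (map (\<lambda>x. map (\<lambda>y. entry p m h (\<lambda>g k. grp R $$ (g, k)) (\<lambda>g a b. rep_mats R ! g $$ (a, b))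
      (x div h) (x mod h) (y div h) (y mod h)) [0..<p ^ m * h]) [0..<p ^ m * h]) = mat_entries (semidirect_table p R)"
    if "rep_ext p q R" "h = dim_row (grp R)" "m = rep_dim R" for R h m
    using entry_semidirect_table[OF that] that(2,3)
    by (auto simp: mat_entries_altdef semidirect_table_def Let_def intro!: arg_cong[where f = concat] map_cong)
  show ?thesis
    unfolding rep_to_group_prog_def block.simps wp.simps
  proof (rule wp_LoadRep[where p = p and m = m1 and h = h1 and \<beta> = 2 and T = ?T1 and A = ?A1], goal_cases)
    case (14 M1)
    have fr1: "M1 a = ?M a" if "a \<notin> {101, 102} \<union> writes (LoadRep 100)" for a using 14(1) that by simp
    have z1: "M1 0 = ?M 0" by (rule fr1) simp
    have p1': "M1 101 0 = p" using 14(2) by (simp add: rep_loaded_def)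
    show ?case
      unfolding wp.simps
    proof (rule wp_LoadRep[where p = p and m = m2 and h = h2 and \<beta> = "2 + ?\<beta>" and T = ?T2 and A = ?A2], goal_cases)
      case (14 M2)
      have L2: "rep_loaded M2 200 p m2 h2 ?T2 ?A2" by (rule 14(2))
      have L1: "rep_loaded M2 100 p m1 h1 ?T1 ?A1"
        by (rule rep_loaded_frame[OF \<open>rep_loaded M1 100 p m1 h1 ?T1 ?A1\<close>]) (use 14(1) in auto)
      have n: "M2 107 (M2 103 0) = p ^ m1 * h1" "M2 207 (M2 203 0) = p ^ m2 * h2"
        using L1 L2 by (simp_all add: rep_loaded_def)
      show ?case
        unfolding wp.simps
      proof (rule wp_Table[where p = p and m = m1 and h = h1 and T = ?T1 and A = ?A1], goal_cases)
        case (8 M3)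
        have L3: "rep_loaded M3 200 p m2 h2 ?T2 ?A2"
          by (rule rep_loaded_frame[OF L2]) (use 8 in auto)
        show ?case
          unfolding wp.simps
        proof (rule wp_Table[where p = p and m = m2 and h = h2 and T = ?T2 and A = ?A2], goal_cases)
          case (8 M4)
          show ?case
            unfolding ent[OF R1 defs(2,1)] ent[OF R2 defs(4,3)]
            by (simp add: n encode_tables_def semidirect_table_def Let_def defs)
        qed (use L3 p1 b2 A2 in auto)
      qed (use L1 p1 b1 A1 in auto)
    qed (use p1 z1 b2 i0 i02 i2 j2 14(3) fr1 in \<open>auto simp: init_mem_other\<close>)
  qed (use p1 b1 i0 i1 j1 in \<open>auto simp: init_mem_other numeral_3_eq_3\<close>)
qed

theorem SInducedRepEpivalent_reducible:
  "SInducedRepEpivalent \<le>\<^sub>p GroupEpi_on (Coprime ElemAb ElemAb)"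
proof (rule poly_time_reducibleI[where k = 0 and c = rep_to_group_prog and Q = "[:2, 0, 2:] * [:1, 1:]"])
  fix x assume "x \<in> instances SInducedRepEpivalent"
  then obtain p R1 R2 q where x: "x = (p, R1, R2)" and *: "prime p" "is_rep p R1" "is_rep p R2" "q \<noteq> p"
    "elementary_abelian q (table_group (grp R1))" "elementary_abelian q (table_group (grp R2))"
    by (auto simp: SInducedRepEpivalent_def rep_pair_valid_def)
  have q: "prime q" using elementary_abelianD(1)[OF *(5)] .
  have R1: "rep_ext p q R1" and R2: "rep_ext p q R2" using * q by (simp_all add: rep_ext_def)
  let ?T1 = "semidirect_table p R1" and ?T2 = "semidirect_table p R2"
  obtain E1 c1 s1 where S1: "split_ext (table_group ?T1) p q R1 E1 c1 s1" and T1: "cayley_table ?T1"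
    using rep_ext.split_ext_semidirect_table[OF R1] by blast
  obtain E2 c2 s2 where S2: "split_ext (table_group ?T2) p q R2 E2 c2 s2" and T2: "cayley_table ?T2"
    using rep_ext.split_ext_semidirect_table[OF R2] by blast
  have C: "Coprime ElemAb ElemAb (table_group ?T1)" "Coprime ElemAb ElemAb (table_group ?T2)"
    using split_ext.Coprime_ElemAb[OF S1] split_ext.Coprime_ElemAb[OF S2] .
  have n: "dim_row ?T1 + dim_row ?T2 = rep_pair_size (p, R1, R2)"
    by (simp add: rep_pair_size_def semidirect_table_def Let_def Coset.order_def table_group_def)
  have size: "bit_size (encode_tables (?T1, ?T2)) \<le> poly ([:2, 0, 2:] * [:1, 1:]) (rep_pair_size (p, R1, R2))"
    by (rule bit_size_tables_le[OF T1 T2]) (use n in simp_all)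
  let ?B = "GroupEpi_on (Coprime ElemAb ElemAb)"
  let ?Q = "\<lambda>M out. \<exists>y. out = encode ?B y \<and> y \<in> instances ?B
    \<and> (x \<in> positive SInducedRepEpivalent \<longleftrightarrow> y \<in> positive ?B)
    \<and> inst_size ?B y \<le> poly ([:2, 0, 2:] * [:1, 1:]) (inst_size SInducedRepEpivalent x)"
  have "wp (rep_pair_size (p, R1, R2)) rep_to_group_prog ?Q (init_mem (encode_rep_pair (p, R1, R2))) []"
    by (rule wp_conseq[OF rep_to_group_wp[OF R1 R2]], rule exI[of _ "(?T1, ?T2)"])
      (use T1 T2 C size epi_iff_epivalent[OF S1 S2] in
        \<open>simp add: x GroupEpi_on_def restrict_problem_def GroupEpi_def SInducedRepEpivalent_def\<close>)
  then show "wp (inst_size SInducedRepEpivalent x + 0) rep_to_group_prog ?Q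
     (init_mem (encode SInducedRepEpivalent x)) []"
    by (simp add: x SInducedRepEpivalent_def)
qed

section \<open>From groups to representations\<close>

text \<open>
  Now \<open>d + 4\<close> holds the order of the group and \<open>d + 5\<close> the addresses of the rows of its table; \<open>d + 27\<close>
  and \<open>d + 28\<close> hold the neutral element and the inverses, \<open>d + 32\<close> the solutions of \<open>x\<^sup>p = 1\<close>, \<open>d + 36\<close>
  their basis, \<open>d + 33\<close> the enumeration of the spanned subgroup, \<open>d + 34\<close> and \<open>d + 35\<close> its
  characteristic function and the inverse of the enumeration, \<open>d + 38\<close> and \<open>d + 39\<close> the number of the
  coset of an element and a representative of a coset, \<open>d + 37\<close> the elements of the cosets found so
  far, and \<open>d + 40\<close> the number of these cosets.
\<close>

definition mulE :: "nat \<Rightarrow> expr \<Rightarrow> expr \<Rightarrow> expr" where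
  "mulE d e1 e2 = Get 0 (Add (Get (d + 5) e1) e2)"

lemma reads_mulE [simp]: "reads (mulE d e1 e2) = {0, d + 5} \<union> reads e1 \<union> reads e2"
  by (auto simp: mulE_def)

section \<open>Reading a table and testing a pair of primes\<close>

definition LoadGroup :: "nat \<Rightarrow> prog" where
  "LoadGroup d = block
    [Offsets d,
     For (d + 17) (V (d + 4)) (IfEq (mulE d (V (d + 17)) (V (d + 17))) (V (d + 17))
      (Assign (d + 27) (V (d + 17))) Skip),
     For (d + 17) (V (d + 4)) (For (d + 18) (V (d + 4))
      (IfEq (mulE d (V (d + 17)) (V (d + 18))) (V (d + 27)) (Put (d + 28) (V (d + 17)) (V (d + 18))) Skip))]"

lemma writes_LoadGroup [simp]: "writes (LoadGroup d) = {d + 5, d + 12, d + 13, d + 17, d + 18, d + 27, d + 28}"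
  by (auto simp: LoadGroup_def)

definition Power :: "nat \<Rightarrow> nat \<Rightarrow> prog" where
  "Power d a = block
    [Assign (d + 31) (V (d + 27)), For (d + 14) (V a) (Assign (d + 31) (mulE d (V (d + 31)) (V (d + 17))))]"

lemma writes_Power [simp]: "writes (Power d a) = {d + 14, d + 31}"
  by (auto simp: Power_def)

definition MarkTor :: "nat \<Rightarrow> prog" where
  "MarkTor d = For (d + 17) (V (d + 4)) (block
    [Power d (d + 1), IfEq (V (d + 31)) (V (d + 27))
      (Put (d + 32) (V (d + 17)) (Const 1)) (Put (d + 32) (V (d + 17)) (Const 0))])"

lemma writes_MarkTor [simp]: "writes (MarkTor d) = {d + 14, d + 17, d + 31, d + 32}"
  by (auto simp: MarkTor_def)

definition CheckTor :: "nat \<Rightarrow> prog" where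
  "CheckTor d = block
    [Assign (d + 29) (Const 1),
     For (d + 17) (V (d + 4)) (block
      [Power d (d + 30),
       IfEq (Get (d + 32) (V (d + 31))) (Const 1) Skip (Assign (d + 29) (Const 0)),
       For (d + 18) (V (d + 4))
        (IfEq (Get (d + 32) (V (d + 17))) (Const 1)
          (IfEq (Get (d + 32) (V (d + 18))) (Const 1)
            (IfEq (Get (d + 32) (mulE d (V (d + 17)) (V (d + 18)))) (Const 1) Skip (Assign (d + 29) (Const 0)))
            Skip)
          Skip)])]"

lemma writes_CheckTor [simp]: "writes (CheckTor d) = {d + 14, d + 17, d + 18, d + 29, d + 31}"
  by (auto simp: CheckTor_def)

locale cayley = group G for G :: "nat monoid" (structure) +
  fixes T :: "nat mat"
  assumes G_table: "G = table_group T" and square: "dim_col T = dim_row T"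
begin

abbreviation "n \<equiv> dim_row T"

lemma carrier_G: "carrier G = {..<n}" by (simp add: G_table table_group_def)
lemma in_G: "x \<in> carrier G \<longleftrightarrow> x < n" by (simp add: carrier_G)
lemma mult_G: "T $$ (x, y) = x \<otimes> y" by (simp add: G_table table_group_def)
lemma mult_less: "x < n \<Longrightarrow> y < n \<Longrightarrow> x \<otimes> y < n" using m_closed by (simp add: in_G)
lemma one_less: "\<one> < n" using one_closed by (simp add: in_G)
lemma inv_less: "x < n \<Longrightarrow> inv x < n" using inv_closed by (simp add: in_G)
lemma pow_less: "x < n \<Longrightarrow> x [^] (j::nat) < n" using nat_pow_closed by (simp add: in_G)

definition loaded :: "mem \<Rightarrow> nat \<Rightarrow> bool" where
  "loaded M d \<longleftrightarrow> M (d + 4) 0 = n \<and> (\<forall>x<n. \<forall>y<n. M 0 (M (d + 5) x + y) = x \<otimes> y)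
    \<and> M (d + 27) 0 = \<one> \<and> (\<forall>x<n. M (d + 28) x = inv x)"

lemma loaded_frame:
  "loaded M d \<Longrightarrow> (\<And>a. a \<in> {0, d + 4, d + 5, d + 27, d + 28} \<Longrightarrow> M' a = M a) \<Longrightarrow> loaded M' d"
  by (simp add: loaded_def)

lemma eval_mulE:
  assumes "loaded M d" "eval M e1 = x" "eval M e2 = y" "x < n" "y < n"
  shows "eval M (mulE d e1 e2) = x \<otimes> y"
  using assms by (simp add: loaded_def mulE_def)

lemma wp_LoadGroup:
  assumes n: "M (d + 4) 0 = n" "n \<le> B" and base: "M (d + 12) 0 = \<beta>"
    and T: "\<And>x y. x < n \<Longrightarrow> y < n \<Longrightarrow> M 0 (\<beta> + x * n + y) = T $$ (x, y)"
    and Q: "\<And>M'. \<forall>a. a \<notin> writes (LoadGroup d) \<longrightarrow> M' a = M a \<Longrightarrow> loaded M' d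
      \<Longrightarrow> M' (d + 12) 0 = \<beta> + n * n \<Longrightarrow> Q M' out"
  shows "wp B (LoadGroup d) Q M out"
  unfolding LoadGroup_def block.simps wp.simps
proof (rule wp_Offsets[where h = n], goal_cases)
  case (3 M1)
  have mul: "eval M' (mulE d (V a) (V b)) = x \<otimes> y"
    if "M' (d + 5) = M1 (d + 5)" "M' 0 = M1 0" "M' a 0 = x" "M' b 0 = y" "x < n" "y < n" for M' a b x y
    using that 3 T[of x y] base by (simp add: mulE_def mult_G)
  show ?case
    unfolding wp.simps
  proof (rule wp_For[where I = "\<lambda>k M' o'. (\<one> < k \<longrightarrow> M' (d + 27) 0 = \<one>) \<and> o' = out" and n = n], goal_cases)
    case (6 k M' o')
    have "eval M' (mulE d (V (d + 17)) (V (d + 17))) = k \<otimes> k"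
      by (rule mul) (use 6 in auto)
    \<comment> \<open>The neutral element is recognised as the only idempotent.\<close>
    moreover have "k \<otimes> k = k \<longleftrightarrow> k = \<one>" using 6(1) l_cancel_one[of k k] by (simp add: in_G)
    ultimately show ?case using 6(3,4) by (auto simp: less_Suc_eq)
  next
    case (7 M2 o2)
    have one: "M2 (d + 27) 0 = \<one>" using 7(2) one_less by simp
    show ?case
      unfolding wp.simps
    proof (rule wp_For[where I = "\<lambda>k M' o'. (\<forall>x<k. M' (d + 28) x = inv x) \<and> o' = out" and n = n], goal_cases)
      case (6 k M' o')
      have one': "M' (d + 27) 0 = \<one>" using 6(2) one by simp
      show ?case
      proof (rule wp_For[where I = "\<lambda>j M' o'. (\<forall>x<k. M' (d + 28) x = inv x) \<and> (inv k < j \<longrightarrow> M' (d + 28) k = inv k) \<and> o' = out"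
            and n = n], goal_cases)
        case (6 j M'' o'')
        have kj: "M'' (d + 17) 0 = k" "k < n" "M'' (d + 27) 0 = \<one>"
          using 6(2) \<open>M' (d + 17) 0 = k\<close> \<open>k < n\<close> one' by simp_all
        have "eval M'' (mulE d (V (d + 17)) (V (d + 18))) = k \<otimes> j"
          by (rule mul) (use 6(1-3) kj \<open>\<forall>a. a \<notin> _ \<longrightarrow> M' a = M2 a\<close> 7(1) in auto)
        moreover have "k \<otimes> j = \<one> \<longleftrightarrow> j = inv k"
          using kj(2) 6(1) inv_equality[of j k] inv_comm[of k j] r_inv[of k] by (auto simp: in_G)
        ultimately show ?case using 6 kj by (auto simp: less_Suc_eq)
      next
        case (7 M'' o'')
        then show ?case using 6(1) inv_less[of k] by (auto simp: less_Suc_eq)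
      qed (use 6 7(1) 3(1) n in auto)
    next
      case (7 M3 o3)
      have fr: "M3 a = M a" if "a \<notin> writes (LoadGroup d)" for a
        using that 7(1) \<open>\<forall>a. a \<notin> _ \<longrightarrow> M2 a = M1 a\<close> 3(1) by simp
      have fr1: "M3 a = M1 a" if "a \<notin> {d + 17, d + 18, d + 27, d + 28}" for a
        using that 7(1) \<open>\<forall>a. a \<notin> _ \<longrightarrow> M2 a = M1 a\<close> by simp
      have "loaded M3 d"
        unfolding loaded_def
      proof (intro conjI allI impI)
        show "M3 (d + 4) 0 = n" using fr n by simp
        show "M3 (d + 27) 0 = \<one>" using 7(1) one by simp
        show "M3 (d + 28) x = inv x" if "x < n" for x using 7(2) that by simp
        show "M3 0 (M3 (d + 5) x + y) = x \<otimes> y" if "x < n" "y < n" for x y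
          using fr1 3(1,2) T[OF that] that base by (simp add: mult_G)
      qed
      moreover have "M3 (d + 12) 0 = \<beta> + n * n" using fr1 3(3) base by simp
      ultimately show ?case using 7(2) Q fr by simp
    qed (use 7 3(1) n in auto)
  qed (use 3(1) n in auto)
qed (use n in auto)

lemma wp_Power:
  assumes L: "loaded M d" and x: "M (d + 17) 0 = x" "x < n" and a: "M a 0 = j" "j \<le> B" "a \<notin> {d + 31, d + 14}"
    and Q: "\<And>M'. \<forall>a. a \<notin> {d + 14, d + 31} \<longrightarrow> M' a = M a \<Longrightarrow> M' (d + 31) 0 = x [^] j \<Longrightarrow> Q M' out"
  shows "wp B (Power d a) Q M out"
  unfolding Power_def block.simps wp.simps
proof (rule wp_For[where I = "\<lambda>k M' o'. M' (d + 31) 0 = x [^] k \<and> o' = out" and n = j], goal_cases)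
  case (6 k M' o')
  have "loaded M' d" by (rule loaded_frame[OF L]) (use 6(2) in auto)
  then have "eval M' (mulE d (V (d + 31)) (V (d + 17))) = x [^] k \<otimes> x"
    by (rule eval_mulE) (use 6 x pow_less in auto)
  then show ?case using 6 by simp
qed (use L x a Q in \<open>auto simp: loaded_def\<close>)

lemma wp_MarkTor:
  assumes L: "loaded M d" and p: "M (d + 1) 0 = p" "p \<le> B" and n: "n \<le> B"
    and Q: "\<And>M'. \<forall>a. a \<notin> writes (MarkTor d) \<longrightarrow> M' a = M a
      \<Longrightarrow> \<forall>x<n. M' (d + 32) x = (if x \<in> tor G p then 1 else 0) \<Longrightarrow> Q M' out"
  shows "wp B (MarkTor d) Q M out"
  unfolding MarkTor_def
proof (rule wp_For[where I = "\<lambda>k M' o'. (\<forall>x<k. M' (d + 32) x = (if x \<in> tor G p then 1 else 0)) \<and> o' = out" and n = n], goal_cases)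
  case (6 k M' o')
  have L': "loaded M' d" by (rule loaded_frame[OF L]) (use 6(2) in auto)
  show ?case
    unfolding block.simps wp.simps
  proof (rule wp_Power[OF L', where x = k and j = p], goal_cases)
    case (6 M'')
    have "M'' (d + 27) 0 = \<one>" using 6(1) L' by (simp add: loaded_def)
    then show ?case using 6 \<open>k < n\<close> \<open>_ \<and> o' = out\<close> \<open>M' (d + 17) 0 = k\<close> by (auto simp: less_Suc_eq tor_def in_G)
  qed (use 6 p in auto)
qed (use L n Q in \<open>auto simp: loaded_def\<close>)

definition tor_ok :: "nat \<Rightarrow> nat \<Rightarrow> bool" where
  "tor_ok p q \<longleftrightarrow> (\<forall>x<n. x [^] q \<in> tor G p \<and> (\<forall>y<n. x \<in> tor G p \<longrightarrow> y \<in> tor G p \<longrightarrow> x \<otimes> y \<in> tor G p))"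

lemma wp_CheckTor:
  assumes L: "loaded M d" and q: "M (d + 30) 0 = q" "q \<le> B" and n: "n \<le> B"
    and N: "\<forall>x<n. M (d + 32) x = (if x \<in> tor G p then 1 else 0)"
    and Q: "\<And>M'. \<forall>a. a \<notin> writes (CheckTor d) \<longrightarrow> M' a = M a
      \<Longrightarrow> M' (d + 29) 0 = (if tor_ok p q then 1 else 0) \<Longrightarrow> Q M' out"
  shows "wp B (CheckTor d) Q M out"
proof -
  let ?P = "\<lambda>x y. x \<in> tor G p \<longrightarrow> y \<in> tor G p \<longrightarrow> x \<otimes> y \<in> tor G p"
  let ?R = "\<lambda>x. x [^] q \<in> tor G p \<and> (\<forall>y<n. ?P x y)"
  show ?thesis
    unfolding CheckTor_def block.simps wp.simps
  proof (rule wp_For[where I = "\<lambda>k M' o'. M' (d + 29) 0 = (if \<forall>x<k. ?R x then 1 else 0) \<and> o' = out" and n = n], goal_cases)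
    case (6 k M1 o1)
    have L1: "loaded M1 d" by (rule loaded_frame[OF L]) (use 6(2) in auto)
    have N1: "\<forall>x<n. M1 (d + 32) x = (if x \<in> tor G p then 1 else 0)" using 6(2) N by simp
    show ?case
      unfolding wp.simps
    proof (rule wp_Power[OF L1, where x = k and j = q], goal_cases)
      case (6 M2)
      have N2: "\<forall>x<n. M2 (d + 32) x = (if x \<in> tor G p then 1 else 0)" using 6(1) N1 by simp
      \<comment> \<open>Both outcomes of the exponent test are followed by the same loop; this state
        stands for either of them.\<close>
      let ?M = "if k [^] q \<in> tor G p then M2 else M2(d + 29 := (M2 (d + 29))(0 := 0))"
      have L3: "loaded ?M d" by (rule loaded_frame[OF L1]) (use 6(1) in auto)
      have M3: "?M (d + 29) 0 = (if (\<forall>x<k. ?R x) \<and> k [^] q \<in> tor G p then 1 else 0)"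
        "?M (d + 17) 0 = k" "?M (d + 32) = M2 (d + 32)" "?M (d + 4) 0 = n"
        using 6(1) \<open>_ \<and> o1 = out\<close> \<open>M1 (d + 17) 0 = k\<close> L1 by (auto simp: loaded_def)
      have *: "wp B (For (d + 18) (V (d + 4))
        (IfEq (Get (d + 32) (V (d + 17))) (Const 1)
          (IfEq (Get (d + 32) (V (d + 18))) (Const 1)
            (IfEq (Get (d + 32) (mulE d (V (d + 17)) (V (d + 18)))) (Const 1) Skip (Assign (d + 29) (Const 0)))
            Skip)
          Skip)) (\<lambda>M'' o''. (M''(d + 17 := (M'' (d + 17))(0 := Suc k))) (d + 29) 0 = (if \<forall>x<Suc k. ?R x then 1 else 0) \<and> o'' = out)
          ?M o1"
      proof (rule wp_For[where I = "\<lambda>j M' o'. M' (d + 29) 0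
            = (if (\<forall>x<k. ?R x) \<and> k [^] q \<in> tor G p \<and> (\<forall>y<j. ?P k y) then 1 else 0) \<and> o' = out" and n = n], goal_cases)
        case (6 j M' o')
        have L': "loaded M' d" by (rule loaded_frame[OF L3]) (use 6(2) in auto)
        have a: "M' (d + 17) 0 = k" "M' (d + 18) 0 = j" "M' (d + 32) = M2 (d + 32)" using 6(2,3) M3 by simp_all
        have "eval M' (mulE d (V (d + 17)) (V (d + 18))) = k \<otimes> j"
          by (rule eval_mulE[OF L']) (use a 6(1) \<open>k < n\<close> in auto)
        then show ?case
          using a N2 6(1,4) \<open>k < n\<close> mult_less[of k j] by (auto simp: less_Suc_eq)
      next
        case (7 M' o') then show ?case by (auto simp: less_Suc_eq)
      qed (use M3 n \<open>_ \<and> o1 = out\<close> in auto)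
      show ?case
      proof (cases "k [^] q \<in> tor G p")
        case True
        then have "M2 (d + 32) (M2 (d + 31) 0) = 1" using N2 6(2) \<open>k < n\<close> pow_less[of k q] by simp
        then show ?thesis using * True by (simp split del: if_split)
      next
        case False
        then have "M2 (d + 32) (M2 (d + 31) 0) = 0" using N2 6(2) \<open>k < n\<close> pow_less[of k q] by simp
        then show ?thesis using * False by (simp split del: if_split)
      qed
    qed (use 6 q in auto)
  next
    case (7 M' o')
    then show ?case using Q[of M'] by (simp add: tor_ok_def)
  qed (use L n in \<open>auto simp: loaded_def\<close>)
qed

end

section \<open>Bases of the torsion and its cosets\<close>

context group begin

text \<open>Coefficients matter only modulo \<open>p\<close>, and reduced coefficients are the
  digits of a number below \<open>p ^ m\<close>.\<close>

lemma lin_digits_image: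
  assumes p: "p > 0" and b: "\<And>k. k < m \<Longrightarrow> b k \<in> tor G p"
  shows "lin G b w m \<in> (\<lambda>i. lin G b (\<lambda>k. i div p ^ k mod p) m) ` {..<p ^ m}"
proof (rule image_eqI)
  let ?i = "\<Sum>k<m. (w k mod p) * p ^ k"
  show "?i \<in> {..<p ^ m}" using p digit_sum_less[of m "\<lambda>k. w k mod p" p] by simp
  have "lin G b w m = lin G b (\<lambda>k. w k mod p) m"
    using b
  proof (induction m)
    case (Suc m)
    then show ?case using pow_mod_exponent[of "b m" p "w m"] Suc.prems[of m] by (simp add: tor_def)
  qed simp
  also have "lin G b (\<lambda>k. w k mod p) m = lin G b (\<lambda>k. ?i div p ^ k mod p) m"
    using p digit_of_digit_sum[of m "\<lambda>k. w k mod p" p] by (intro lin_cong) simp_all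
  finally show "lin G b w m = lin G b (\<lambda>k. ?i div p ^ k mod p) m" .
qed

text \<open>Adding \<open>p ^ m\<close> raises the digit with index \<open>m\<close> by one and
  leaves the lower digits alone; the bound on \<open>i\<close> excludes a carry. Injectivity is the
  exchange argument of linear algebra: a coincidence would place a power of \<open>x\<close> with
  exponent between 1 and \<open>p - 1\<close> in the old span, and with it \<open>x\<close>
  itself.\<close>

lemma lin_extend:
  assumes closed: "\<And>x y. x \<in> tor G p \<Longrightarrow> y \<in> tor G p \<Longrightarrow> x \<otimes> y \<in> tor G p"
    and comm: "\<And>x y. x \<in> tor G p \<Longrightarrow> y \<in> tor G p \<Longrightarrow> x \<otimes> y = y \<otimes> x"
    and p: "prime p" and b: "\<And>k. k < m \<Longrightarrow> b k \<in> tor G p" and x: "x \<in> tor G p"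
    and inj: "inj_on (\<lambda>i. lin G b (\<lambda>k. i div p ^ k mod p) m) {..<p ^ m}"
    and new: "x \<notin> (\<lambda>i. lin G b (\<lambda>k. i div p ^ k mod p) m) ` {..<p ^ m}"
  defines "e \<equiv> \<lambda>i. lin G (b(m := x)) (\<lambda>k. i div p ^ k mod p) (Suc m)"
  shows "\<And>i. i < p ^ m \<Longrightarrow> e i = lin G b (\<lambda>k. i div p ^ k mod p) m"
    and "\<And>i. i < (p - 1) * p ^ m \<Longrightarrow> e (i + p ^ m) = e i \<otimes> x"
    and "inj_on e {..<p ^ Suc m}"
proof -
  let ?l = "\<lambda>i. lin G b (\<lambda>k. i div p ^ k mod p) m"
  have p1: "p > 1" using p by (rule prime_gt_1_nat)
  have xc: "x \<in> carrier G" and xp: "x [^] p = \<one>" using x by (simp_all add: tor_def)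
  have lt: "lin G b w m \<in> tor G p" for w by (rule lin_tor) (rule closed b; assumption)+
  have lc: "lin G b w m \<in> carrier G" for w using lt[of w] by (simp add: tor_def)
  have e: "e i = ?l i \<otimes> x [^] (i div p ^ m mod p)" for i
    unfolding e_def by (simp cong: lin_cong)
  show "e i = ?l i" if "i < p ^ m" for i
    using that lc by (simp add: e)
  show "e (i + p ^ m) = e i \<otimes> x" if i: "i < (p - 1) * p ^ m" for i
  proof -
    have "(i + p ^ m) div p ^ k mod p = i div p ^ k mod p" if "k < m" for k
    proof -
      have "p ^ m = p ^ k * (p * p ^ (m - k - 1))" using that by (simp flip: power_Suc power_add)
      then have "(i + p ^ m) div p ^ k = i div p ^ k + p * p ^ (m - k - 1)"
        using p1 by (simp add: div_add1_eq)
      then show ?thesis by simp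
    qed
    then have l: "?l (i + p ^ m) = ?l i" by (intro lin_cong) auto
    have "i div p ^ m < p - 1" using i by (simp add: less_mult_imp_div_less)
    then have "(i + p ^ m) div p ^ m mod p = Suc (i div p ^ m mod p)" using p1 by simp
    then show ?thesis unfolding e l using xc lc by (simp add: m_assoc)
  qed
  have indep: False
    if ij: "lin G b w m \<otimes> x [^] c = lin G b w' m \<otimes> x [^] d" "c < d" "d < p" for w w' and c d :: nat
  proof -
    let ?a = "lin G b w m" and ?a' = "lin G b w' m" and ?t = "d - c"
    have "x [^] d = x [^] ?t \<otimes> x [^] c" using ij(2) xc by (simp add: nat_pow_mult)
    then have "?a \<otimes> x [^] c = (?a' \<otimes> x [^] ?t) \<otimes> x [^] c" using ij(1) xc lc by (simp add: m_assoc)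
    then have a: "?a = ?a' \<otimes> x [^] ?t" using xc lc by simp
    \<comment> \<open>The power with exponent \<open>p - 1\<close> serves as inverse, so that the
      quotient is again a combination with natural coefficients.\<close>
    have "?a' \<otimes> ?a' [^] (p - 1) = ?a' [^] p"
      using lc p1 nat_pow_mult[of ?a' 1 "p - 1"] by simp
    also have "\<dots> = \<one>" using lt[of w'] by (simp add: tor_def)
    finally have "?a' [^] (p - 1) \<otimes> ?a' = \<one>" using lc inv_comm by (metis nat_pow_closed)
    then have "x [^] ?t = ?a' [^] (p - 1) \<otimes> ?a" unfolding a using xc lc by (simp flip: m_assoc)
    also have "?a' [^] (p - 1) = lin G b (\<lambda>k. w' k * (p - 1) mod p) m"
      by (rule lin_smult[symmetric]) (rule closed comm b; assumption)+
    also have "\<dots> \<otimes> ?a = lin G b (\<lambda>k. (w' k * (p - 1) mod p + w k) mod p) m"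
      by (rule lin_add[symmetric]) (rule closed comm b; assumption)+
    finally have xt: "x [^] ?t = lin G b (\<lambda>k. (w' k * (p - 1) mod p + w k) mod p) m" .
    \<comment> \<open>Dividing by the exponent \<open>?t\<close> modulo \<open>p\<close> recovers
      \<open>x\<close> from its power.\<close>
    have "coprime ?t p" using ij(2,3) p by (metis coprime_commute prime_imp_coprime_nat nat_dvd_not_less zero_less_diff less_imp_diff_less)
    then obtain u where "[?t * u = Suc 0] (mod p)" using cong_solve_coprime_nat by blast
    then have "?t * u mod p = 1" using p1 by (simp add: cong_def)
    then have "x = x [^] (?t * u)" using pow_mod_exponent[OF xc xp, of "?t * u"] xc by simp
    also have "\<dots> = (x [^] ?t) [^] u" using xc by (simp add: nat_pow_pow)
    also have "\<dots> = lin G b (\<lambda>k. (w' k * (p - 1) mod p + w k) mod p * u mod p) m"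
      unfolding xt by (rule lin_smult[symmetric]) (rule closed comm b; assumption)+
    finally have "x = lin G b (\<lambda>k. (w' k * (p - 1) mod p + w k) mod p * u mod p) m" .
    moreover have "lin G b (\<lambda>k. (w' k * (p - 1) mod p + w k) mod p * u mod p) m \<in> ?l ` {..<p ^ m}"
    proof (rule lin_digits_image)
      show "p > 0" using p1 by simp
    qed (rule b)
    ultimately show False using new by metis
  qed
  show "inj_on e {..<p ^ Suc m}"
  proof (rule inj_onI)
    fix i j assume i: "i \<in> {..<p ^ Suc m}" and j: "j \<in> {..<p ^ Suc m}" and eq: "e i = e j"
    have q: "i div p ^ m < p" "j div p ^ m < p" using i j by (simp_all add: less_mult_imp_div_less)
    have eq': "?l i \<otimes> x [^] (i div p ^ m) = ?l j \<otimes> x [^] (j div p ^ m)" using eq q by (simp add: e)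
    have d: "i div p ^ m = j div p ^ m"
      using indep[OF eq'] indep[OF eq'[symmetric]] q by (metis linorder_neqE_nat)
    then have "?l i = ?l j" using eq' xc lc by simp
    moreover have "?l i = ?l (i mod p ^ m)" for i
    proof (rule lin_cong)
      fix k assume "k < m"
      then show "i div p ^ k mod p = (i mod p ^ m) div p ^ k mod p"
        unfolding digit_sum_of_digits[symmetric]
        using digit_of_digit_sum[of m "\<lambda>k. i div p ^ k mod p" p k] p1 by simp
    qed simp
    ultimately have "?l (i mod p ^ m) = ?l (j mod p ^ m)" by metis
    then have "i mod p ^ m = j mod p ^ m" using inj p1 by (simp add: inj_on_def)
    then show "i = j" using d by (metis div_mult_mod_eq)
  qed
qed

end

text \<open>The loop also reads entries that it has just written: each of the \<open>p - 1\<close>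
  new blocks of length \<open>p ^ m\<close> is the preceding block times the new element.\<close>

definition ExtendBasis :: "nat \<Rightarrow> prog" where
  "ExtendBasis d = block
    [Put (d + 36) (V (d + 3)) (V (d + 17)), Assign (d + 3) (Add (V (d + 3)) (Const 1)),
     MulTo (d + 15) (d + 14) (V (d + 8)) (Sub (V (d + 1)) (Const 1)),
     For (d + 14) (V (d + 15)) (block
      [Assign (d + 31) (mulE d (Get (d + 33) (V (d + 14))) (V (d + 17))),
       Put (d + 33) (Add (V (d + 14)) (V (d + 8))) (V (d + 31)),
       Put (d + 34) (V (d + 31)) (Const 1),
       Put (d + 35) (V (d + 31)) (Add (V (d + 14)) (V (d + 8)))]),
     Assign (d + 8) (Add (V (d + 8)) (V (d + 15)))]"

lemma writes_ExtendBasis [simp]: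
  "writes (ExtendBasis d) = {d + 3, d + 8, d + 14, d + 15, d + 31, d + 33, d + 34, d + 35, d + 36}"
  by (auto simp: ExtendBasis_def)

definition FindBasis :: "nat \<Rightarrow> prog" where
  "FindBasis d = block
    [Put (d + 33) (Const 0) (V (d + 27)), Put (d + 34) (V (d + 27)) (Const 1),
     Put (d + 35) (V (d + 27)) (Const 0), Assign (d + 8) (Const 1), Assign (d + 3) (Const 0),
     For (d + 17) (V (d + 4)) (IfEq (Get (d + 32) (V (d + 17))) (Const 1)
      (IfEq (Get (d + 34) (V (d + 17))) (Const 0) (ExtendBasis d) Skip) Skip)]"

lemma writes_FindBasis [simp]:
  "writes (FindBasis d) = {d + 3, d + 8, d + 14, d + 15, d + 17, d + 31, d + 33, d + 34, d + 35, d + 36}"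
  by (auto simp: FindBasis_def)

definition AddCoset :: "nat \<Rightarrow> prog" where
  "AddCoset d = block
    [For (d + 14) (V (d + 8)) (block
      [Assign (d + 31) (mulE d (Get (d + 33) (V (d + 14))) (V (d + 17))),
       Put (d + 37) (V (d + 31)) (Const 1), Put (d + 38) (V (d + 31)) (V (d + 40))]),
     Put (d + 39) (V (d + 40)) (V (d + 17)), Assign (d + 40) (Add (V (d + 40)) (Const 1))]"

lemma writes_AddCoset [simp]: "writes (AddCoset d) = {d + 14, d + 31, d + 37, d + 38, d + 39, d + 40}"
  by (auto simp: AddCoset_def)

definition FindCosets :: "nat \<Rightarrow> prog" where
  "FindCosets d = block
    [Assign (d + 40) (Const 0),
     For (d + 17) (V (d + 4)) (IfEq (Get (d + 37) (V (d + 17))) (Const 0) (AddCoset d) Skip)]"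

lemma writes_FindCosets [simp]: "writes (FindCosets d) = {d + 14, d + 17, d + 31, d + 37, d + 38, d + 39, d + 40}"
  by (auto simp: FindCosets_def)

text \<open>Closedness is tested by the program, whereas commutativity follows from membership in
  the class, by \<open>tor_complement\<close>.\<close>

locale cayley_tor = cayley G T for G :: "nat monoid" (structure) and T +
  fixes p :: nat
  assumes p: "prime p"
    and closed: "\<And>x y. x \<in> tor G p \<Longrightarrow> y \<in> tor G p \<Longrightarrow> x \<otimes> y \<in> tor G p"
    and comm: "\<And>x y. x \<in> tor G p \<Longrightarrow> y \<in> tor G p \<Longrightarrow> x \<otimes> y = y \<otimes> x"
begin

definition comb :: "(nat \<Rightarrow> nat) \<Rightarrow> nat \<Rightarrow> nat \<Rightarrow> nat" where
  "comb b m i = lin G b (\<lambda>k. i div p ^ k mod p) m"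

definition basis :: "mem \<Rightarrow> nat \<Rightarrow> nat \<Rightarrow> bool" where
  "basis M d m \<longleftrightarrow> M (d + 3) 0 = m \<and> M (d + 8) 0 = p ^ m \<and> (\<forall>k<m. M (d + 36) k \<in> tor G p)
    \<and> inj_on (comb (M (d + 36)) m) {..<p ^ m}
    \<and> (\<forall>i<p ^ m. M (d + 33) i = comb (M (d + 36)) m i \<and> M (d + 35) (comb (M (d + 36)) m i) = i)
    \<and> (\<forall>y<n. M (d + 34) y = (if y \<in> comb (M (d + 36)) m ` {..<p ^ m} then 1 else 0))"

lemma basis_frame:
  "basis M d m \<Longrightarrow> (\<And>a. a \<in> {d + 3, d + 8, d + 33, d + 34, d + 35, d + 36} \<Longrightarrow> M' a = M a) \<Longrightarrow> basis M' d m"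
  by (simp add: basis_def)

lemma p1: "p > 1" using p by (rule prime_gt_1_nat)

lemma tor_less: "x \<in> tor G p \<Longrightarrow> x < n" by (simp add: tor_def in_G)

lemma comb_tor: "(\<And>k. k < m \<Longrightarrow> b k \<in> tor G p) \<Longrightarrow> comb b m i \<in> tor G p"
  unfolding comb_def by (rule lin_tor) (rule closed; assumption)+

lemma comb_zero: "comb b m 0 = \<one>"
  by (simp add: comb_def lin_zero)

text \<open>An injective enumeration fits into the group. This bounds every loop over the spanned
  subgroup, including the one that extends it.\<close>

lemma card_basis_le:
  assumes "\<And>k. k < m \<Longrightarrow> b k \<in> tor G p" "inj_on (comb b m) {..<p ^ m}"
  shows "p ^ m \<le> n"
proof -
  have "comb b m i < n" for i
    by (rule tor_less, rule comb_tor) (rule assms(1))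
  then have "comb b m ` {..<p ^ m} \<subseteq> {..<n}" by auto
  then have "card {..<p ^ m} \<le> card {..<n}" using assms(2) by (intro card_inj_on_le) auto
  then show ?thesis by simp
qed

lemma wp_ExtendBasis:
  assumes L: "loaded M d" and n: "n \<le> B" and b: "basis M d m" and p': "M (d + 1) 0 = p"
    and x: "M (d + 17) 0 = x" "x \<in> tor G p" "M (d + 34) x = 0"
    and Q: "\<And>M'. \<forall>a. a \<notin> writes (ExtendBasis d) \<longrightarrow> M' a = M a \<Longrightarrow> basis M' d (Suc m)
      \<Longrightarrow> M' (d + 34) x = 1 \<Longrightarrow> \<forall>y<n. M (d + 34) y = 1 \<longrightarrow> M' (d + 34) y = 1 \<Longrightarrow> Q M' out"
  shows "wp B (ExtendBasis d) Q M out"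
proof -
  let ?s = "p ^ m" and ?b = "M (d + 36)"
  let ?b' = "?b(m := x)"
  let ?e = "comb ?b' (Suc m)"
  note b' = b[unfolded basis_def]
  have bt: "?b k \<in> tor G p" if "k < m" for k using b' that by blast
  have bt': "?b' k \<in> tor G p" if "k < Suc m" for k using bt x that by (auto simp: less_Suc_eq)
  have new: "x \<notin> comb ?b m ` {..<?s}" using b' x tor_less[OF x(2)] by (metis zero_neq_one)
  have e1: "?e i = comb ?b m i" if "i < ?s" for i
    unfolding comb_def by (rule lin_extend(1)[where x = x]) (use p bt x(2) b' new that closed comm in \<open>auto simp: comb_def[abs_def]\<close>)
  have e2: "?e (i + ?s) = ?e i \<otimes> x" if "i < (p - 1) * ?s" for i
    unfolding comb_def by (rule lin_extend(2)[where x = x]) (use p bt x(2) b' new that closed comm in \<open>auto simp: comb_def[abs_def]\<close>)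
  have e3: "inj_on ?e {..<p ^ Suc m}"
    unfolding comb_def[abs_def] by (rule lin_extend(3)[where x = x]) (use p bt x(2) b' new closed comm in \<open>auto simp: comb_def[abs_def]\<close>)
  have et: "?e i \<in> tor G p" for i using bt' by (rule comb_tor)
  have card: "p ^ Suc m \<le> n" using bt' e3 by (rule card_basis_le)
  have "inj_on (comb ?b m) {..<?s}" using b' by blast
  with bt have cardm: "?s \<le> n" by (rule card_basis_le)
  \<comment> \<open>The old block and the \<open>p - 1\<close> new ones.\<close>
  have tot: "?s + ?s * (p - 1) = p ^ Suc m" using p1 by (cases p) auto
  have spos: "?s > 0" using p1 by simp
  show ?thesis
    unfolding ExtendBasis_def block.simps wp.simps
  proof (rule wp_MulTo, goal_cases)
    case (7 M1)
    have M1: "M1 (d + 15) 0 = ?s * (p - 1)" "M1 (d + 8) 0 = ?s" "M1 (d + 36) = ?b'" "M1 (d + 3) 0 = Suc m"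
      "M1 (d + 17) 0 = x" "M1 (d + 33) = M (d + 33)" "M1 (d + 34) = M (d + 34)" "M1 (d + 35) = M (d + 35)"
      using 7 b' p' x by simp_all
    have L1: "loaded M1 d" by (rule loaded_frame[OF L]) (use 7(1) in auto)
    show ?case
      unfolding wp.simps
    proof (rule wp_For[where n = "?s * (p - 1)" and I = "\<lambda>k M' o'.
          (\<forall>i<?s + k. M' (d + 33) i = ?e i \<and> M' (d + 35) (?e i) = i)
          \<and> (\<forall>y<n. M' (d + 34) y = (if y \<in> ?e ` {..<?s + k} then 1 else 0)) \<and> o' = out"], goal_cases)
      case 4 show ?case using card tot n by linarith
    next
      case 5
      have "?e ` {..<?s} = comb ?b m ` {..<?s}" using e1 by (intro image_cong) auto
      then show ?case using M1 b' e1 by auto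
    next
      case (6 k M2 o2)
      have L2: "loaded M2 d" by (rule loaded_frame[OF L1]) (use 6(2) in auto)
      have M2: "M2 (d + 8) 0 = ?s" "M2 (d + 17) 0 = x" using 6(2) M1 by simp_all
      have "M2 (d + 33) k = ?e k" using 6(4) spos by simp
      then have "eval M2 (mulE d (Get (d + 33) (V (d + 14))) (V (d + 17))) = ?e k \<otimes> x"
        by (intro eval_mulE[OF L2]) (use 6(3) M2 tor_less et x in auto)
      then have y: "eval M2 (mulE d (Get (d + 33) (V (d + 14))) (V (d + 17))) = ?e (?s + k)"
        using e2[of k] 6(1) by (simp add: mult.commute add.commute)
      have "?s + k < p ^ Suc m" using 6(1) tot by linarith
      \<comment> \<open>As the extended enumeration is injective, no earlier entry of its inverse is
        overwritten.\<close>
      then have ne: "?e i \<noteq> ?e (?s + k)" if "i < ?s + k" for i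
        using inj_onD[OF e3, of i "?s + k"] that by fastforce
      have "{..<?s + Suc k} = insert (?s + k) {..<?s + k}" by auto
      then have img: "?e ` {..<?s + Suc k} = insert (?e (?s + k)) (?e ` {..<?s + k})" by simp
      show ?case
        unfolding block.simps wp.simps y img
        using 6(3,4) M2 ne by (simp add: less_Suc_eq add.commute[of k])
    next
      case (7 M2 o2)
      have M2: "M2 (d + 8) 0 = ?s" "M2 (d + 36) = ?b'" "M2 (d + 3) 0 = Suc m" "M2 (d + 15) 0 = ?s * (p - 1)"
        using 7(1) M1 by simp_all
      let ?M = "M2(d + 8 := (M2 (d + 8))(0 := M2 (d + 8) 0 + M2 (d + 15) 0))"
      have "basis ?M d (Suc m)"
        unfolding basis_def using M2 7(2) bt' e3 tot by simp
      moreover have "?M (d + 34) x = 1"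
      proof -
        have "x = ?e (0 + ?s)" using e2[of 0] p1 x by (simp add: comb_zero tor_def)
        moreover have "?s < p ^ Suc m" using p1 spos by simp
        ultimately have "x \<in> ?e ` {..<p ^ Suc m}" by (metis add_0 image_eqI lessThan_iff)
        then show ?thesis using 7(2) tor_less[OF x(2)] tot by simp
      qed
      moreover have "\<forall>y<n. M (d + 34) y = 1 \<longrightarrow> ?M (d + 34) y = 1"
      proof (intro allI impI)
        fix y assume y: "y < n" "M (d + 34) y = 1"
        then have "y \<in> comb ?b m ` {..<?s}" using b' by (metis zero_neq_one)
        then obtain i where "i < ?s" "y = ?e i" using e1 by auto
        moreover have "?s \<le> ?s + ?s * (p - 1)" by simp
        ultimately have "y \<in> ?e ` {..<?s + ?s * (p - 1)}" by (metis image_eqI lessThan_iff order.strict_trans2)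
        then show "?M (d + 34) y = 1" using 7(2) y by simp
      qed
      moreover have "\<forall>a. a \<notin> writes (ExtendBasis d) \<longrightarrow> ?M a = M a"
        using 7(1) \<open>\<forall>a. a \<noteq> _ \<and> a \<noteq> _ \<longrightarrow> M1 a = _ a\<close> by simp
      ultimately have "Q ?M out" using Q by blast
      then show ?case using 7(2) by simp
    qed (use M1 in auto)
  next
    case 6 show ?case using b' cardm n by simp
  qed auto
qed

text \<open>Every torsion element is either marked as lying in the span when its turn comes or
  adjoined then. Marks are never lost, so one pass exhausts the torsion.\<close>

lemma wp_FindBasis:
  assumes L: "loaded M d" and n: "n \<le> B" and p': "M (d + 1) 0 = p"
    and N: "\<forall>x<n. M (d + 32) x = (if x \<in> tor G p then 1 else 0)" and z: "M (d + 34) = (\<lambda>_. 0)"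
    and Q: "\<And>M' m. \<forall>a. a \<notin> writes (FindBasis d) \<longrightarrow> M' a = M a \<Longrightarrow> basis M' d m
      \<Longrightarrow> \<forall>y\<in>tor G p. y \<in> comb (M' (d + 36)) m ` {..<p ^ m} \<Longrightarrow> Q M' out"
  shows "wp B (FindBasis d) Q M out"
  unfolding FindBasis_def block.simps wp.simps
proof (rule wp_For[where n = n and I = "\<lambda>k M' o'. (\<exists>m. basis M' d m)
      \<and> (\<forall>y<k. y \<in> tor G p \<longrightarrow> M' (d + 34) y = 1) \<and> o' = out"], goal_cases)
  case 5
  have e: "M (d + 27) 0 = \<one>" using L by (simp add: loaded_def)
  show ?case using e z by (auto simp: basis_def comb_def inj_on_def intro!: exI[of _ 0])
next
  case (6 k M1 o1)
  obtain m where m: "basis M1 d m" using 6(4) by blast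
  have M1: "M1 (d + 32) = M (d + 32)" "M1 (d + 1) 0 = p" using 6(2) p' by simp_all
  have L1: "loaded M1 d" by (rule loaded_frame[OF L]) (use 6(2) in auto)
  have Nk: "M1 (d + 32) k = (if k \<in> tor G p then 1 else 0)" using N 6(1) M1 by simp
  have "M1 (d + 34) k = 0 \<or> M1 (d + 34) k = 1" using m 6(1) by (simp add: basis_def)
  then consider "k \<notin> tor G p" | "k \<in> tor G p" "M1 (d + 34) k = 0" | "k \<in> tor G p" "M1 (d + 34) k = 1"
    by metis
  then show ?case
  proof cases
    case 1
    have "basis (M1(d + 17 := (M1 (d + 17))(0 := Suc k))) d m" by (rule basis_frame[OF m]) auto
    then show ?thesis using 1 6 Nk by (auto simp: less_Suc_eq)
  next
    case 2
    have "wp B (ExtendBasis d) (\<lambda>M'' o''. ((\<exists>m. basis (M''(d + 17 := (M'' (d + 17))(0 := Suc k))) d m)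
      \<and> (\<forall>y<Suc k. y \<in> tor G p \<longrightarrow> (M''(d + 17 := (M'' (d + 17))(0 := Suc k))) (d + 34) y = 1) \<and> o'' = out)) M1 o1"
    proof (rule wp_ExtendBasis[OF L1 n m M1(2), where x = k], goal_cases)
      case (4 M2)
      have "basis (M2(d + 17 := (M2 (d + 17))(0 := Suc k))) d (Suc m)" by (rule basis_frame[OF 4(2)]) auto
      then show ?case using 4(3,4) 6(1,4) by (auto simp: less_Suc_eq)
    qed (use 6 2 in auto)
    then show ?thesis using 2 6 Nk by simp
  next
    case 3
    have "basis (M1(d + 17 := (M1 (d + 17))(0 := Suc k))) d m" by (rule basis_frame[OF m]) auto
    then show ?thesis using 3 6 Nk by (auto simp: less_Suc_eq)
  qed
next
  case (7 M1 o1)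
  obtain m where m: "basis M1 d m" using 7(2) by blast
  have "\<forall>y\<in>tor G p. y \<in> comb (M1 (d + 36)) m ` {..<p ^ m}"
  proof
    fix y assume y: "y \<in> tor G p"
    then have "M1 (d + 34) y = 1" using 7(2) tor_less by blast
    then show "y \<in> comb (M1 (d + 36)) m ` {..<p ^ m}" using m tor_less[OF y] by (auto simp: basis_def split: if_splits)
  qed
  then show ?case using 7 m Q[of M1 m] by simp
qed (use n L in \<open>auto simp: loaded_def\<close>)

text \<open>The last condition also expresses that the cosets found so far are disjoint: an element
  of two of them would have two numbers.\<close>

definition cosets :: "mem \<Rightarrow> nat \<Rightarrow> nat \<Rightarrow> bool" where
  "cosets M d h \<longleftrightarrow> M (d + 40) 0 = h \<and> (\<forall>i<h. M (d + 39) i < n)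
    \<and> (\<forall>y<n. M (d + 37) y = (if \<exists>i<h. y \<otimes> inv (M (d + 39) i) \<in> tor G p then 1 else 0))
    \<and> (\<forall>i<h. \<forall>y<n. y \<otimes> inv (M (d + 39) i) \<in> tor G p \<longrightarrow> M (d + 38) y = i)"

lemma cosets_frame:
  "cosets M d h \<Longrightarrow> (\<And>a. a \<in> {d + 37, d + 38, d + 39, d + 40} \<Longrightarrow> M' a = M a) \<Longrightarrow> cosets M' d h"
  by (simp add: cosets_def)

lemma wp_AddCoset:
  assumes L: "loaded M d" and n: "n \<le> B" and s: "M (d + 8) 0 = s" "s \<le> B"
    and E: "\<And>i. i < s \<Longrightarrow> M (d + 33) i \<in> tor G p" "\<And>y. y \<in> tor G p \<Longrightarrow> \<exists>i<s. M (d + 33) i = y"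
    and h: "cosets M d h" and x: "M (d + 17) 0 = x" "x < n" "M (d + 37) x = 0"
    and Q: "\<And>M'. \<forall>a. a \<notin> writes (AddCoset d) \<longrightarrow> M' a = M a \<Longrightarrow> cosets M' d (Suc h)
      \<Longrightarrow> M' (d + 37) x = 1 \<Longrightarrow> \<forall>y<n. M (d + 37) y = 1 \<longrightarrow> M' (d + 37) y = 1 \<Longrightarrow> Q M' out"
  shows "wp B (AddCoset d) Q M out"
proof -
  let ?E = "M (d + 33)" and ?r = "M (d + 39)"
  note h' = h[unfolded cosets_def]
  have xc: "x \<in> carrier G" using x by (simp add: in_G)
  have Ec: "?E i \<in> carrier G" if "i < s" for i using E(1)[OF that] by (simp add: tor_def)
  have rc: "?r i \<in> carrier G" if "i < h" for i using h' that by (simp add: in_G)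
  have coset: "y \<otimes> inv x \<in> tor G p \<longleftrightarrow> (\<exists>i<s. y = ?E i \<otimes> x)" if y: "y < n" for y
  proof
    assume "y \<otimes> inv x \<in> tor G p"
    then obtain i where "i < s" "?E i = y \<otimes> inv x" using E(2) by metis
    then show "\<exists>i<s. y = ?E i \<otimes> x" using y[folded in_G] xc by (intro exI[of _ i]) (simp add: m_assoc)
  next
    assume "\<exists>i<s. y = ?E i \<otimes> x"
    then show "y \<otimes> inv x \<in> tor G p" using E(1) Ec xc by (auto simp: m_assoc)
  qed
  have tor_inv: "inv z \<in> tor G p" if "z \<in> tor G p" for z using that by (simp add: tor_def nat_pow_inv)
  \<comment> \<open>If the new coset met an old one, \<open>x\<close> would lie in the old one and
    would be marked. Hence the numbers of the old elements survive.\<close>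
  have other: "(?E k \<otimes> x) \<otimes> inv (?r i) \<notin> tor G p" if k: "k < s" and i: "i < h" for k i
  proof
    assume *: "(?E k \<otimes> x) \<otimes> inv (?r i) \<in> tor G p"
    have "x \<otimes> inv (?r i) = inv (?E k) \<otimes> ((?E k \<otimes> x) \<otimes> inv (?r i))"
      using Ec[OF k] xc rc[OF i] by (simp flip: m_assoc)
    then have "x \<otimes> inv (?r i) \<in> tor G p" using closed[OF tor_inv[OF E(1)[OF k]] *] by simp
    then show False using h' x i by (metis zero_neq_one)
  qed
  have El: "?E k \<otimes> x < n" if "k < s" for k using E(1)[OF that] tor_less x(2) mult_less by blast
  show ?thesis
    unfolding AddCoset_def block.simps wp.simps
  proof (rule wp_For[where n = s and I = "\<lambda>k M' o'.
      (\<forall>y<n. M' (d + 37) y = (if (\<exists>i<h. y \<otimes> inv (?r i) \<in> tor G p) \<or> (\<exists>i<k. y = ?E i \<otimes> x) then 1 else 0))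
      \<and> (\<forall>i<h. \<forall>y<n. y \<otimes> inv (?r i) \<in> tor G p \<longrightarrow> M' (d + 38) y = i)
      \<and> (\<forall>i<k. M' (d + 38) (?E i \<otimes> x) = h) \<and> o' = out"], goal_cases)
    case 5 then show ?case using h' by auto
  next
    case (6 k M1 o1)
    have L1: "loaded M1 d" by (rule loaded_frame[OF L]) (use 6(2) in auto)
    have M1: "M1 (d + 33) = ?E" "M1 (d + 17) 0 = x" "M1 (d + 40) 0 = h" using 6(2) x h' by simp_all
    have y: "eval M1 (mulE d (Get (d + 33) (V (d + 14))) (V (d + 17))) = ?E k \<otimes> x"
      by (rule eval_mulE[OF L1]) (use 6(1,3) M1 x tor_less[OF E(1)[OF 6(1)]] in auto)
    show ?case
      unfolding block.simps wp.simps y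
      using 6(4) M1 other[OF 6(1)] El[OF 6(1)] by (auto simp: less_Suc_eq)
  next
    case (7 M1 o1)
    let ?M = "M1(d + 39 := (M1 (d + 39))(M1 (d + 40) 0 := M1 (d + 17) 0),
      d + 40 := (M1 (d + 40))(0 := M1 (d + 40) 0 + 1))"
    have M1: "M1 (d + 17) 0 = x" "M1 (d + 40) 0 = h" "M1 (d + 39) = ?r" using 7(1) x h' by simp_all
    have r': "?M (d + 39) = ?r(h := x)" using M1 by simp
    have "(\<exists>i<Suc h. P i) \<longleftrightarrow> (\<exists>i<h. P i) \<or> P h" for P by (auto simp: less_Suc_eq)
    moreover have "(\<exists>i<h. y \<otimes> inv ((?r(h := x)) i) \<in> tor G p) \<longleftrightarrow> (\<exists>i<h. y \<otimes> inv (?r i) \<in> tor G p)" for y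
      by (intro ex_cong1 conj_cong) auto
    ultimately have key: "(\<exists>i<Suc h. y \<otimes> inv (?M (d + 39) i) \<in> tor G p)
        \<longleftrightarrow> (\<exists>i<h. y \<otimes> inv (?r i) \<in> tor G p) \<or> y \<otimes> inv x \<in> tor G p" for y
      unfolding r' by simp
    have "cosets ?M d (Suc h)"
      unfolding cosets_def
    proof (intro conjI allI impI)
      show "?M (d + 39) i < n" if "i < Suc h" for i using that M1 x(2) h' by (auto simp: less_Suc_eq)
      show "?M (d + 37) y = (if \<exists>i<Suc h. y \<otimes> inv (?M (d + 39) i) \<in> tor G p then 1 else 0)" if y: "y < n" for y
        unfolding key coset[OF y] using 7(2) y by simp
      show "?M (d + 38) y = i" if "i < Suc h" "y < n" "y \<otimes> inv (?M (d + 39) i) \<in> tor G p" for i y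
        using 7(2) coset[of y] that M1 by (auto simp: less_Suc_eq split: if_splits)
    qed (use M1 in simp)
    moreover have "?M (d + 37) x = 1"
    proof -
      have "x \<otimes> inv x \<in> tor G p" using xc by (simp add: tor_def)
      then have "\<exists>i<s. x = ?E i \<otimes> x" using coset[OF x(2)] by blast
      then show ?thesis using 7(2) x(2) by simp
    qed
    moreover have "\<forall>y<n. M (d + 37) y = 1 \<longrightarrow> ?M (d + 37) y = 1"
      using 7(2) h' by (auto split: if_splits)
    moreover have "\<forall>a. a \<notin> writes (AddCoset d) \<longrightarrow> ?M a = M a" using 7(1) by simp
    ultimately have "Q ?M out" using Q by blast
    then show ?case using 7(2) by simp
  qed (use s in auto)
qed

lemma wp_FindCosets:
  assumes L: "loaded M d" and n: "n \<le> B" and s: "M (d + 8) 0 = s" "s \<le> B"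
    and E: "\<And>i. i < s \<Longrightarrow> M (d + 33) i \<in> tor G p" "\<And>y. y \<in> tor G p \<Longrightarrow> \<exists>i<s. M (d + 33) i = y"
    and z: "M (d + 37) = (\<lambda>_. 0)"
    and Q: "\<And>M' h. \<forall>a. a \<notin> writes (FindCosets d) \<longrightarrow> M' a = M a \<Longrightarrow> cosets M' d h
      \<Longrightarrow> \<forall>y<n. \<exists>i<h. y \<otimes> inv (M' (d + 39) i) \<in> tor G p \<Longrightarrow> Q M' out"
  shows "wp B (FindCosets d) Q M out"
  unfolding FindCosets_def block.simps wp.simps
proof (rule wp_For[where n = n and I = "\<lambda>k M' o'. (\<exists>h. cosets M' d h)
      \<and> (\<forall>y<k. M' (d + 37) y = 1) \<and> o' = out"], goal_cases)
  case 5
  show ?case using z by (auto simp: cosets_def intro!: exI[of _ 0])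
next
  case (6 k M1 o1)
  obtain h where h: "cosets M1 d h" using 6(4) by blast
  have L1: "loaded M1 d" by (rule loaded_frame[OF L]) (use 6(2) in auto)
  have M1: "M1 (d + 8) 0 = s" "M1 (d + 33) = M (d + 33)" using 6(2) s by simp_all
  have "M1 (d + 37) k = 0 \<or> M1 (d + 37) k = 1" using h 6(1) by (simp add: cosets_def)
  then consider "M1 (d + 37) k = 0" | "M1 (d + 37) k = 1" by metis
  then show ?case
  proof cases
    case 1
    have "wp B (AddCoset d) (\<lambda>M'' o''. ((\<exists>h. cosets (M''(d + 17 := (M'' (d + 17))(0 := Suc k))) d h)
      \<and> (\<forall>y<Suc k. (M''(d + 17 := (M'' (d + 17))(0 := Suc k))) (d + 37) y = 1) \<and> o'' = out)) M1 o1"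
    proof (rule wp_AddCoset[OF L1 n M1(1) s(2) _ _ h, where x = k], goal_cases)
      case (6 M2)
      have "cosets (M2(d + 17 := (M2 (d + 17))(0 := Suc k))) d (Suc h)" by (rule cosets_frame[OF 6(2)]) auto
      then show ?case using 6(3,4) \<open>k < n\<close> \<open>_ \<and> _ \<and> o1 = out\<close> by (auto simp: less_Suc_eq)
    qed (use 6 1 M1 E in auto)
    then show ?thesis using 1 6 by simp
  next
    case 2
    have "cosets (M1(d + 17 := (M1 (d + 17))(0 := Suc k))) d h" by (rule cosets_frame[OF h]) auto
    then show ?thesis using 2 6 by (auto simp: less_Suc_eq)
  qed
next
  case (7 M1 o1)
  obtain h where h: "cosets M1 d h" using 7(2) by blast
  have "\<forall>y<n. \<exists>i<h. y \<otimes> inv (M1 (d + 39) i) \<in> tor G p"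
    using h 7(2) by (auto simp: cosets_def split: if_splits)
  then show ?case using 7 h Q[of M1 h] by simp
qed (use n L in \<open>auto simp: loaded_def\<close>)

end

text \<open>Matrices are printed row by row, whereas a conjugate determines a column. The position
  of the conjugate is therefore looked up anew for each entry and divided by \<open>p\<close> as
  often as the row index says.\<close>

definition WriteRep :: "nat \<Rightarrow> prog" where
  "WriteRep d = block
    [Write (V (d + 3)), Write (V (d + 40)),
     For (d + 17) (V (d + 40)) (For (d + 18) (V (d + 40))
      (Write (Get (d + 38) (mulE d (Get (d + 39) (V (d + 17))) (Get (d + 39) (V (d + 18))))))),
     For (d + 17) (V (d + 40)) (For (d + 18) (V (d + 3)) (For (d + 19) (V (d + 3)) (block
      [Assign (d + 31) (Get (d + 35) (mulE d (mulE d (Get (d + 39) (V (d + 17))) (Get (d + 36) (V (d + 19))))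
         (Get (d + 28) (Get (d + 39) (V (d + 17)))))),
       For (d + 14) (V (d + 18)) (Assign (d + 31) (Get (d + 9) (V (d + 31)))),
       Write (Get (d + 10) (V (d + 31)))])))]"

lemma writes_WriteRep [simp]: "writes (WriteRep d) = {d + 14, d + 17, d + 18, d + 19, d + 31}"
  by (auto simp: WriteRep_def)

definition Analyze :: "nat \<Rightarrow> prog" where
  "Analyze d = block [MarkTor d, FindBasis d, FindCosets d, DivMod d, WriteRep d]"

lemma writes_Analyze [simp]: "writes (Analyze d) = {d + 3, d + 8, d + 9, d + 10, d + 13, d + 14, d + 15, d + 17,
    d + 18, d + 19, d + 31, d + 32, d + 33, d + 34, d + 35, d + 36, d + 37, d + 38, d + 39, d + 40}"
  by (auto simp: Analyze_def)

context cayley_tor begin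

text \<open>The hypotheses of \<open>split_ext_quotient_rep\<close> with the basis, the
  representatives and the numbering hidden: these depend on the contents of the memory, and only the
  representation leaves the program.\<close>

definition quotient_data :: "rep \<Rightarrow> bool" where
  "quotient_data R \<longleftrightarrow> (\<exists>m b pos h r c. R = quotient_rep G p m b pos h r c
    \<and> (\<forall>k<m. b k \<in> tor G p)
    \<and> (\<forall>y\<in>tor G p. pos y < p ^ m \<and> lin G b (\<lambda>k. pos y div p ^ k mod p) m = y)
    \<and> inj_on (\<lambda>i. lin G b (\<lambda>k. i div p ^ k mod p) m) {..<p ^ m}
    \<and> (\<forall>i<h. r i \<in> carrier G \<and> c (r i) = i) \<and> (\<forall>x\<in>carrier G. c x < h)
    \<and> (\<forall>x\<in>carrier G. \<forall>y\<in>carrier G. c x = c y \<longleftrightarrow> x \<otimes> inv y \<in> tor G p))"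

lemma split_ext_of_quotient_data:
  assumes "quotient_data R" and "Coprime ElemAb ElemAb G" "prime q" "p \<noteq> q"
    and "\<And>x. x \<in> carrier G \<Longrightarrow> x [^] q \<in> tor G p"
  shows "\<exists>E c s. split_ext G p q R E c s"
proof -
  obtain m b pos h r c where R: "R = quotient_rep G p m b pos h r c" and
    *: "\<forall>k<m. b k \<in> tor G p"
    "\<forall>y\<in>tor G p. pos y < p ^ m \<and> lin G b (\<lambda>k. pos y div p ^ k mod p) m = y"
    "inj_on (\<lambda>i. lin G b (\<lambda>k. i div p ^ k mod p) m) {..<p ^ m}"
    "\<forall>i<h. r i \<in> carrier G \<and> c (r i) = i" "\<forall>x\<in>carrier G. c x < h"
    "\<forall>x\<in>carrier G. \<forall>y\<in>carrier G. c x = c y \<longleftrightarrow> x \<otimes> inv y \<in> tor G p"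
    using assms(1) unfolding quotient_data_def by (elim exE conjE) (rule that)
  have "\<exists>E s. split_ext G p q (quotient_rep G p m b pos h r c) E c s"
    by (rule split_ext_quotient_rep) (use assms p closed * in auto)
  then show ?thesis unfolding R by metis
qed

lemma quotient_data_of_memory:
  assumes b: "basis M d m" and span: "\<forall>y\<in>tor G p. y \<in> comb (M (d + 36)) m ` {..<p ^ m}"
    and h: "cosets M d h" and cover: "\<forall>y<n. \<exists>i<h. y \<otimes> inv (M (d + 39) i) \<in> tor G p"
  shows "quotient_data (quotient_rep G p m (M (d + 36)) (M (d + 35)) h (M (d + 39)) (M (d + 38)))" "m \<le> n" "h \<le> n"
proof -
  let ?r = "M (d + 39)" and ?c = "M (d + 38)"
  note b' = b[unfolded basis_def] and h' = h[unfolded cosets_def]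
  have rG: "?r i \<in> carrier G" if "i < h" for i using h' that by (simp add: in_G)
  have c: "?c y = i" if "i < h" "y \<in> carrier G" "y \<otimes> inv (?r i) \<in> tor G p" for i y
    using h' that by (simp add: in_G)
  have one: "\<one> \<in> tor G p" by (simp add: tor_def)
  have tor_inv: "inv z \<in> tor G p" if "z \<in> tor G p" for z using that by (simp add: tor_def nat_pow_inv)
  have c_coset: "?c y < h \<and> y \<otimes> inv (?r (?c y)) \<in> tor G p" if y: "y \<in> carrier G" for y
  proof -
    obtain i where "i < h" "y \<otimes> inv (?r i) \<in> tor G p" using cover y by (auto simp: in_G)
    then show ?thesis using c[of i y] y by simp
  qed
  have cr: "?c (?r i) = i" if "i < h" for i using c[OF that rG[OF that]] rG[OF that] one by simp
  have c_eq: "?c x = ?c y \<longleftrightarrow> x \<otimes> inv y \<in> tor G p" if x: "x \<in> carrier G" and y: "y \<in> carrier G" for x y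
  proof
    assume eq: "?c x = ?c y"
    let ?z = "?r (?c y)"
    have z: "?z \<in> carrier G" using rG c_coset[OF y] by blast
    have "inv ?z \<otimes> (?z \<otimes> inv y) = inv y" using z y by (simp flip: m_assoc)
    then have "x \<otimes> inv y = (x \<otimes> inv ?z) \<otimes> inv (y \<otimes> inv ?z)"
      using x y z by (simp add: m_assoc inv_mult_group)
    then show "x \<otimes> inv y \<in> tor G p" using closed[OF _ tor_inv] c_coset[OF x] c_coset[OF y] eq by simp
  next
    assume xy: "x \<otimes> inv y \<in> tor G p"
    let ?z = "?r (?c y)"
    have z: "?z \<in> carrier G" using rG c_coset[OF y] by blast
    have "inv y \<otimes> (y \<otimes> inv ?z) = inv ?z" using z y by (simp flip: m_assoc)
    then have "x \<otimes> inv ?z = (x \<otimes> inv y) \<otimes> (y \<otimes> inv ?z)" using x y z by (simp add: m_assoc)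
    then have "x \<otimes> inv ?z \<in> tor G p" using closed[OF xy] c_coset[OF y] by simp
    then show "?c x = ?c y" using c c_coset[OF y] x by blast
  qed
  have pos: "M (d + 35) y < p ^ m \<and> lin G (M (d + 36)) (\<lambda>k. M (d + 35) y div p ^ k mod p) m = y" if y: "y \<in> tor G p" for y
  proof -
    obtain i where i: "y = comb (M (d + 36)) m i" "i \<in> {..<p ^ m}" using bspec[OF span y] by (rule imageE)
    then have "M (d + 35) y = i" using b' by simp
    then show ?thesis using i by (simp add: comb_def)
  qed
  show "quotient_data (quotient_rep G p m (M (d + 36)) (M (d + 35)) h ?r ?c)"
    unfolding quotient_data_def
    by (rule exI[of _ m], rule exI[of _ "M (d + 36)"], rule exI[of _ "M (d + 35)"], rule exI[of _ h],
        rule exI[of _ ?r], rule exI[of _ ?c])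
      (use b' pos rG cr c_coset c_eq in \<open>simp add: comb_def[abs_def]\<close>)
  have "inj_on ?r {..<h}" by (rule inj_on_inverseI[of _ ?c]) (use cr in simp)
  moreover have "?r ` {..<h} \<subseteq> {..<n}" using h' by auto
  ultimately have "card {..<h} \<le> card {..<n}" by (intro card_inj_on_le) auto
  then show "h \<le> n" by simp
  have "p ^ m \<le> n" by (rule card_basis_le[of m "M (d + 36)"]) (use b' in auto)
  moreover have "m < p ^ m" using p1 by (simp add: power_gt_expt)
  ultimately show "m \<le> n" by simp
qed

lemma wp_WriteRep:
  assumes L: "loaded M d" and n: "n \<le> B" and b: "basis M d m"
    and span: "\<forall>y\<in>tor G p. y \<in> comb (M (d + 36)) m ` {..<p ^ m}"
    and h: "cosets M d h" and cover: "\<forall>y<n. \<exists>i<h. y \<otimes> inv (M (d + 39) i) \<in> tor G p"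
    and dm: "\<forall>v<p ^ m. M (d + 9) v = v div p \<and> M (d + 10) v = v mod p"
    and Q: "\<And>M' R. \<forall>a. a \<notin> writes (WriteRep d) \<longrightarrow> M' a = M a \<Longrightarrow> quotient_data R
      \<Longrightarrow> Q M' (out @ encode_rep R)"
  shows "wp B (WriteRep d) Q M out"
proof -
  let ?b = "M (d + 36)" and ?pos = "M (d + 35)" and ?r = "M (d + 39)" and ?c = "M (d + 38)"
  let ?R = "quotient_rep G p m ?b ?pos h ?r ?c"
  note qd = quotient_data_of_memory[OF b span h cover]
  note b' = b[unfolded basis_def] and h' = h[unfolded cosets_def]
  have r: "?r i < n" if "i < h" for i using h' that by blast
  have bt: "?b j \<in> tor G p" if "j < m" for j using b' that by blast
  let ?y = "\<lambda>i j. ?r i \<otimes> ?b j \<otimes> inv (?r i)"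
  \<comment> \<open>Conjugates of torsion elements are torsion and hence occur in the enumeration,
    so their positions are within the division table.\<close>
  have pos: "?pos (?y i j) < p ^ m" if "i < h" "j < m" for i j
  proof -
    have "?y i j \<in> tor G p" using r[OF that(1)] bt[OF that(2)] by (intro conj_tor) (simp_all add: in_G)
    from bspec[OF span this] obtain l where "?y i j = comb ?b m l" "l \<in> {..<p ^ m}" by (rule imageE)
    then show ?thesis using b' by simp
  qed
  have enc: "encode_rep ?R = [m, h] @ concat (map (\<lambda>i. concat (map (\<lambda>j. [?c (?r i \<otimes> ?r j)]) [0..<h])) [0..<h])
    @ concat (map (\<lambda>i. concat (map (\<lambda>a. concat (map (\<lambda>j. [?pos (?y i j) div p ^ a mod p]) [0..<m])) [0..<m])) [0..<h])"
    by (simp add: encode_rep_def quotient_rep_def mat_entries_altdef concat_map_singleton comp_def)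
      (intro arg_cong2[where f = "(@)"] arg_cong[where f = concat] map_cong refl; simp)
  let ?fr = "\<lambda>M'. \<forall>a. a \<notin> writes (WriteRep d) \<longrightarrow> M' a = M a"
  show ?thesis
    unfolding WriteRep_def block.simps wp.simps
  proof (rule wp_For_emit[where n = h and f = "\<lambda>i. concat (map (\<lambda>j. [?c (?r i \<otimes> ?r j)]) [0..<h])"], goal_cases)
    case (5 i M1 o1)
    show ?case
    proof (rule wp_For_emit[where n = h and f = "\<lambda>j. [?c (?r i \<otimes> ?r j)]"], goal_cases)
      case (5 j M2 o2)
      have fr: "M2 a = M a" if "a \<notin> {d + 17, d + 18}" for a using 5(2) \<open>\<forall>a. _ \<longrightarrow> M1 a = M a\<close> that by simp
      have L2: "loaded M2 d" by (rule loaded_frame[OF L]) (use fr in auto)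
      have "M2 (d + 17) 0 = i" using 5(2) \<open>M1 (d + 17) 0 = i\<close> by simp
      then have "eval M2 (mulE d (Get (d + 39) (V (d + 17))) (Get (d + 39) (V (d + 18)))) = ?r i \<otimes> ?r j"
        by (intro eval_mulE[OF L2]) (use 5(3) fr r \<open>i < h\<close> \<open>j < h\<close> in auto)
      then show ?case using fr by simp
    qed (use 5 h' n qd in auto)
  next
    case (6 M1)
    show ?case
      unfolding wp.simps
    proof (rule wp_For_emit[where n = h and f = "\<lambda>i. concat (map (\<lambda>a. concat (map (\<lambda>j. [?pos (?y i j) div p ^ a mod p]) [0..<m])) [0..<m])"], goal_cases)
      case (5 i M2 o2)
      have fr2: "M2 a = M a" if "a \<notin> {d + 14, d + 17, d + 18, d + 19, d + 31}" for a using 5(2) 6 that by simp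
      show ?case
      proof (rule wp_For_emit[where n = m and f = "\<lambda>a. concat (map (\<lambda>j. [?pos (?y i j) div p ^ a mod p]) [0..<m])"], goal_cases)
        case (5 a M3 o3)
        have fr3: "M3 a = M a" if "a \<notin> {d + 14, d + 17, d + 18, d + 19, d + 31}" for a using 5(2) fr2 that by simp
        have i3: "M3 (d + 17) 0 = i" using 5(2) \<open>M2 (d + 17) 0 = i\<close> by simp
        show ?case
        proof (rule wp_For_emit[where n = m and f = "\<lambda>j. [?pos (?y i j) div p ^ a mod p]"], goal_cases)
          case (5 j M4 o4)
          have fr4: "M4 a = M a" if "a \<notin> {d + 14, d + 17, d + 18, d + 19, d + 31}" for a using 5(2) fr3 that by simp
          have i4: "M4 (d + 17) 0 = i" "M4 (d + 18) 0 = a" "M4 (d + 19) 0 = j"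
            using 5(2,3) i3 \<open>M3 (d + 18) 0 = a\<close> by simp_all
          have L4: "loaded M4 d" by (rule loaded_frame[OF L]) (use fr4 in auto)
          have bj: "?b j < n" using tor_less bt[OF 5(1)] by blast
          have ri: "?r i < n" by (rule r) fact
          have "eval M4 (mulE d (Get (d + 39) (V (d + 17))) (Get (d + 36) (V (d + 19)))) = ?r i \<otimes> ?b j"
            by (rule eval_mulE[OF L4]) (use fr4 i4 ri bj in auto)
          moreover have "eval M4 (Get (d + 28) (Get (d + 39) (V (d + 17)))) = inv (?r i)"
            using L4 fr4 i4 ri by (simp add: loaded_def)
          ultimately have y: "eval M4 (mulE d (mulE d (Get (d + 39) (V (d + 17))) (Get (d + 36) (V (d + 19))))
              (Get (d + 28) (Get (d + 39) (V (d + 17))))) = ?y i j"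
            by (rule eval_mulE[OF L4]) (use mult_less inv_less ri bj in auto)
          let ?v = "?pos (?y i j)"
          have v: "?v < p ^ m" using pos \<open>i < h\<close> \<open>j < m\<close> by blast
          show ?case
            unfolding block.simps wp.simps
          proof (rule wp_For[where n = a and I = "\<lambda>k M' o'. M' (d + 31) 0 = ?v div p ^ k \<and> o' = o4"], goal_cases)
            case 4 show ?case using \<open>a < m\<close> qd(2) n by linarith
          next
            case 5 show ?case using y fr4 by simp
          next
            case (6 k M5 o5)
            have "?v div p ^ k < p ^ m" using v by (meson div_le_dividend order.strict_trans1)
            moreover have "?v div p ^ k div p = ?v div p ^ Suc k" by (metis div_mult2_eq power_Suc2)
            moreover have "M5 (d + 9) = M (d + 9)" using 6(2) fr4 by simp
            ultimately show ?case using 6(4) dm by simp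
          next
            case (7 M5 o5)
            have "?v div p ^ a < p ^ m" using v by (meson div_le_dividend order.strict_trans1)
            moreover have "M5 (d + 10) = M (d + 10)" using 7(1) fr4 by simp
            ultimately show ?case using 7(2) dm by simp
          qed (use i4 in auto)
        qed (use fr3 b' n qd in auto)
      qed (use fr2 b' n qd in auto)
    next
      case (6 M2)
      have "?fr M2" using 6 \<open>\<forall>a. _ \<longrightarrow> M1 a = M a\<close> by simp
      from Q[OF this qd(1)] show ?case unfolding enc using b' h' by simp
    qed (use 6 h' n qd in auto)
  qed (use h' n qd in auto)
qed

text \<open>The marks in \<open>d + 34\<close> and \<open>d + 37\<close> are tested before the
  program sets them, and the division tables are built up from their entry 0; hence the initial
  zeros. The search for the primes leaves these arrays alone.\<close>

lemma wp_Analyze: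
  assumes L: "loaded M d" and n: "n \<le> B" and p': "M (d + 1) 0 = p" "p \<le> B"
    and z: "M (d + 9) = (\<lambda>_. 0)" "M (d + 10) = (\<lambda>_. 0)" "M (d + 34) = (\<lambda>_. 0)" "M (d + 37) = (\<lambda>_. 0)"
    and Q: "\<And>M' R. \<forall>a. a \<notin> writes (Analyze d) \<longrightarrow> M' a = M a \<Longrightarrow> quotient_data R
      \<Longrightarrow> Q M' (out @ encode_rep R)"
  shows "wp B (Analyze d) Q M out"
  unfolding Analyze_def block.simps wp.simps
proof (rule wp_MarkTor[OF L p' n], goal_cases)
  case (1 M1)
  have L1: "loaded M1 d" by (rule loaded_frame[OF L]) (use 1(1) in auto)
  show ?case
    unfolding wp.simps
  proof (rule wp_FindBasis[OF L1 n _ 1(2)], goal_cases)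
    case (3 M2 m)
    have L2: "loaded M2 d" by (rule loaded_frame[OF L1]) (use 3(1) in auto)
    note b' = 3(2)[unfolded basis_def]
    have pm: "p ^ m \<le> n" by (rule card_basis_le[of m "M2 (d + 36)"]) (use b' in auto)
    have E: "M2 (d + 33) i \<in> tor G p" if "i < p ^ m" for i
    proof -
      have "comb (M2 (d + 36)) m i \<in> tor G p" by (rule comb_tor) (use b' in auto)
      then show ?thesis using b' that by metis
    qed
    have E': "\<exists>i<p ^ m. M2 (d + 33) i = y" if "y \<in> tor G p" for y
      using 3(3) b' that by (metis imageE lessThan_iff)
    show ?case
      unfolding wp.simps
    proof (rule wp_FindCosets[OF L2 n, where s = "p ^ m"], goal_cases)
      case (6 M3 h)
      have L3: "loaded M3 d" by (rule loaded_frame[OF L2]) (use 6(1) in auto)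
      have b3: "basis M3 d m" by (rule basis_frame[OF 3(2)]) (use 6(1) in auto)
      show ?case
        unfolding wp.simps
      proof (rule wp_DivMod[where p = p and s = "p ^ m"], goal_cases)
        case (7 M4)
        have L4: "loaded M4 d" by (rule loaded_frame[OF L3]) (use 7(1) in auto)
        have b4: "basis M4 d m" by (rule basis_frame[OF b3]) (use 7(1) in auto)
        have c4: "cosets M4 d h" by (rule cosets_frame[OF 6(2)]) (use 7(1) in auto)
        show ?case
          unfolding wp.simps
        proof (rule wp_WriteRep[OF L4 n b4 _ c4 _ 7(2)], goal_cases)
          case (3 M5 R)
          have "\<forall>a. a \<notin> writes (Analyze d) \<longrightarrow> M5 a = M a"
            using 3(1) 7(1) 6(1) 1(1) \<open>\<forall>a. a \<notin> writes (FindBasis d) \<longrightarrow> M2 a = M1 a\<close> by simp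
          then show ?case using Q 3(2) by simp
        qed (use 7(1) 6(1,3) 3(3) in auto)
      qed (use 6(1) 3(1) 1(1) p' z p1 b3 pm n in \<open>auto simp: basis_def\<close>)
    qed (use E E' b' pm n 3(1) 1(1) z in auto)
  qed (use 1(1) p' z in auto)
qed

end

text \<open>Torsion elements times elements of the complement are pairwise distinct. This bounds the
  size of the produced instance by the orders of the given groups.\<close>

lemma (in split_ext) card_le: "p ^ rep_dim R * Coset.order (table_group (grp R)) \<le> card (carrier G)"
proof -
  let ?f = "\<lambda>(v, h). E v \<otimes>\<^bsub>G\<^esub> s h"
  have c_f: "c (E v \<otimes>\<^bsub>G\<^esub> s h) = h" if "v \<in> W" "h \<in> carrier H" for v h
    using that c_one[of "E v"] E_tor E_closed c_s by simp
  have "inj_on ?f (W \<times> carrier H)"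
  proof (rule inj_onI)
    fix x y assume xy: "x \<in> W \<times> carrier H" "y \<in> W \<times> carrier H" and eq: "?f x = ?f y"
    obtain v h w k where e: "x = (v, h)" "y = (w, k)" by (cases x; cases y)
    have i: "v \<in> W" "h \<in> carrier H" "w \<in> W" "k \<in> carrier H" using xy by (simp_all add: e)
    have "h = k" using c_f[of v h] c_f[of w k] i eq by (simp add: e)
    moreover have "E v = E w" using eq i E_closed \<open>h = k\<close> by (simp add: e)
    ultimately show "x = y" using E_inj i by (simp add: e)
  qed
  moreover have "?f ` (W \<times> carrier H) \<subseteq> carrier G"
  proof (rule image_subsetI)
    fix x assume "x \<in> W \<times> carrier H"
    then show "?f x \<in> carrier G" using E_closed by (cases x) simp
  qed
  ultimately have "card (W \<times> carrier H) \<le> card (carrier G)" using finite by (rule card_inj_on_le)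
  moreover have "card W = p ^ m" using bij_betw_same_card[OF vec_code_bij[OF p_pos]] by simp
  ultimately show ?thesis by (simp add: card_cartesian_product Coset.order_def)
qed

text \<open>The exponent condition passes to images directly. Closedness requires torsion elements
  to have torsion preimages, which \<open>epi_tor_surj\<close> provides.\<close>

lemma epi_tor:
  assumes G1: "group G1" and G2: "group G2" and f: "f \<in> epi G1 G2" and pq: "coprime q p" "p > 1"
    and closed: "\<And>x y. x \<in> tor G1 p \<Longrightarrow> y \<in> tor G1 p \<Longrightarrow> x \<otimes>\<^bsub>G1\<^esub> y \<in> tor G1 p"
    and expo: "\<And>x. x \<in> carrier G1 \<Longrightarrow> x [^]\<^bsub>G1\<^esub> q \<in> tor G1 p"
  shows "\<And>y z. y \<in> tor G2 p \<Longrightarrow> z \<in> tor G2 p \<Longrightarrow> y \<otimes>\<^bsub>G2\<^esub> z \<in> tor G2 p"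
    and "\<And>y. y \<in> carrier G2 \<Longrightarrow> y [^]\<^bsub>G2\<^esub> q \<in> tor G2 p"
proof -
  have hom: "f \<in> hom G1 G2" and surj: "f ` carrier G1 = carrier G2" using f by (simp_all add: epi_def)
  interpret f: group_hom G1 G2 f using G1 G2 hom by (simp add: group_hom_def group_hom_axioms_def)
  have f_tor: "f x \<in> tor G2 p" if "x \<in> tor G1 p" for x
    using that f.hom_nat_pow[of x p] by (auto simp: tor_def)
  have pre: "\<exists>x\<in>carrier G1. f x = y" if "y \<in> carrier G2" for y using surj that by (metis imageE)
  show expo2: "y [^]\<^bsub>G2\<^esub> q \<in> tor G2 p" if y: "y \<in> carrier G2" for y
  proof -
    obtain x where x: "x \<in> carrier G1" "f x = y" using pre[OF y] by metis
    then show ?thesis using f_tor[OF expo[OF x(1)]] by (simp add: f.hom_nat_pow)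
  qed
  have lift: "\<exists>x\<in>tor G1 p. f x = y" if "y \<in> tor G2 p" for y
    by (rule epi_tor_surj[OF G1 G2 f pq _ that]) (rule expo)
  show "y \<otimes>\<^bsub>G2\<^esub> z \<in> tor G2 p" if yz: "y \<in> tor G2 p" "z \<in> tor G2 p" for y z
  proof -
    obtain u where u: "u \<in> tor G1 p" "f u = y" using lift[OF yz(1)] by metis
    obtain v where v: "v \<in> tor G1 p" "f v = z" using lift[OF yz(2)] by metis
    have "f (u \<otimes>\<^bsub>G1\<^esub> v) \<in> tor G2 p" using f_tor[OF closed[OF u(1) v(1)]] .
    then show ?thesis using u v by (simp add: tor_def)
  qed
qed

section \<open>Primes and the search for a common pair\<close>

definition Sieve :: prog where
  "Sieve = For 3 (V 1) (block
    [Assign 4 (Add (Add (V 3) (V 3)) (Const 4)),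
     For 5 (V 1) (block [Put 6 (V 4) (Const 1), Assign 4 (Add (V 4) (Add (V 3) (Const 2)))])])"

lemma writes_Sieve [simp]: "writes Sieve = {3, 4, 5, 6}"
  by (auto simp: Sieve_def)

text \<open>A composite number has two factors that are at least 2 and at most the number itself;
  the shift by 2 lets the loop counters start from 0.\<close>

lemma prime_iff_not_product:
  fixes k L :: nat
  assumes "2 \<le> k" "k < L"
  shows "prime k \<longleftrightarrow> \<not> (\<exists>a<L. \<exists>b<L. k = (a + 2) * (b + 2))"
proof
  assume k: "prime k"
  show "\<not> (\<exists>a<L. \<exists>b<L. k = (a + 2) * (b + 2))"
  proof
    assume "\<exists>a<L. \<exists>b<L. k = (a + 2) * (b + 2)"
    then obtain a b where ab: "k = (a + 2) * (b + 2)" by blast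
    then have "a + 2 dvd k" by (rule dvdI)
    then have "a + 2 = k" using k unfolding prime_nat_iff by fastforce
    then show False using ab by simp
  qed
next
  assume *: "\<not> (\<exists>a<L. \<exists>b<L. k = (a + 2) * (b + 2))"
  show "prime k"
    unfolding prime_nat_iff
  proof (intro conjI allI impI)
    fix m assume "m dvd k"
    then obtain l where l: "k = m * l" by blast
    show "m = 1 \<or> m = k"
    proof (rule ccontr)
      assume "\<not> (m = 1 \<or> m = k)"
      then have ml: "2 \<le> m" "2 \<le> l" using l assms(1) by (cases m; cases l; auto)+
      then have "m \<le> k" "l \<le> k" using l by auto
      then have "m - 2 < L" "l - 2 < L" using assms(2) by linarith+
      moreover have "k = ((m - 2) + 2) * ((l - 2) + 2)" using ml by (simp only: l le_add_diff_inverse2)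
      ultimately show False using * by blast
    qed
  qed (use assms in simp)
qed

text \<open>For each \<open>a\<close> the multiples of \<open>a + 2\<close> are marked, beginning
  with \<open>a + a + 4\<close>, twice this number. Marks beyond \<open>L\<close> do no harm, and 0
  and 1 stay unmarked.\<close>

lemma wp_Sieve:
  assumes L: "M 1 0 = L" "L \<le> B" and z: "M 6 = (\<lambda>_. 0)"
    and Q: "\<And>M'. \<forall>a. a \<notin> writes Sieve \<longrightarrow> M' a = M a
      \<Longrightarrow> \<forall>k<L. 2 \<le> k \<longrightarrow> (M' 6 k = 0 \<longleftrightarrow> prime k) \<Longrightarrow> Q M' out"
  shows "wp B Sieve Q M out"
  unfolding Sieve_def
proof (rule wp_For[where n = L and I = "\<lambda>a M' o'. (\<forall>k. M' 6 k = 0 \<longleftrightarrow> \<not> (\<exists>a'<a. \<exists>b<L. k = (a' + 2) * (b + 2))) \<and> o' = out"], goal_cases)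
  case (6 a M1 o1)
  show ?case
    unfolding block.simps wp.simps
  proof (rule wp_For[where n = L and I = "\<lambda>b M' o'. (\<forall>k. M' 6 k = 0 \<longleftrightarrow>
      \<not> ((\<exists>a'<a. \<exists>b<L. k = (a' + 2) * (b + 2)) \<or> (\<exists>b'<b. k = (a + 2) * (b' + 2))))
      \<and> M' 4 0 = (a + 2) * (b + 2) \<and> o' = out"], goal_cases)
    case (6 b M2 o2)
    have "M2 3 0 = a" using 6(2) \<open>M1 3 0 = a\<close> by simp
    then show ?case using 6(4) by (auto simp: less_Suc_eq)
  next
    case (7 M2 o2)
    have "(\<exists>a'<Suc a. \<exists>b<L. k = (a' + 2) * (b + 2)) \<longleftrightarrow>
      (\<exists>a'<a. \<exists>b<L. k = (a' + 2) * (b + 2)) \<or> (\<exists>b'<L. k = (a + 2) * (b' + 2))" for k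
      by (auto simp: less_Suc_eq)
    then show ?case using 7(2) by simp
  qed (use 6 L in auto)
next
  case (7 M1 o1)
  then show ?case using prime_iff_not_product[of _ L] Q[of M1] by simp
qed (use L z in auto)

definition TestTor :: prog where
  "TestTor = block
    [Assign 101 (V 7), Assign 130 (V 8), MarkTor 100, CheckTor 100,
     Assign 201 (V 7), Assign 230 (V 8), MarkTor 200, CheckTor 200,
     IfEq (V 129) (Const 1) (IfEq (V 229) (Const 1) (block [Assign 9 (V 7), Assign 10 (V 8)]) Skip) Skip]"

lemma writes_TestTor [simp]: "writes TestTor = {9, 10, 101, 114, 117, 118, 129, 130, 131, 132,
    201, 214, 217, 218, 229, 230, 231, 232}"
  by (auto simp: TestTor_def)

text \<open>The search runs through all pairs and keeps the last suitable one; 0 in cell 9 signals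
  that there was none, 0 being no prime. The comparisons with 1 reject 0 and 1, which the sieve does
  not mark.\<close>

definition SearchPrimes :: prog where
  "SearchPrimes = For 7 (V 1) (For 8 (V 1)
    (Cond (Const 1) (V 7) (Cond (Const 1) (V 8) (IfEq (V 7) (V 8) Skip
      (IfEq (Get 6 (V 7)) (Const 0) (IfEq (Get 6 (V 8)) (Const 0) TestTor Skip) Skip)) Skip) Skip))"

lemma writes_SearchPrimes [simp]: "writes SearchPrimes = insert 7 (insert 8 (writes TestTor))"
  by (auto simp: SearchPrimes_def)

locale cayley_pair = A: cayley G1 T1 + B: cayley G2 T2
  for G1 :: "nat monoid" and T1 :: "nat mat" and G2 :: "nat monoid" and T2 :: "nat mat"
begin

definition good :: "nat \<Rightarrow> nat \<Rightarrow> bool" where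
  "good p q \<longleftrightarrow> prime p \<and> prime q \<and> p \<noteq> q \<and> A.tor_ok p q \<and> B.tor_ok p q"

lemma wp_TestTor:
  assumes L1: "A.loaded M 100" and L2: "B.loaded M 200" and n: "A.n \<le> B" "B.n \<le> B"
    and p: "M 7 0 = p" "p \<le> B" and q: "M 8 0 = q" "q \<le> B"
    and Q: "\<And>M'. \<forall>a. a \<notin> writes TestTor \<longrightarrow> M' a = M a
      \<Longrightarrow> if A.tor_ok p q \<and> B.tor_ok p q then M' 9 0 = p \<and> M' 10 0 = q else M' 9 = M 9 \<and> M' 10 = M 10 \<Longrightarrow> Q M' out"
  shows "wp B TestTor Q M out"
  unfolding TestTor_def block.simps wp.simps
proof (rule A.wp_MarkTor[where p = p], goal_cases)
  case (5 M1)
  have L1': "A.loaded M1 100" by (rule A.loaded_frame[OF L1]) (use 5(1) in auto)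
  have L1'': "B.loaded M1 200" by (rule B.loaded_frame[OF L2]) (use 5(1) in auto)
  show ?case
    unfolding wp.simps
  proof (rule A.wp_CheckTor[OF L1', where q = q and p = p], goal_cases)
    case (5 M2)
    have L2': "B.loaded M2 200" by (rule B.loaded_frame[OF L1'']) (use 5(1) in auto)
    have fr2: "M2 7 = M 7" "M2 8 = M 8" "M2 9 = M 9" "M2 10 = M 10"
      using 5(1) \<open>\<forall>a. a \<notin> writes (MarkTor 100) \<longrightarrow> _ a\<close> by simp_all
    show ?case
      unfolding wp.simps
    proof (rule B.wp_MarkTor[where p = p], goal_cases)
      case (5 M3)
      have L3: "B.loaded M3 200" by (rule B.loaded_frame[OF L2']) (use 5(1) in auto)
      show ?case
        unfolding wp.simps
      proof (rule B.wp_CheckTor[OF L3, where q = q and p = p], goal_cases)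
        case (5 M4)
        have fr: "\<forall>a. a \<notin> writes TestTor \<longrightarrow> M4 a = M a"
          using 5(1) \<open>\<forall>a. a \<notin> writes (MarkTor 200) \<longrightarrow> _ a\<close> \<open>\<forall>a. a \<notin> writes (CheckTor 100) \<longrightarrow> _ a\<close>
            \<open>\<forall>a. a \<notin> writes (MarkTor 100) \<longrightarrow> _ a\<close> by simp
        have v: "M4 129 0 = (if A.tor_ok p q then 1 else 0)" "M4 229 0 = (if B.tor_ok p q then 1 else 0)"
          "M4 7 0 = p" "M4 8 0 = q" "M4 9 = M 9" "M4 10 = M 10"
          using 5 \<open>\<forall>a. a \<notin> writes (MarkTor 200) \<longrightarrow> _ a\<close> \<open>M2 (100 + 29) 0 = _\<close> fr2 p q by simp_all
        show ?case
        proof (cases "A.tor_ok p q \<and> B.tor_ok p q")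
          case True
          then show ?thesis using v Q[of "M4(9 := (M4 9)(0 := p), 10 := (M4 10)(0 := q))"] fr by simp
        next
          case False
          then show ?thesis using v Q[of M4] fr by auto
        qed
      qed (use 5 fr2 p q n in auto)
    qed (use 5 fr2 p q n L2' in \<open>auto simp: B.loaded_def\<close>)
  qed (use 5 p q n in auto)
qed (use L1 p q n in \<open>auto simp: A.loaded_def\<close>)

lemma wp_SearchPrimes:
  assumes L1: "A.loaded M 100" and L2: "B.loaded M 200" and n: "A.n \<le> B" "B.n \<le> B"
    and L: "M 1 0 = L" "L \<le> B" and z: "M 9 0 = 0" and sieve: "\<forall>k<L. 2 \<le> k \<longrightarrow> (M 6 k = 0 \<longleftrightarrow> prime k)"
    and Q: "\<And>M'. \<forall>a. a \<notin> writes SearchPrimes \<longrightarrow> M' a = M a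
      \<Longrightarrow> (M' 9 0 = 0 \<and> (\<forall>p<L. \<forall>q<L. \<not> good p q)) \<or> (good (M' 9 0) (M' 10 0) \<and> M' 9 0 < L) \<Longrightarrow> Q M' out"
  shows "wp B SearchPrimes Q M out"
  unfolding SearchPrimes_def
proof (rule wp_For[where n = L and I = "\<lambda>k M' o'. ((M' 9 0 = 0 \<and> (\<forall>p<k. \<forall>q<L. \<not> good p q))
      \<or> (good (M' 9 0) (M' 10 0) \<and> M' 9 0 < L)) \<and> o' = out"], goal_cases)
  case (6 p M1 o1)
  show ?case
  proof (rule wp_For[where n = L and I = "\<lambda>k M' o'. ((M' 9 0 = 0 \<and> (\<forall>p'<p. \<forall>q<L. \<not> good p' q) \<and> (\<forall>q<k. \<not> good p q))
      \<or> (good (M' 9 0) (M' 10 0) \<and> M' 9 0 < L)) \<and> o' = out"], goal_cases)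
    case (6 q M2 o2)
    have fr: "M2 a = M a" if "a \<notin> writes SearchPrimes" for a
      using 6(2) \<open>\<forall>a. _ \<longrightarrow> M1 a = M a\<close> that by simp
    have v: "M2 7 0 = p" "M2 8 0 = q" using 6(2,3) \<open>M1 7 0 = p\<close> by simp_all
    have sp: "M2 6 p = 0 \<longleftrightarrow> prime p" if "2 \<le> p" using sieve fr \<open>p < L\<close> that by simp
    have sq: "M2 6 q = 0 \<longleftrightarrow> prime q" if "2 \<le> q" using sieve fr \<open>q < L\<close> that by simp
    have L1': "A.loaded M2 100" by (rule A.loaded_frame[OF L1]) (use fr in auto)
    have L2': "B.loaded M2 200" by (rule B.loaded_frame[OF L2]) (use fr in auto)
    let ?Q = "\<lambda>M'' o''. ((M'' 9 0 = 0 \<and> (\<forall>p'<p. \<forall>q<L. \<not> good p' q) \<and> (\<forall>q'<Suc q. \<not> good p q'))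
      \<or> (good (M'' 9 0) (M'' 10 0) \<and> M'' 9 0 < L)) \<and> o'' = out"
    have test: "wp B TestTor ?Q M2 o2" if "prime p" "prime q" "p \<noteq> q"
    proof (rule wp_TestTor[OF L1' L2' n v(1) _ v(2)], goal_cases)
      case (3 M')
      show ?case
      proof (cases "A.tor_ok p q \<and> B.tor_ok p q")
        case True
        then show ?thesis using 3(2) that \<open>p < L\<close> \<open>_ \<and> o2 = out\<close> by (simp add: good_def)
      next
        case False
        then have "\<not> good p q" by (auto simp: good_def)
        then show ?thesis using 3(2) False \<open>_ \<and> o2 = out\<close> by (auto simp: less_Suc_eq)
      qed
    qed (use \<open>p < L\<close> \<open>q < L\<close> L in auto)
    have skip: "?Q M2 o2" if "\<not> (prime p \<and> prime q \<and> p \<noteq> q)"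
      using that 6(4) by (auto simp: good_def less_Suc_eq)
    have np: "\<not> prime p" if "\<not> 1 < p" using that prime_gt_1_nat by blast
    have nq: "\<not> prime q" if "\<not> 1 < q" using that prime_gt_1_nat by blast
    have "wp B (Cond (Const 1) (V 7) (Cond (Const 1) (V 8) (IfEq (V 7) (V 8) Skip
      (IfEq (Get 6 (V 7)) (Const 0) (IfEq (Get 6 (V 8)) (Const 0) TestTor Skip) Skip)) Skip) Skip) ?Q M2 o2"
      unfolding wp.simps wp_IfEq eval.simps v
      using test skip np nq sp sq by (simp split del: if_split) (auto split: if_split)
    then show ?case by simp
  next
    case (7 M2 o2)
    then show ?case by (auto simp: less_Suc_eq)
  qed (use 6 L in auto)
next
  case (7 M1 o1)
  then show ?case using Q[of M1] by simp
qed (use L z in auto)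

end

text \<open>A fixed negative instance, the answer for pairs of groups without common primes: over
  trivial groups, a space of dimension 0 has to be mapped onto one of dimension 1.\<close>

definition no_instance :: rep_pair where
  "no_instance = (2, \<lparr>grp = mat 1 1 (\<lambda>_. 0), rep_dim = 0, rep_mats = [1\<^sub>m 0]\<rparr>,
    \<lparr>grp = mat 1 1 (\<lambda>_. 0), rep_dim = 1, rep_mats = [1\<^sub>m 1]\<rparr>)"

lemma encode_no_instance: "encode_rep_pair no_instance = [2, 0, 1, 0, 1, 1, 0, 1]"
  by (simp add: no_instance_def encode_rep_pair_def encode_rep_def mat_entries_altdef)

lemma size_no_instance: "rep_pair_size no_instance = 3"
  by (simp add: no_instance_def rep_pair_size_def Coset.order_def table_group_def)

lemma no_instance_valid: "rep_pair_valid no_instance"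
proof -
  let ?T = "mat 1 1 (\<lambda>_. 0) :: nat mat" and ?K = "\<lparr>carrier = {()}, monoid.mult = (\<lambda>_ _. ()), one = ()\<rparr>"
  have K: "group ?K" by (rule groupI) auto
  have T: "cayley_table ?T" "carrier (table_group ?T) = {..<1}" "\<one>\<^bsub>table_group ?T\<^esub> = 0"
    using cayley_table_of_surj[OF K, of ?T 1 "\<lambda>_. 0"] by auto
  then have grp: "group (table_group ?T)" by (simp add: cayley_table_def)
  \<comment> \<open>Any prime other than 2 may accompany the trivial group.\<close>
  have elem: "elementary_abelian 3 (table_group ?T)"
    unfolding elementary_abelian_def
  proof (intro conjI ballI)
    show "comm_group (table_group ?T)" using T(2) by (intro group.group_comm_groupI grp) simp
    fix x assume "x \<in> carrier (table_group ?T)"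
    then have "x = \<one>\<^bsub>table_group ?T\<^esub>" using T(2,3) by simp
    then show "x [^]\<^bsub>table_group ?T\<^esub> (3::nat) = \<one>\<^bsub>table_group ?T\<^esub>"
      using monoid.nat_pow_one[OF group.is_monoid[OF grp]] by simp
  qed (use T in simp_all)
  have "is_rep 2 \<lparr>grp = ?T, rep_dim = m, rep_mats = [1\<^sub>m m]\<rparr>" for m
  proof -
    have I: "mat_mod 2 (1\<^sub>m m) = (1\<^sub>m m :: nat mat)" by (intro eq_matI) auto
    have "(1\<^sub>m m :: nat mat) \<in> Zp_mat 2 m" by (auto simp: Zp_mat_def)
    then have "(1\<^sub>m m :: nat mat) \<in> carrier (GL m 2)"
      using I by (auto simp: GL_def intro!: bexI[of _ "1\<^sub>m m"])
    then show ?thesis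
      using T I by (auto simp: is_rep_def hom_def GL_def table_group_def)
  qed
  then show ?thesis
    using elem by (auto simp: rep_pair_valid_def no_instance_def intro!: exI[of _ 3])
qed

lemma no_instance_not_epivalent: "\<not> epivalent no_instance"
proof
  assume "epivalent no_instance"
  then obtain \<rho> where \<rho>: "\<rho> ` Zp_vec 2 0 = Zp_vec 2 1"
    by (auto simp: epivalent_def no_instance_def)
  have "Zp_vec 2 0 \<subseteq> {vNil}" by (auto simp: Zp_vec_def intro: eq_vecI)
  then have sub: "Zp_vec 2 1 \<subseteq> {\<rho> vNil}" unfolding \<rho>[symmetric] by auto
  have v: "vec 1 (\<lambda>_. 0) \<in> Zp_vec 2 1" "vec 1 (\<lambda>_. 1) \<in> Zp_vec 2 1" by (auto intro: Zp_vecI)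
  have "vec 1 (\<lambda>_. 0) = (vec 1 (\<lambda>_. 1) :: nat vec)"
    using singletonD[OF subsetD[OF sub v(1)]] singletonD[OF subsetD[OF sub v(2)]] by (rule trans[OF _ sym])
  then have "vec 1 (\<lambda>_. 0) $ 0 = (vec 1 (\<lambda>_. 1) :: nat vec) $ 0" by simp
  then show False by simp
qed

definition WriteNo :: prog where
  "WriteNo = block (map (\<lambda>k. Write (Const k)) [2, 0, 1, 0, 1, 1, 0, 1])"

text \<open>Cell 1 receives the limit for the primes. The tables follow the length of the input and
  the two orders, so the first one begins at address 3.\<close>

definition group_to_rep_prog :: prog where
  "group_to_rep_prog = block
    [Assign 1 (Add (Add (Get 0 (Const 1)) (Get 0 (Const 2))) (Const 4)),
     Assign 104 (Get 0 (Const 1)), Assign 112 (Const 3), LoadGroup 100,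
     Assign 204 (Get 0 (Const 2)), Assign 212 (V 112), LoadGroup 200, Sieve, SearchPrimes,
     IfEq (V 9) (Const 0) WriteNo (block
      [Write (V 9), Assign 101 (V 9), Analyze 100, Assign 201 (V 9), Analyze 200])]"

context cayley_pair begin

lemma cayley_tor_left:
  assumes "good p q" "\<And>x y. x \<in> tor G1 p \<Longrightarrow> y \<in> tor G1 p \<Longrightarrow> x \<otimes>\<^bsub>G1\<^esub> y = y \<otimes>\<^bsub>G1\<^esub> x"
  shows "cayley_tor G1 T1 p"
proof (intro cayley_tor.intro cayley_tor_axioms.intro A.cayley_axioms)
  fix x y assume "x \<in> tor G1 p" "y \<in> tor G1 p"
  moreover from this have "x < A.n" "y < A.n" by (simp_all add: tor_def A.in_G)
  ultimately show "x \<otimes>\<^bsub>G1\<^esub> y \<in> tor G1 p" using assms(1) by (simp add: good_def A.tor_ok_def)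
qed (use assms in \<open>auto simp: good_def\<close>)

lemma cayley_tor_right:
  assumes "good p q" "\<And>x y. x \<in> tor G2 p \<Longrightarrow> y \<in> tor G2 p \<Longrightarrow> x \<otimes>\<^bsub>G2\<^esub> y = y \<otimes>\<^bsub>G2\<^esub> x"
  shows "cayley_tor G2 T2 p"
proof (intro cayley_tor.intro cayley_tor_axioms.intro B.cayley_axioms)
  fix x y assume "x \<in> tor G2 p" "y \<in> tor G2 p"
  moreover from this have "x < B.n" "y < B.n" by (simp_all add: tor_def B.in_G)
  ultimately show "x \<otimes>\<^bsub>G2\<^esub> y \<in> tor G2 p" using assms(1) by (simp add: good_def B.tor_ok_def)
qed (use assms in \<open>auto simp: good_def\<close>)

text \<open>The two possible outcomes appear as premises, which separates the treatment of the
  memory from the group theory that justifies the answers.\<close>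

lemma wp_group_to_rep_prog:
  assumes B: "A.n + B.n + 4 \<le> B"
    and comm: "\<And>p q. good p q \<Longrightarrow> cayley_tor G1 T1 p \<and> cayley_tor G2 T2 p"
    and no: "\<And>M'. \<forall>p<A.n + B.n + 4. \<forall>q<A.n + B.n + 4. \<not> good p q \<Longrightarrow> Q M' (encode_rep_pair no_instance)"
    and yes: "\<And>M' p q R1 R2. good p q \<Longrightarrow> cayley_tor.quotient_data G1 p R1 \<Longrightarrow> cayley_tor.quotient_data G2 p R2
      \<Longrightarrow> Q M' (encode_rep_pair (p, R1, R2))"
  shows "wp B group_to_rep_prog Q (init_mem (encode_tables (T1, T2))) []"
proof -
  let ?xs = "encode_tables (T1, T2)"
  let ?M = "init_mem ?xs" and ?L = "A.n + B.n + 4"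
  have xs: "?xs = A.n # B.n # mat_entries T1 @ mat_entries T2" by (simp add: encode_tables_def)
  have row: "x * n + y < n * n" if "x < n" "y < n" for x y n :: nat
    using that mult_le_mono1[of "Suc x" n n] by simp
  have i0: "?M 0 1 = A.n" "?M 0 2 = B.n"
    using init_mem_Suc[of 0 ?xs] init_mem_Suc[of 1 ?xs] by (simp_all add: xs numeral_2_eq_2)
  have i1: "?M 0 (3 + x * A.n + y) = T1 $$ (x, y)" if "x < A.n" "y < A.n" for x y
    using init_mem_Suc[of "2 + (x * A.n + y)" ?xs] row[OF that] mat_entries_nth[of x T1 y] that
    by (simp add: xs nth_append A.square B.square eval_nat_numeral)
  have i2: "?M 0 (3 + A.n * A.n + x * B.n + y) = T2 $$ (x, y)" if "x < B.n" "y < B.n" for x y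
    using init_mem_Suc[of "2 + (A.n * A.n + (x * B.n + y))" ?xs] row[OF that] mat_entries_nth[of x T2 y] that
    by (simp add: xs nth_append A.square B.square eval_nat_numeral add.assoc)
  show ?thesis
    unfolding group_to_rep_prog_def block.simps wp.simps
  proof (rule A.wp_LoadGroup[where \<beta> = 3], goal_cases)
    case (5 M1)
    have f1: "M1 0 = ?M 0" "M1 112 0 = 3 + A.n * A.n" "M1 1 0 = ?L" using 5 i0 by simp_all
    have z1: "M1 a = (\<lambda>_. 0)" if "a \<notin> {0, 1, 104, 112} \<union> writes (LoadGroup 100)" for a
      using 5(1) that by (simp add: init_mem_other)
    show ?case
      unfolding wp.simps
    proof (rule B.wp_LoadGroup[where \<beta> = "3 + A.n * A.n"], goal_cases)
      case (5 M2)
      have L1: "A.loaded M2 100" by (rule A.loaded_frame[OF \<open>A.loaded M1 100\<close>]) (use 5(1) in auto)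
      have L2: "B.loaded M2 200" by (rule 5(2))
      have f2: "M2 1 0 = ?L" using 5(1) f1 by simp
      have z2: "M2 a = (\<lambda>_. 0)" if "a \<notin> {0, 1, 104, 112, 204, 212} \<union> writes (LoadGroup 100) \<union> writes (LoadGroup 200)" for a
        using 5(1) that z1[of a] by simp
      show ?case
        unfolding wp.simps
      proof (rule wp_Sieve[where L = ?L], goal_cases)
        case (4 M3)
        have L1: "A.loaded M3 100" by (rule A.loaded_frame[OF L1]) (use 4(1) in auto)
        have L2: "B.loaded M3 200" by (rule B.loaded_frame[OF L2]) (use 4(1) in auto)
        show ?case
          unfolding wp.simps
        proof (rule wp_SearchPrimes[OF L1 L2, where L = ?L], goal_cases)
          case (7 M4)
          have L1: "A.loaded M4 100" by (rule A.loaded_frame[OF L1]) (use 7(1) in auto)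
          have L2: "B.loaded M4 200" by (rule B.loaded_frame[OF L2]) (use 7(1) in auto)
          have z4: "M4 109 = (\<lambda>_. 0)" "M4 110 = (\<lambda>_. 0)" "M4 134 = (\<lambda>_. 0)" "M4 137 = (\<lambda>_. 0)"
            "M4 209 = (\<lambda>_. 0)" "M4 210 = (\<lambda>_. 0)" "M4 234 = (\<lambda>_. 0)" "M4 237 = (\<lambda>_. 0)"
            using 7(1) 4(1) z2 by simp_all
          show ?case
          proof (cases "M4 9 0 = 0")
            case True
            then have "\<forall>p<?L. \<forall>q<?L. \<not> good p q" using 7(2) by (auto simp: good_def)
            from no[OF this] show ?thesis using True by (simp add: WriteNo_def encode_no_instance)
          next
            case False
            let ?p = "M4 9 0"
            have g: "good ?p (M4 10 0)" and pL: "?p < ?L" using 7(2) False by auto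
            have "cayley_tor G1 T1 ?p" "cayley_tor G2 T2 ?p" using comm[OF g] by auto
            then interpret X: cayley_tor G1 T1 ?p + Y: cayley_tor G2 T2 ?p .
            have "wp B (block [Write (V 9), Assign 101 (V 9), Analyze 100, Assign 201 (V 9), Analyze 200]) Q M4 []"
              unfolding block.simps wp.simps
            proof (rule X.wp_Analyze, goal_cases)
              case 1 show ?case by (rule A.loaded_frame[OF L1]) auto
            next
              case (9 M5 R1)
              have M5: "M5 9 0 = ?p" using 9(1) by simp
              show ?case
                unfolding wp.simps
              proof (rule Y.wp_Analyze, goal_cases)
                case 1 show ?case by (rule B.loaded_frame[OF L2]) (use 9(1) in auto)
              next
                case (9 M6 R2)
                show ?case
                  using yes[OF g \<open>X.quotient_data R1\<close> 9(2)] by (simp add: encode_rep_pair_def)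
              qed (use 9(1) M5 z4 B pL in auto)
            qed (use z4 B pL in auto)
            then show ?thesis using False by simp
          qed
        qed (use 4 f2 z2 B in auto)
      qed (use f2 z2 B in auto)
    qed (use 5 f1 i0 i2 B in auto)
  qed (use i0 i1 B in auto)
qed

end

lemma bit_size_ge_length: "length xs \<le> bit_size xs"
  by (induction xs) (auto simp: bit_size_def)

text \<open>The constant 4 allows loops up to the limit for the primes. In \<open>[:3, 1:]\<close>
  the constant 3 is the size of \<open>no_instance\<close>; the linear term covers the regular case,
  where the size is at most the sum of the orders.\<close>

theorem GroupEpi_reducible: "GroupEpi_on (Coprime ElemAb ElemAb) \<le>\<^sub>p SInducedRepEpivalent"
proof (rule poly_time_reducibleI[where k = 4 and c = group_to_rep_prog and Q = "[:3, 1:]"])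
  fix x assume "x \<in> instances (GroupEpi_on (Coprime ElemAb ElemAb))"
  then obtain T1 T2 where x: "x = (T1, T2)" and T: "cayley_table T1" "cayley_table T2"
    and C: "Coprime ElemAb ElemAb (table_group T1)" "Coprime ElemAb ElemAb (table_group T2)"
    by (auto simp: GroupEpi_on_def restrict_problem_def GroupEpi_def)
  let ?G1 = "table_group T1" and ?G2 = "table_group T2"
  interpret A: cayley ?G1 T1 using T by (simp add: cayley_def cayley_axioms_def cayley_table_def)
  interpret B: cayley ?G2 T2 using T by (simp add: cayley_def cayley_axioms_def cayley_table_def)
  interpret P: cayley_pair ?G1 T1 ?G2 T2 ..
  let ?S = "bit_size (encode_tables (T1, T2))" and ?L = "A.n + B.n + 4"
  have sq: "A.n \<le> A.n * A.n" "B.n \<le> B.n * B.n" by simp_all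
  have "length (encode_tables (T1, T2)) = 2 + A.n * A.n + B.n * B.n"
    by (simp add: encode_tables_def A.square B.square)
  then have S: "A.n + B.n \<le> ?S"
    using bit_size_ge_length[of "encode_tables (T1, T2)"] sq by linarith
  have A_tor: "x \<in> tor ?G1 p \<Longrightarrow> x < A.n" for x p by (simp add: tor_def A.in_G)
  have B_tor: "x \<in> tor ?G2 p \<Longrightarrow> x < B.n" for x p by (simp add: tor_def B.in_G)
  have closed1: "x \<otimes>\<^bsub>?G1\<^esub> y \<in> tor ?G1 p" if "P.good p q" "x \<in> tor ?G1 p" "y \<in> tor ?G1 p" for p q x y
    using that A_tor by (simp add: P.good_def A.tor_ok_def)
  have closed2: "x \<otimes>\<^bsub>?G2\<^esub> y \<in> tor ?G2 p" if "P.good p q" "x \<in> tor ?G2 p" "y \<in> tor ?G2 p" for p q x y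
    using that B_tor by (simp add: P.good_def B.tor_ok_def)
  have expo1: "x [^]\<^bsub>?G1\<^esub> q \<in> tor ?G1 p" if "P.good p q" "x \<in> carrier ?G1" for p q x
    using that by (simp add: P.good_def A.tor_ok_def A.in_G)
  have expo2: "x [^]\<^bsub>?G2\<^esub> q \<in> tor ?G2 p" if "P.good p q" "x \<in> carrier ?G2" for p q x
    using that by (simp add: P.good_def B.tor_ok_def B.in_G)
  have ct: "cayley_tor ?G1 T1 p \<and> cayley_tor ?G2 T2 p" if g: "P.good p q" for p q
  proof
    have pq: "prime p" "prime q" "p \<noteq> q" using g by (simp_all add: P.good_def)
    have "\<exists>K. subgroup K ?G1 \<and> (\<forall>x\<in>K. \<forall>y\<in>K. x \<otimes>\<^bsub>?G1\<^esub> y = y \<otimes>\<^bsub>?G1\<^esub> x) \<and> (\<forall>x\<in>K. x [^]\<^bsub>?G1\<^esub> q = \<one>\<^bsub>?G1\<^esub>)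
      \<and> (\<forall>x\<in>tor ?G1 p. \<forall>y\<in>tor ?G1 p. x \<otimes>\<^bsub>?G1\<^esub> y = y \<otimes>\<^bsub>?G1\<^esub> x)
      \<and> (\<forall>x\<in>carrier ?G1. \<exists>n\<in>tor ?G1 p. \<exists>k\<in>K. x = n \<otimes>\<^bsub>?G1\<^esub> k)"
      by (rule A.tor_complement[OF C(1) pq]) (use closed1[OF g] expo1[OF g] in auto)
    then show "cayley_tor ?G1 T1 p" using P.cayley_tor_left[OF g] by metis
    have "\<exists>K. subgroup K ?G2 \<and> (\<forall>x\<in>K. \<forall>y\<in>K. x \<otimes>\<^bsub>?G2\<^esub> y = y \<otimes>\<^bsub>?G2\<^esub> x) \<and> (\<forall>x\<in>K. x [^]\<^bsub>?G2\<^esub> q = \<one>\<^bsub>?G2\<^esub>)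
      \<and> (\<forall>x\<in>tor ?G2 p. \<forall>y\<in>tor ?G2 p. x \<otimes>\<^bsub>?G2\<^esub> y = y \<otimes>\<^bsub>?G2\<^esub> x)
      \<and> (\<forall>x\<in>carrier ?G2. \<exists>n\<in>tor ?G2 p. \<exists>k\<in>K. x = n \<otimes>\<^bsub>?G2\<^esub> k)"
      by (rule B.tor_complement[OF C(2) pq]) (use closed2[OF g] expo2[OF g] in auto)
    then show "cayley_tor ?G2 T2 p" using P.cayley_tor_right[OF g] by metis
  qed
  \<comment> \<open>The primes of the first group lie below its order plus 4, hence below
    \<open>?L\<close>, and an epimorphism would make them suitable for the second group.\<close>
  have no_epi: "epi ?G1 ?G2 = {}" if none: "\<forall>p<?L. \<forall>q<?L. \<not> P.good p q"
  proof (rule ccontr)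
    assume "epi ?G1 ?G2 \<noteq> {}"
    then obtain f where f: "f \<in> epi ?G1 ?G2" by blast
    obtain p q where pq: "prime p" "prime q" "p \<noteq> q" "p < card (carrier ?G1) + 4" "q < card (carrier ?G1) + 4"
      and cl: "\<forall>x\<in>tor ?G1 p. \<forall>y\<in>tor ?G1 p. x \<otimes>\<^bsub>?G1\<^esub> y \<in> tor ?G1 p"
      and ex: "\<forall>x\<in>carrier ?G1. x [^]\<^bsub>?G1\<^esub> q \<in> tor ?G1 p"
      using A.ex_tor_primes[OF C(1)] by (elim exE conjE) (rule that)
    have cop: "coprime q p" "p > 1" using pq prime_gt_1_nat by (simp_all add: primes_coprime)
    note tr = epi_tor[OF A.is_group B.is_group f cop bspec[OF bspec[OF cl]] bspec[OF ex]]
    have "A.tor_ok p q" using cl ex by (simp add: A.tor_ok_def A.carrier_G)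
    moreover have "B.tor_ok p q" using tr by (simp add: B.tor_ok_def B.carrier_G)
    ultimately have "P.good p q" using pq by (simp add: P.good_def)
    moreover have "p < ?L" "q < ?L" using pq by (simp_all add: A.carrier_G)
    ultimately show False using none by blast
  qed
  let ?Q = "\<lambda>M out. \<exists>y. out = encode SInducedRepEpivalent y \<and> y \<in> instances SInducedRepEpivalent
    \<and> (x \<in> positive (GroupEpi_on (Coprime ElemAb ElemAb)) \<longleftrightarrow> y \<in> positive SInducedRepEpivalent)
    \<and> inst_size SInducedRepEpivalent y \<le> poly [:3, 1:] (inst_size (GroupEpi_on (Coprime ElemAb ElemAb)) x)"
  have "wp (?S + 4) group_to_rep_prog ?Q (init_mem (encode_tables (T1, T2))) []"
  proof (rule P.wp_group_to_rep_prog[OF _ ct], goal_cases)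
    case 1 show ?case using S by simp
  next
    case (3 M')
    show ?case
      using no_epi[OF 3] no_instance_valid no_instance_not_epivalent size_no_instance
      by (intro exI[of _ no_instance])
        (simp add: x SInducedRepEpivalent_def GroupEpi_on_def restrict_problem_def GroupEpi_def)
  next
    case (4 M' p q R1 R2)
    have g: "P.good p q" by (rule 4(1))
    have pq: "prime p" "prime q" "p \<noteq> q" using g by (simp_all add: P.good_def)
    obtain E1 c1 s1 where S1: "split_ext ?G1 p q R1 E1 c1 s1"
      using cayley_tor.split_ext_of_quotient_data[OF conjunct1[OF ct[OF g]] 4(2) C(1) pq(2,3)] expo1[OF g] by metis
    obtain E2 c2 s2 where S2: "split_ext ?G2 p q R2 E2 c2 s2"
      using cayley_tor.split_ext_of_quotient_data[OF conjunct2[OF ct[OF g]] 4(3) C(2) pq(2,3)] expo2[OF g] by metis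
    have "rep_pair_valid (p, R1, R2)"
      using split_ext.is_rep[OF S1] split_ext.is_rep[OF S2] split_ext.elem_ab[OF S1] split_ext.elem_ab[OF S2] pq
      by (auto simp: rep_pair_valid_def)
    moreover have "rep_pair_size (p, R1, R2) \<le> ?S"
      using split_ext.card_le[OF S1] split_ext.card_le[OF S2] S
      by (simp add: rep_pair_size_def A.carrier_G B.carrier_G)
    ultimately show ?case
      using epi_iff_epivalent[OF S1 S2]
      by (intro exI[of _ "(p, R1, R2)"])
        (simp add: x SInducedRepEpivalent_def GroupEpi_on_def restrict_problem_def GroupEpi_def)
  qed
  then show "wp (inst_size (GroupEpi_on (Coprime ElemAb ElemAb)) x + 4) group_to_rep_prog ?Q
      (init_mem (encode (GroupEpi_on (Coprime ElemAb ElemAb)) x)) []"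
    by (simp add: x GroupEpi_on_def restrict_problem_def GroupEpi_def)
qed

theorem theorem2:
  shows "GroupEpi_on (Coprime ElemAb ElemAb) \<le>\<^sub>p SInducedRepEpivalent \<and>
         SInducedRepEpivalent \<le>\<^sub>p GroupEpi_on (Coprime ElemAb ElemAb)"
  using GroupEpi_reducible SInducedRepEpivalent_reducible by blast

end
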